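(* Let $g\ge 1$ and let $S^1\hookrightarrow P\xrightarrow{p}F_g$ be a principal $S^1$-bundle with even Chern class $q$ over the closed oriented surface $F_g$ of genus $g$. Fix generators $x_1,\dots,x_{2g}$ of $\pi_1(F_g)$ and $u_0,u_1,\dots,u_{2g}$ of $\pi_1(P)$ as in the context, and let $s\colon H_1(F_g;\mathbb{Z}_2)\to H_1(P;\mathbb{Z}_2)$ be an associated quadratic section. Then the $s$-action of the symplectic group $Sp(H_1(F_g;\mathbb{Z}_2),\cdot)$ on the set $\mathcal{E}(q)$ of special $2$-fold coverings of $P$ has exactly two orbits, one with $2^{g-1}(2^g+1)$ elements and the other with $2^{g-1}(2^g-1)$ elements. The number of orbits and the number of elements in each orbit do not depend on the quadratic section $s$.
   Context: Setting. $\pi_1(F_g)=\langle x_1,\dots,x_{2g}\mid \prod_{j=1}^g[x_{2j-1},x_{2j}]\rangle$ is the standard presentation. $u_0\in\pi_1(P)$ is the image of a generator of $\pi_1(S^1)$ (the fiber), and $u_i\in\pi_1(P)$, $1\le i\le 2g$, are chosen with $p_\sharp(u_i)=x_i$, so that $\pi_1(P)=\langle u_0,u_1,\dots,u_{2g}\mid [u_i,u_0]\ (1\le i\le 2g),\ \prod_{\ell=1}^g[u_{2\ell-1},u_{2\ell}]\,u_0^{q}\rangle$. Special coverings. $\mathcal{E}(q)$ is the set of homomorphisms $\varphi\colon\pi_1(P)\to\mathbb{Z}_2$ with $\varphi(u_0)=1$ (the nontrivial element of $\mathbb{Z}_2$); these are the monodromies of the special $2$-fold coverings $\pi_\varphi\colon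 E_\varphi\to P$. Let $h_P\colon\pi_1(P)\to H_1(P;\mathbb{Z}_2)$ and $h_{F_g}\colon\pi_1(F_g)\to H_1(F_g;\mathbb{Z}_2)$ be the mod $2$ Hurewicz maps. Each $\varphi\in\mathcal{E}(q)$ factors uniquely as $\varphi=\tilde\varphi\circ h_P$ with $\tilde\varphi\colon H_1(P;\mathbb{Z}_2)\to\mathbb{Z}_2$ linear. Quadratic section. Put $\sigma_i=h_{F_g}(x_i)$ (a symplectic basis of $H_1(F_g;\mathbb{Z}_2)$ for the mod $2$ intersection product "$\cdot$") and $\nu_i=h_P(u_i)$, $0\le i\le 2g$ (a basis of $H_1(P;\mathbb{Z}_2)$). Given $r_1,\dots,r_{2g}\in\mathbb{Z}_2$, the quadratic section $s$ is the unique map $s\colon H_1(F_g;\mathbb{Z}_2)\to H_1(P;\mathbb{Z}_2)$ with $s(\sigma_i)=\nu_i+r_i\nu_0$ for $1\le i\le 2g$ and $s(a+b)=s(a)+s(b)+(a\cdot b)\nu_0$ for all $a,b$. $s$-action. For $f\in Sp(H_1(F_g;\mathbb{Z}_2),\cdot)$, $f_s$ is the linear automorphism of $H_1(P;\mathbb{Z}_2)$ with $f_s(s(\sigma_i))=s(f(\sigma_i))$ for all $1\le i\le 2g$ and $f_s(\nu_0)=\nu_0$; it satisfies $f_s\circ s=s\circ f$. The symplectic group acts on $\mathcal{E}(q)$ (on the right) by $\tilde\varphi\mapsto\tilde\varphi\circ f_s$; thus $\varphi,\varphi'$ are in the same orbit iff $\tilde\varphi=\tilde\varphi'\circ f_s$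 for some symplectic $f$. *)

theory Defs
  imports "HOL-Homology.Homology" "HOL-Complex_Analysis.Winding_Numbers" "HOL-Algebra.Group_Action"
begin

section \<open>Fundamental groups\<close>

text \<open>Classes consist of functions on all of \<open>real\<close>; values outside the unit interval are
  irrelevant for \<^const>\<open>homotopic_paths\<close>.  All spaces are subsets of types of class
  \<^class>\<open>topological_space\<close>.\<close>

definition is_loop :: "'a::topological_space set \<Rightarrow> 'a \<Rightarrow> (real \<Rightarrow> 'a) \<Rightarrow> bool" where
  "is_loop X b \<gamma> \<longleftrightarrow> path \<gamma> \<and> path_image \<gamma> \<subseteq> X \<and> pathstart \<gamma> = b \<and> pathfinish \<gamma> = b"

definition path_class :: "'a::topological_space set \<Rightarrow> (real \<Rightarrow> 'a) \<Rightarrow> (real \<Rightarrow> 'a) set" where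
  "path_class X \<gamma> = {\<delta>. homotopic_paths X \<gamma> \<delta>}"

definition pi1 :: "'a::topological_space set \<Rightarrow> 'a \<Rightarrow> (real \<Rightarrow> 'a) set monoid" where
  "pi1 X b =
    \<lparr>carrier = path_class X ` {\<gamma>. is_loop X b \<gamma>},
     monoid.mult = (\<lambda>A B. \<Union>\<gamma>\<in>A. \<Union>\<delta>\<in>B. path_class X (\<gamma> +++ \<delta>)),
     monoid.one = path_class X (\<lambda>_. b)\<rparr>"

definition pi1_map ::
    "'b::topological_space set \<Rightarrow> ('a \<Rightarrow> 'b) \<Rightarrow> (real \<Rightarrow> 'a) set \<Rightarrow> (real \<Rightarrow> 'b) set" where
  "pi1_map Y f A = (\<Union>\<gamma>\<in>A. path_class Y (f \<circ> \<gamma>))"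

section \<open>Group presentations\<close>

text \<open>A word is a list of syllables; the syllable \<open>(i, n)\<close> stands for the \<open>n\<close>-th power of the
  \<open>i\<close>-th generator.\<close>

type_synonym word = "(nat \<times> int) list"

definition words :: "nat set \<Rightarrow> word set" where
  "words I = lists (I \<times> UNIV)"

definition word_eval :: "('a, 'm) monoid_scheme \<Rightarrow> (nat \<Rightarrow> 'a) \<Rightarrow> word \<Rightarrow> 'a" where
  "word_eval G y w = foldr (\<lambda>(i, n) a. (y i [^]\<^bsub>G\<^esub> n) \<otimes>\<^bsub>G\<^esub> a) w \<one>\<^bsub>G\<^esub>"

inductive word_eq :: "nat set \<Rightarrow> word set \<Rightarrow> word \<Rightarrow> word \<Rightarrow> bool" for I R where
  refl: "v \<in> words I \<Longrightarrow> word_eq I R v v"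
| sym: "word_eq I R v w \<Longrightarrow> word_eq I R w v"
| trans: "word_eq I R u v \<Longrightarrow> word_eq I R v w \<Longrightarrow> word_eq I R u w"
| merge: "i \<in> I \<Longrightarrow> v \<in> words I \<Longrightarrow> w \<in> words I \<Longrightarrow>
    word_eq I R (v @ [(i, m), (i, n)] @ w) (v @ [(i, m + n)] @ w)"
| zero: "i \<in> I \<Longrightarrow> v \<in> words I \<Longrightarrow> w \<in> words I \<Longrightarrow> word_eq I R (v @ [(i, 0)] @ w) (v @ w)"
| relator: "r \<in> R \<Longrightarrow> v \<in> words I \<Longrightarrow> w \<in> words I \<Longrightarrow> word_eq I R (v @ r @ w) (v @ w)"

text \<open>\<open>presented_by G y I R\<close>: sending the generator \<open>i\<close> to \<open>y i\<close> induces an isomorphism from the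
  group presented by the generators \<open>I\<close> and relators \<open>R\<close> onto \<open>G\<close>.\<close>

definition presented_by ::
    "('a, 'm) monoid_scheme \<Rightarrow> (nat \<Rightarrow> 'a) \<Rightarrow> nat set \<Rightarrow> word set \<Rightarrow> bool" where
  "presented_by G y I R \<longleftrightarrow>
    group G \<and> y ` I \<subseteq> carrier G \<and> R \<subseteq> words I \<and>
    word_eval G y ` words I = carrier G \<and>
    (\<forall>v\<in>words I. \<forall>w\<in>words I. word_eval G y v = word_eval G y w \<longleftrightarrow> word_eq I R v w)"

definition commutator_word :: "nat \<Rightarrow> nat \<Rightarrow> word" where
  "commutator_word i j = [(i, 1), (j, 1), (i, -1), (j, -1)]"

definition surface_word :: "nat \<Rightarrow> word" where
  "surface_word g = concat (map (\<lambda>l. commutator_word (2 * l - 1) (2 * l)) [1..<Suc g])"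

definition surface_presentation ::
    "nat \<Rightarrow> ('a, 'm) monoid_scheme \<Rightarrow> (nat \<Rightarrow> 'a) \<Rightarrow> bool" where
  "surface_presentation g G x \<longleftrightarrow> presented_by G x {1..2 * g} {surface_word g}"

definition bundle_presentation ::
    "nat \<Rightarrow> int \<Rightarrow> ('a, 'm) monoid_scheme \<Rightarrow> (nat \<Rightarrow> 'a) \<Rightarrow> bool" where
  "bundle_presentation g q G u \<longleftrightarrow>
    presented_by G u {0..2 * g}
      ((\<lambda>i. commutator_word i 0) ` {1..2 * g} \<union> {surface_word g @ [(0, q)]})"

section \<open>Surfaces and principal circle bundles\<close>

text \<open>For a closed connected surface, orientability is equivalent to the second integral homology
  being infinite cyclic (a generator being an orientation).\<close>

definition closed_orientable_surface :: "'a::t2_space set \<Rightarrow> bool" where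
  "closed_orientable_surface F \<longleftrightarrow>
    F \<noteq> {} \<and> compact F \<and> connected F \<and>
    (\<forall>y\<in>F. \<exists>U V. y \<in> U \<and> openin (top_of_set F) U \<and>
       open (V :: complex set) \<and> U homeomorphic V) \<and>
    homology_group 2 (top_of_set F) \<cong> integer_group"

definition principal_circle_bundle ::
    "'p::topological_space set \<Rightarrow> ('p \<Rightarrow> 'f::topological_space) \<Rightarrow> 'f set \<Rightarrow>
      (complex \<Rightarrow> 'p \<Rightarrow> 'p) \<Rightarrow> bool" where
  "principal_circle_bundle P p F act \<longleftrightarrow>
    continuous_on (sphere 0 1 \<times> P) (\<lambda>(z, e). act z e) \<and>
    (\<forall>z\<in>sphere 0 1. \<forall>e\<in>P. act z e \<in> P) \<and>
    (\<forall>e\<in>P. act 1 e = e) \<and>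
    (\<forall>z\<in>sphere 0 1. \<forall>w\<in>sphere 0 1. \<forall>e\<in>P. act (z * w) e = act z (act w e)) \<and>
    continuous_on P p \<and> p ` P = F \<and>
    (\<forall>y\<in>F. \<exists>U h k. y \<in> U \<and> openin (top_of_set F) U \<and>
       homeomorphism (U \<times> sphere 0 1) (P \<inter> p -` U) h k \<and>
       (\<forall>v\<in>U. \<forall>z\<in>sphere 0 1. p (h (v, z)) = v \<and>
          (\<forall>w\<in>sphere 0 1. act w (h (v, z)) = h (v, w * z))))"

text \<open>The Chern number as the obstruction to a global section: over the complement of an open disc
  and over the closed disc there are sections \<open>s\<close> and \<open>t\<close>, and the Chern number is the degree of
  their difference along the boundary circle.  The embedding \<open>d\<close> of the disc may reverse the
  orientation, so \<open>q\<close> and \<open>-q\<close> are not distinguished here; the sign, which depends on the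
  orientations of base and fibre, is the one in \<^const>\<open>bundle_presentation\<close>.\<close>

definition has_chern_number ::
    "'p::topological_space set \<Rightarrow> ('p \<Rightarrow> 'f::topological_space) \<Rightarrow> 'f set \<Rightarrow>
      (complex \<Rightarrow> 'p \<Rightarrow> 'p) \<Rightarrow> int \<Rightarrow> bool" where
  "has_chern_number P p F act q \<longleftrightarrow>
    (\<exists>d d' s t \<rho>.
      d ` cball 0 1 \<subseteq> F \<and> homeomorphism (cball (0::complex) 1) (d ` cball 0 1) d d' \<and>
      openin (top_of_set F) (d ` ball 0 1) \<and>
      continuous_on (F - d ` ball 0 1) s \<and>
      (\<forall>y\<in>F - d ` ball 0 1. s y \<in> P \<and> p (s y) = y) \<and>
      continuous_on (d ` cball 0 1) t \<and>
      (\<forall>y\<in>d ` cball 0 1. t y \<in> P \<and> p (t y) = y) \<and>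
      continuous_on (sphere 0 1) \<rho> \<and> \<rho> ` sphere 0 1 \<subseteq> sphere (0::complex) 1 \<and>
      (\<forall>z\<in>sphere 0 1. s (d z) = act (\<rho> z) (t (d z))) \<and>
      winding_number (\<rho> \<circ> circlepath 0 1) 0 = of_int q)"

section \<open>Singular homology with coefficients in the integers mod 2\<close>

abbreviation Z2 :: "int monoid" where
  "Z2 \<equiv> integer_mod_group 2"

text \<open>Mod 2 chains are represented by integral chains \<open>c\<close> up to chains of the form \<open>2e\<close>.\<close>

definition mod2_cycle :: "nat \<Rightarrow> 'a topology \<Rightarrow> 'a chain \<Rightarrow> bool" where
  "mod2_cycle n X c \<longleftrightarrow> singular_chain n X c \<and>
    (\<exists>e. singular_chain (n - 1) X e \<and> chain_boundary n c = frag_cmul 2 e)"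

definition mod2_boundary :: "nat \<Rightarrow> 'a topology \<Rightarrow> 'a chain \<Rightarrow> bool" where
  "mod2_boundary n X c \<longleftrightarrow> (\<exists>d e. singular_chain (Suc n) X d \<and> singular_chain n X e \<and>
    c = chain_boundary (Suc n) d + frag_cmul 2 e)"

definition mod2_cycle_group :: "nat \<Rightarrow> 'a topology \<Rightarrow> 'a chain monoid" where
  "mod2_cycle_group n X = subgroup_generated (chain_group n X) (Collect (mod2_cycle n X))"

definition homology_mod2 :: "nat \<Rightarrow> 'a topology \<Rightarrow> 'a chain set monoid" where
  "homology_mod2 n X = mod2_cycle_group n X Mod Collect (mod2_boundary n X)"

definition mod2_class :: "nat \<Rightarrow> 'a topology \<Rightarrow> 'a chain \<Rightarrow> 'a chain set" where
  "mod2_class n X c = Collect (mod2_boundary n X) #>\<^bsub>mod2_cycle_group n X\<^esub> c"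

abbreviation H1 :: "'a::topological_space set \<Rightarrow> 'a chain set monoid" where
  "H1 X \<equiv> homology_mod2 1 (top_of_set X)"

definition path_simplex :: "(real \<Rightarrow> 'a) \<Rightarrow> (nat \<Rightarrow> real) \<Rightarrow> 'a" where
  "path_simplex \<gamma> = restrict (\<lambda>v. \<gamma> (v 1)) (standard_simplex 1)"

definition hurewicz ::
    "'a::topological_space set \<Rightarrow> (real \<Rightarrow> 'a) set \<Rightarrow> 'a chain set" where
  "hurewicz X A = mod2_class 1 (top_of_set X) (frag_of (path_simplex (SOME \<gamma>. \<gamma> \<in> A)))"

section \<open>The mod 2 intersection product\<close>

definition cochain_eval :: "(((nat \<Rightarrow> real) \<Rightarrow> 'a) \<Rightarrow> int) \<Rightarrow> 'a chain \<Rightarrow> int" where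
  "cochain_eval \<alpha> c = (\<Sum>\<tau>\<in>Poly_Mapping.keys c. Poly_Mapping.lookup c \<tau> * \<alpha> \<tau>)"

definition mod2_cocycle1 :: "'a topology \<Rightarrow> (((nat \<Rightarrow> real) \<Rightarrow> 'a) \<Rightarrow> int) \<Rightarrow> bool" where
  "mod2_cocycle1 X \<alpha> \<longleftrightarrow>
    (\<forall>d. singular_chain 2 X d \<longrightarrow> even (cochain_eval \<alpha> (chain_boundary 2 d)))"

text \<open>Cap product of a 2-chain with a 1-cochain: evaluate on the edge from vertex 0 to vertex 1
  (the face opposite to vertex 2) and keep the edge from vertex 1 to vertex 2.\<close>

definition cap21 :: "'a chain \<Rightarrow> (((nat \<Rightarrow> real) \<Rightarrow> 'a) \<Rightarrow> int) \<Rightarrow> 'a chain" where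
  "cap21 z \<alpha> =
    frag_extend (\<lambda>\<tau>. frag_cmul (\<alpha> (singular_face 2 2 \<tau>)) (frag_of (singular_face 2 0 \<tau>))) z"

text \<open>The value of the Poincare dual cocycle \<open>\<alpha>\<close> of \<open>a\<close> on \<open>b\<close>.  The second mod 2 homology of a
  closed connected surface has only one nonzero element, so \<open>z\<close> represents the fundamental
  class.\<close>

definition intersection_product ::
    "'a::topological_space set \<Rightarrow> 'a chain set \<Rightarrow> 'a chain set \<Rightarrow> int" where
  "intersection_product F a b = (THE n.
    \<exists>z \<alpha> c. mod2_cycle 2 (top_of_set F) z \<and> \<not> mod2_boundary 2 (top_of_set F) z \<and>
      mod2_cocycle1 (top_of_set F) \<alpha> \<and> a = mod2_class 1 (top_of_set F) (cap21 z \<alpha>) \<and>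
      c \<in> b \<and> n = cochain_eval \<alpha> c mod 2)"

section \<open>Symplectic groups over the integers mod 2\<close>

text \<open>Vector spaces over the field with two elements are groups of exponent 2 (written
  multiplicatively), and their linear maps are the group homomorphisms.\<close>

definition Z2_basis :: "('a, 'm) monoid_scheme \<Rightarrow> (nat \<Rightarrow> 'a) \<Rightarrow> nat set \<Rightarrow> bool" where
  "Z2_basis H \<sigma> I \<longleftrightarrow> \<sigma> ` I \<subseteq> carrier H \<and>
    bij_betw (\<lambda>c. finprod H (\<lambda>i. \<sigma> i [^]\<^bsub>H\<^esub> c i) I) (I \<rightarrow>\<^sub>E carrier Z2) (carrier H)"

definition Z2_bilinear :: "('a, 'm) monoid_scheme \<Rightarrow> ('a \<Rightarrow> 'a \<Rightarrow> int) \<Rightarrow> bool" where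
  "Z2_bilinear H dot \<longleftrightarrow>
    (\<forall>a\<in>carrier H. dot a \<in> hom H Z2) \<and> (\<forall>b\<in>carrier H. (\<lambda>a. dot a b) \<in> hom H Z2)"

definition symplectic_basis ::
    "('a, 'm) monoid_scheme \<Rightarrow> ('a \<Rightarrow> 'a \<Rightarrow> int) \<Rightarrow> nat \<Rightarrow> (nat \<Rightarrow> 'a) \<Rightarrow> bool" where
  "symplectic_basis H dot g \<sigma> \<longleftrightarrow>
    Z2_bilinear H dot \<and> Z2_basis H \<sigma> {1..2 * g} \<and>
    (\<forall>i\<in>{1..2 * g}. \<forall>j\<in>{1..2 * g}.
       dot (\<sigma> i) (\<sigma> j) = (if \<exists>l\<in>{1..g}. {i, j} = {2 * l - 1, 2 * l} then 1 else 0))"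

definition Sp :: "('a, 'm) monoid_scheme \<Rightarrow> ('a \<Rightarrow> 'a \<Rightarrow> int) \<Rightarrow> ('a \<Rightarrow> 'a) monoid" where
  "Sp H dot = AutoGroup H
    \<lparr>carrier := {f \<in> auto H. \<forall>a\<in>carrier H. \<forall>b\<in>carrier H. dot (f a) (f b) = dot a b}\<rparr>"

section \<open>Special coverings and the action defined by a quadratic section\<close>

text \<open>Monodromies of the special 2-fold coverings; functions are extensional so that each
  homomorphism is counted once.\<close>

definition special_coverings ::
    "('a, 'm) monoid_scheme \<Rightarrow> 'a \<Rightarrow> ('a \<Rightarrow> int) set" where
  "special_coverings G u0 = {\<phi> \<in> hom G Z2 \<inter> extensional (carrier G). \<phi> u0 = 1}"

definition quadratic_section ::
    "('a, 'm) monoid_scheme \<Rightarrow> ('a \<Rightarrow> 'a \<Rightarrow> int) \<Rightarrow> ('b, 'n) monoid_scheme \<Rightarrow> nat \<Rightarrow>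
      (nat \<Rightarrow> 'a) \<Rightarrow> (nat \<Rightarrow> 'b) \<Rightarrow> (nat \<Rightarrow> int) \<Rightarrow> ('a \<Rightarrow> 'b) \<Rightarrow> bool" where
  "quadratic_section HF dot HP g \<sigma> \<nu> r s \<longleftrightarrow>
    r ` {1..2 * g} \<subseteq> carrier Z2 \<and> s \<in> carrier HF \<rightarrow> carrier HP \<and>
    (\<forall>i\<in>{1..2 * g}. s (\<sigma> i) = \<nu> i \<otimes>\<^bsub>HP\<^esub> (\<nu> 0 [^]\<^bsub>HP\<^esub> r i)) \<and>
    (\<forall>a\<in>carrier HF. \<forall>b\<in>carrier HF.
       s (a \<otimes>\<^bsub>HF\<^esub> b) = s a \<otimes>\<^bsub>HP\<^esub> s b \<otimes>\<^bsub>HP\<^esub> (\<nu> 0 [^]\<^bsub>HP\<^esub> dot a b))"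

definition section_lift ::
    "('b, 'n) monoid_scheme \<Rightarrow> nat \<Rightarrow> (nat \<Rightarrow> 'a) \<Rightarrow> (nat \<Rightarrow> 'b) \<Rightarrow> ('a \<Rightarrow> 'b) \<Rightarrow>
      ('a \<Rightarrow> 'a) \<Rightarrow> 'b \<Rightarrow> 'b" where
  "section_lift HP g \<sigma> \<nu> s f = (THE k. k \<in> auto HP \<and> k (\<nu> 0) = \<nu> 0 \<and>
    (\<forall>i\<in>{1..2 * g}. k (s (\<sigma> i)) = s (f (\<sigma> i))))"

text \<open>The linear map through which a homomorphism on \<open>G\<close> factors, for a map \<open>h\<close> from \<open>G\<close> to
  \<open>H\<close>.\<close>

definition linear_factor ::
    "('c, 'm) monoid_scheme \<Rightarrow> ('c \<Rightarrow> 'b) \<Rightarrow> ('b, 'n) monoid_scheme \<Rightarrow> ('c \<Rightarrow> int) \<Rightarrow> 'b \<Rightarrow> int"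
  where
  "linear_factor G h H \<phi> = (THE \<psi>. \<psi> \<in> hom H Z2 \<inter> extensional (carrier H) \<and>
    (\<forall>a\<in>carrier G. \<phi> a = \<psi> (h a)))"

definition s_action ::
    "('c, 'm) monoid_scheme \<Rightarrow> ('c \<Rightarrow> 'b) \<Rightarrow> ('b, 'n) monoid_scheme \<Rightarrow> nat \<Rightarrow> (nat \<Rightarrow> 'a) \<Rightarrow>
      (nat \<Rightarrow> 'b) \<Rightarrow> ('a \<Rightarrow> 'b) \<Rightarrow> ('a \<Rightarrow> 'a) \<Rightarrow> ('c \<Rightarrow> int) \<Rightarrow> 'c \<Rightarrow> int" where
  "s_action G h HP g \<sigma> \<nu> s f \<phi> =
    restrict (linear_factor G h HP \<phi> \<circ> section_lift HP g \<sigma> \<nu> s f \<circ> h) (carrier G)"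

text \<open>This is a right action, but \<^const>\<open>orbits\<close> does not depend on the side.\<close>

abbreviation s_orbits where
  "s_orbits P e u F dot g \<sigma> \<nu> s \<equiv>
    orbits (Sp (H1 F) dot) (special_coverings (pi1 P e) (u (0::nat)))
      (s_action (pi1 P e) (hurewicz P) (H1 P) g \<sigma> \<nu> s)"

end

theory Submission
  imports Defs
begin

text \<open>
  Through a quadratic section, special coverings become quadratic forms.  A special covering is a
  linear form \<open>\<psi>\<close> on the first mod 2 homology of the total space with value 1 on the fibre class.  As
  the section \<open>s\<close> deviates from linearity by the intersection product times the fibre class, the
  composite \<open>\<psi> \<circ> s\<close> is a quadratic form on the homology of the surface which refines the
  intersection product.  This is a bijection onto all such forms (\<open>bij_form\<close>), and it carries the
  \<open>s\<close>-action to the composition of quadratic forms with symplectic maps (\<open>s_action_equivariant\<close>),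
  which does not involve \<open>s\<close> any more.

  The orbits of quadratic forms are classified by the Arf invariant, treated here as the sign of the
  Gauss sum, the number of zeros minus the number of ones.  Fix a form \<open>\<omega>\<close>.  Every other form is \<open>\<omega>\<close>
  plus the product with a vector \<open>v\<close>, and its Gauss sum is that of \<open>\<omega>\<close> times the sign of \<open>\<omega> v\<close>.
  If \<open>\<omega> v = 0\<close>, the transvection along \<open>v\<close> carries \<open>\<omega>\<close> to this form; if \<open>\<omega> v = 1\<close>, the Gauss sums
  differ, because they are nonzero: their squares equal \<open>4 ^ g\<close>.  Hence there are two orbits, in
  bijection with the zeros and with the ones of \<open>\<omega>\<close>, and their sizes follow from the sum \<open>4 ^ g\<close>
  and the difference \<open>\<plusminus>2 ^ g\<close> of these two numbers (\<open>orbits_of_quadratic_forms\<close>).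

  The passage from coverings to linear forms is the mod 2 Hurewicz theorem: for the path connected
  total space the Hurewicz map is a surjective homomorphism, and every homomorphism from the
  fundamental group to the integers mod 2 factors through it (\<open>hurewicz_hom\<close>, \<open>hurewicz_surj\<close>,
  \<open>hurewicz_factor\<close>).  All three rest on one observation, that three paths bound a singular triangle
  exactly when two of them compose to the third up to homotopy.  The presentation of the fundamental
  group shows that the characters of the homology group of the total space may be prescribed on the
  generators; this uses that the Chern number is even (\<open>bundle_presentation_character\<close>).
\<close>

section \<open>Homology modulo 2\<close>

lemma frag_cmul_diff: "frag_cmul k (a - b) = frag_cmul k a - frag_cmul k b"
  by (rule poly_mapping_eqI) (simp add: lookup_minus right_diff_distrib)

lemma mod2_boundary_zero: "mod2_boundary n X 0"
  unfolding mod2_boundary_def by (rule exI[of _ 0], rule exI[of _ 0]) simp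

lemma mod2_boundaryI:
  "singular_chain (Suc n) X d \<Longrightarrow> singular_chain n X e \<Longrightarrow>
    c = chain_boundary (Suc n) d + frag_cmul 2 e \<Longrightarrow> mod2_boundary n X c"
  unfolding mod2_boundary_def by blast

lemma mod2_boundary_add:
  assumes "mod2_boundary n X a" "mod2_boundary n X b"
  shows "mod2_boundary n X (a + b)"
proof -
  obtain d e d' e' where "singular_chain (Suc n) X d" "singular_chain n X e"
    "singular_chain (Suc n) X d'" "singular_chain n X e'"
    "a = chain_boundary (Suc n) d + frag_cmul 2 e" "b = chain_boundary (Suc n) d' + frag_cmul 2 e'"
    using assms unfolding mod2_boundary_def by blast
  then show ?thesis
    by (intro mod2_boundaryI[of n X "d + d'" "e + e'"])
      (simp_all add: singular_chain_add chain_boundary_add frag_cmul_distrib2)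
qed

lemma mod2_boundary_minus:
  assumes "mod2_boundary n X a"
  shows "mod2_boundary n X (- a)"
proof -
  obtain d e where "singular_chain (Suc n) X d" "singular_chain n X e"
    "a = chain_boundary (Suc n) d + frag_cmul 2 e"
    using assms unfolding mod2_boundary_def by blast
  then show ?thesis
    by (intro mod2_boundaryI[of n X "- d" "- e"])
      (use frag_cmul_diff[of 2 0 e] in \<open>simp_all add: singular_chain_minus chain_boundary_minus\<close>)
qed

lemma mod2_boundary_diff:
  "mod2_boundary n X a \<Longrightarrow> mod2_boundary n X b \<Longrightarrow> mod2_boundary n X (a - b)"
  using mod2_boundary_add[of n X a "- b"] mod2_boundary_minus[of n X b] by simp

lemma mod2_boundary_double:
  "singular_chain n X e \<Longrightarrow> mod2_boundary n X (frag_cmul 2 e)"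
  unfolding mod2_boundary_def by (rule exI[of _ 0], rule exI[of _ e]) simp

text \<open>The square of the boundary operator vanishes, so only the term \<open>2e\<close> contributes to the
  boundary of such a chain.\<close>

lemma mod2_boundary_imp_cycle:
  assumes "mod2_boundary n X c"
  shows "mod2_cycle n X c"
proof -
  obtain d e where de: "singular_chain (Suc n) X d" "singular_chain n X e"
    "c = chain_boundary (Suc n) d + frag_cmul 2 e"
    using assms unfolding mod2_boundary_def by blast
  moreover have "chain_boundary n c = frag_cmul 2 (chain_boundary n e)"
    using de by (simp add: chain_boundary_add chain_boundary_cmul chain_boundary_boundary_alt)
  ultimately show ?thesis
    unfolding mod2_cycle_def using singular_chain_boundary[of n X e]
    by (auto intro!: singular_chain_add singular_chain_cmul singular_chain_boundary_alt)
qed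

lemma mod2_cycle_diff:
  assumes "mod2_cycle n X a" "mod2_cycle n X b"
  shows "mod2_cycle n X (a - b)"
proof -
  obtain d e where "singular_chain (n - 1) X d" "singular_chain (n - 1) X e"
    "chain_boundary n a = frag_cmul 2 d" "chain_boundary n b = frag_cmul 2 e"
    using assms unfolding mod2_cycle_def by blast
  then have "singular_chain (n - 1) X (d - e)" "chain_boundary n (a - b) = frag_cmul 2 (d - e)"
    by (simp_all add: chain_boundary_diff frag_cmul_diff singular_chain_diff)
  then show ?thesis
    using assms singular_chain_diff[of n X a b] unfolding mod2_cycle_def by blast
qed

lemma mod2_cycle_add:
  assumes "mod2_cycle n X a" "mod2_cycle n X b"
  shows "mod2_cycle n X (a + b)"
  using mod2_cycle_diff[OF assms(1) mod2_cycle_diff[OF mod2_boundary_imp_cycle[OF mod2_boundary_zero] assms(2)]]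
  by simp

lemma subgroup_mod2_cycles: "subgroup (Collect (mod2_cycle n X)) (chain_group n X)"
proof (rule group.subgroupI)
  show "Collect (mod2_cycle n X) \<noteq> {}"
    using mod2_boundary_imp_cycle[OF mod2_boundary_zero] by blast
  show "Collect (mod2_cycle n X) \<subseteq> carrier (chain_group n X)"
    by (auto simp: mod2_cycle_def singular_chain_def)
  show "a \<otimes>\<^bsub>chain_group n X\<^esub> b \<in> Collect (mod2_cycle n X)"
    if "a \<in> Collect (mod2_cycle n X)" "b \<in> Collect (mod2_cycle n X)" for a b
    using that by (simp add: mod2_cycle_add)
  show "inv\<^bsub>chain_group n X\<^esub> a \<in> Collect (mod2_cycle n X)"
    if "a \<in> Collect (mod2_cycle n X)" for a
    using that mod2_cycle_diff[OF mod2_boundary_imp_cycle[OF mod2_boundary_zero], of n X a]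
    by (simp add: mod2_cycle_def singular_chain_def)
qed simp

lemma carrier_mod2_cycle_group: "carrier (mod2_cycle_group n X) = Collect (mod2_cycle n X)"
  unfolding mod2_cycle_group_def
  using subgroup_mod2_cycles by (rule subgroup.carrier_subgroup_generated_subgroup)

lemma mult_mod2_cycle_group [simp]: "a \<otimes>\<^bsub>mod2_cycle_group n X\<^esub> b = a + b"
  unfolding mod2_cycle_group_def by simp

lemma comm_group_mod2_cycle_group: "comm_group (mod2_cycle_group n X)"
  unfolding mod2_cycle_group_def
  by (simp add: group.abelian_subgroup_generated abelian_chain_group)

text \<open>This is what turns \<^const>\<open>homology_mod2\<close> into a genuine quotient group.\<close>

lemma normal_mod2_boundaries:
  "Collect (mod2_boundary n X) \<lhd> mod2_cycle_group n X"
proof -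
  interpret comm_group "mod2_cycle_group n X" by (rule comm_group_mod2_cycle_group)
  have one: "\<one>\<^bsub>mod2_cycle_group n X\<^esub> = 0"
    unfolding mod2_cycle_group_def by simp
  have "subgroup (Collect (mod2_boundary n X)) (mod2_cycle_group n X)"
  proof (rule subgroupI)
    show "inv\<^bsub>mod2_cycle_group n X\<^esub> a \<in> Collect (mod2_boundary n X)"
      if a: "a \<in> Collect (mod2_boundary n X)" for a
    proof -
      have "inv\<^bsub>mod2_cycle_group n X\<^esub> a = - a"
        by (rule inv_equality)
          (use a mod2_boundary_minus[of n X a] in
            \<open>auto simp: one carrier_mod2_cycle_group mod2_boundary_imp_cycle\<close>)
      then show ?thesis using a mod2_boundary_minus[of n X a] by simp
    qed
  qed (use mod2_boundary_zero in \<open>auto simp: carrier_mod2_cycle_group mod2_boundary_imp_cycle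
        intro: mod2_boundary_add\<close>)
  then show ?thesis by (simp add: normal_iff_subgroup)
qed

lemma mod2_class_memberD:
  assumes "d \<in> mod2_class n X c"
  shows "mod2_boundary n X (d - c)"
  using assms unfolding mod2_class_def r_coset_def by auto

lemma mem_mod2_class: "c \<in> mod2_class n X c"
  using mod2_boundary_zero[of n X] unfolding mod2_class_def r_coset_def by force

lemma mod2_class_eqI:
  assumes "mod2_boundary n X (c - d)"
  shows "mod2_class n X c = mod2_class n X d"
proof -
  have "mod2_boundary n X (y - c) \<longleftrightarrow> mod2_boundary n X (y - d)" for y
    using mod2_boundary_add[of n X "y - c" "c - d"] mod2_boundary_diff[of n X "y - d" "c - d"] assms
    by auto
  moreover have "mod2_class n X a = {y. mod2_boundary n X (y - a)}" for a
    unfolding mod2_class_def r_coset_def by (force intro: exI[of _ "_ - a"])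
  ultimately show ?thesis by simp
qed

lemma carrier_homology_mod2:
  "carrier (homology_mod2 n X) = mod2_class n X ` Collect (mod2_cycle n X)"
  unfolding homology_mod2_def FactGroup_def RCOSETS_def mod2_class_def
  by (auto simp: carrier_mod2_cycle_group)

lemma mult_homology_mod2:
  assumes "mod2_cycle n X c" "mod2_cycle n X d"
  shows "mod2_class n X c \<otimes>\<^bsub>homology_mod2 n X\<^esub> mod2_class n X d = mod2_class n X (c + d)"
  using normal.rcos_sum[OF normal_mod2_boundaries, of c n X d] assms
  unfolding homology_mod2_def FactGroup_def mod2_class_def
  by (simp add: carrier_mod2_cycle_group)

lemma one_homology_mod2: "\<one>\<^bsub>homology_mod2 n X\<^esub> = mod2_class n X 0"
proof -
  have "mod2_class n X 0 = Collect (mod2_boundary n X)"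
    unfolding mod2_class_def r_coset_def by auto
  then show ?thesis
    unfolding homology_mod2_def FactGroup_def by simp
qed

lemma comm_group_homology_mod2: "comm_group (homology_mod2 n X)"
proof -
  have "group (homology_mod2 n X)"
    unfolding homology_mod2_def by (rule normal.factorgroup_is_group[OF normal_mod2_boundaries])
  then show ?thesis
    by (rule group.group_comm_groupI)
      (auto simp: carrier_homology_mod2 mult_homology_mod2 add.commute)
qed

text \<open>Doubles of chains count as boundaries, hence mod 2 homology has exponent 2 and is a vector
  space over the field with two elements.\<close>

lemma homology_mod2_exponent_2:
  assumes "a \<in> carrier (homology_mod2 n X)"
  shows "a \<otimes>\<^bsub>homology_mod2 n X\<^esub> a = \<one>\<^bsub>homology_mod2 n X\<^esub>"
proof -
  obtain c where c: "mod2_cycle n X c" "a = mod2_class n X c"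
    using assms by (auto simp: carrier_homology_mod2)
  have "mod2_boundary n X (frag_cmul 2 c)"
    using c by (intro mod2_boundary_double) (simp add: mod2_cycle_def)
  moreover have "frag_cmul 2 c = c + c"
    using frag_cmul_distrib[of 1 1 c] by simp
  ultimately show ?thesis
    using c by (simp add: mult_homology_mod2 one_homology_mod2 mod2_class_eqI)
qed

section \<open>Triangles and homotopies of paths\<close>

definition segment_point :: "real \<Rightarrow> nat \<Rightarrow> real" where
  "segment_point t = (\<lambda>i. if i = 0 then 1 - t else if i = 1 then t else 0)"

definition edge :: "((nat \<Rightarrow> real) \<Rightarrow> 'a) \<Rightarrow> real \<Rightarrow> 'a" where
  "edge \<tau> t = \<tau> (segment_point t)"

text \<open>This map sweeps the unit square over the standard triangle.  At time \<open>s = 0\<close> it traverses the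
  broken line from vertex 0 over vertex 1 to vertex 2, at time \<open>s = 1\<close> the straight edge from vertex 0
  to vertex 2, and the two end points are kept fixed throughout.  The function \<open>min t (1 - t)\<close> is half
  the barycentric coordinate of vertex 1 along the broken line.  Maps defined on the triangle thus
  correspond to homotopies, with fixed end points, from the broken line to the edge.\<close>

definition sweep :: "real \<times> real \<Rightarrow> nat \<Rightarrow> real" where
  "sweep = (\<lambda>(s, t) i. let m = (1 - s) * min t (1 - t) in
     if i = 0 then 1 - t - m else if i = 1 then 2 * m else if i = 2 then t - m else 0)"

abbreviation simplex_space :: "nat \<Rightarrow> (nat \<Rightarrow> real) topology" where
  "simplex_space n \<equiv> subtopology (powertop_real UNIV) (standard_simplex n)"

abbreviation unit_square :: "(real \<times> real) set" where
  "unit_square \<equiv> {0..1} \<times> {0..1}"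

lemma segment_point_simplex: "t \<in> {0..1} \<Longrightarrow> segment_point t \<in> standard_simplex 1"
  by (auto simp: segment_point_def standard_simplex_def)

lemma simplex_1_cases:
  assumes "v \<in> standard_simplex 1"
  obtains t where "t \<in> {0..1}" "v = segment_point t" "v 1 = t"
proof
  show "v 1 \<in> {0..1}" using assms by (auto simp: standard_simplex_def)
  show "v = segment_point (v 1)"
    using assms by (auto simp: standard_simplex_def segment_point_def fun_eq_iff)
qed simp

lemma continuous_segment_point:
  "continuous_map (top_of_set {0..1}) (simplex_space 1) segment_point"
proof -
  have "continuous_on {0..1} (\<lambda>t. segment_point t i)" for i
    unfolding segment_point_def by (cases "i = 0"; cases "i = 1") (auto intro!: continuous_intros)
  then show ?thesis
    by (auto simp: continuous_map_in_subtopology continuous_map_componentwise_UNIV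
        segment_point_simplex[simplified])
qed

lemma sweep_simplex:
  assumes "st \<in> unit_square"
  shows "sweep st \<in> standard_simplex 2"
proof -
  obtain s t where st: "st = (s, t)" "0 \<le> s" "s \<le> 1" "0 \<le> t" "t \<le> 1" using assms by auto
  define m where "m = (1 - s) * min t (1 - t)"
  have "m \<ge> 0" "m \<le> min t (1 - t)"
    using st mult_left_le_one_le[of "min t (1 - t)" "1 - s"] by (auto simp: m_def)
  then show ?thesis
    using st by (auto simp: sweep_def standard_simplex_def numeral_2_eq_2 m_def[symmetric])
qed

lemma continuous_sweep:
  "continuous_map (top_of_set unit_square) (simplex_space 2) sweep"
proof -
  have "continuous_on unit_square (\<lambda>st. sweep st i)" for i
  proof -
    have eq: "sweep st i = (if i = 0 then 1 - snd st - (1 - fst st) * min (snd st) (1 - snd st)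
      else if i = 1 then 2 * ((1 - fst st) * min (snd st) (1 - snd st))
      else if i = 2 then snd st - (1 - fst st) * min (snd st) (1 - snd st) else 0)" for st
      by (simp add: sweep_def case_prod_beta Let_def)
    show ?thesis
      unfolding eq by (cases "i = 0"; cases "i = 1"; cases "i = 2") (auto intro!: continuous_intros)
  qed
  moreover have "sweep ` unit_square \<subseteq> standard_simplex 2" using sweep_simplex by blast
  ultimately show ?thesis
    by (auto simp: continuous_map_in_subtopology continuous_map_componentwise_UNIV)
qed

lemma sweep_surj:
  assumes "v \<in> standard_simplex 2"
  shows "v \<in> sweep ` unit_square"
proof -
  have v: "v 0 \<ge> 0" "v 1 \<ge> 0" "v 2 \<ge> 0" "v 0 + v 1 + v 2 = 1" "\<And>i. i > 2 \<Longrightarrow> v i = 0"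
    using assms by (auto simp: standard_simplex_def numeral_2_eq_2)
  define t where "t = v 1 / 2 + v 2"
  define m where "m = min t (1 - t)"
  have t: "0 \<le> t" "t \<le> 1" "v 1 \<le> 2 * m"
    using v unfolding t_def m_def min_def by (simp_all add: field_simps)
  \<comment> \<open>If \<open>m = 0\<close> then \<open>v\<close> is vertex 0 or vertex 2, which is hit at every time \<open>s\<close>.\<close>
  define s where "s = (if m = 0 then 0 else 1 - v 1 / (2 * m))"
  have "m \<ge> 0" using t by (auto simp: m_def)
  have "s \<ge> 0" "s \<le> 1" using t v \<open>m \<ge> 0\<close> by (auto simp: s_def field_simps)
  moreover have "2 * ((1 - s) * m) = v 1"
    using t v \<open>m \<ge> 0\<close> by (auto simp: s_def)
  then have "(1 - s) * min t (1 - t) = v 1 / 2" by (simp add: m_def)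
  then have "sweep (s, t) i = (if i = 0 then 1 - t - v 1 / 2 else if i = 1 then v 1
      else if i = 2 then t - v 1 / 2 else 0)" for i
    by (simp add: sweep_def)
  then have "sweep (s, t) i = v i" for i
    using v by (auto simp: t_def)
  then have "sweep (s, t) = v" by auto
  ultimately show ?thesis using t by (force intro: image_eqI[of _ _ "(s, t)"])
qed

text \<open>The only identifications that the sweep makes collapse the sides \<open>t = 0\<close> and \<open>t = 1\<close> of the
  square.  These are exactly the sides on which a homotopy of paths is constant.\<close>

lemma sweep_eqD:
  assumes "sweep (s, t) = sweep (s', t')"
  shows "t = t' \<and> (s = s' \<or> t = 0 \<or> t = 1)"
proof -
  define m where "m = (1 - s) * min t (1 - t)"
  define m' where "m' = (1 - s') * min t' (1 - t')"
  have "1 - t - m = 1 - t' - m'" "2 * m = 2 * m'"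
    using fun_cong[OF assms, of 0] fun_cong[OF assms, of 1]
    by (simp_all add: sweep_def m_def m'_def)
  then have "m = m'" "t = t'" by auto
  then show ?thesis by (auto simp: m_def m'_def min_def split: if_splits)
qed

text \<open>A continuous surjection from a compact space to a Hausdorff space is a quotient map.  This
  makes a function on the triangle continuous as soon as its composite with the sweep is, and so
  avoids an estimate at the two vertices, where an explicit inverse of the sweep is discontinuous.\<close>

lemma quotient_map_sweep:
  "quotient_map (top_of_set unit_square) (simplex_space 2) sweep"
proof (rule continuous_imp_quotient_map[OF continuous_sweep])
  show "compact_space (top_of_set unit_square)"
    by (simp add: compact_space_subtopology compact_Times)
  show "Hausdorff_space (simplex_space 2)"
    by (simp add: Hausdorff_space_subtopology Hausdorff_space_product_topology)
  show "sweep ` topspace (top_of_set unit_square) = topspace (simplex_space 2)"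
    using sweep_surj sweep_simplex by auto
qed

text \<open>The faces opposite to vertices 2 and 0 are the two halves of the broken line, and the face
  opposite to vertex 1 is the final edge of the sweep.\<close>

lemma face_2_segment_point:
  assumes "t \<in> {0..1}"
  shows "simplical_face 2 (segment_point t) = sweep (0, t / 2)"
    "simplical_face 0 (segment_point t) = sweep (0, (t + 1) / 2)"
    "simplical_face 1 (segment_point t) = sweep (1, t)"
proof -
  have m: "min (t / 2) ((2 - t) / 2) = t / 2" "min ((1 + t) / 2) ((1 - t) / 2) = (1 - t) / 2"
    using assms by (auto intro!: min_absorb1 min_absorb2 simp: field_simps)
  show "simplical_face 2 (segment_point t) = sweep (0, t / 2)"
    "simplical_face 0 (segment_point t) = sweep (0, (t + 1) / 2)"
    "simplical_face 1 (segment_point t) = sweep (1, t)"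
    by (auto simp: simplical_face_def segment_point_def sweep_def Let_def m fun_eq_iff field_simps)
qed

lemma edge_face_2:
  assumes "t \<in> {0..1}"
  shows "edge (singular_face 2 2 \<tau>) t = \<tau> (sweep (0, t / 2))"
    "edge (singular_face 2 0 \<tau>) t = \<tau> (sweep (0, (t + 1) / 2))"
    "edge (singular_face 2 1 \<tau>) t = \<tau> (sweep (1, t))"
  using segment_point_simplex[OF assms] face_2_segment_point[OF assms]
  by (simp_all add: edge_def singular_face_def)

lemma sweep_ends:
  "sweep (s, 0) = (\<lambda>i. if i = 0 then 1 else 0)" "sweep (s, 1) = (\<lambda>i. if i = 2 then 1 else 0)"
  by (auto simp: sweep_def)

lemma path_edge:
  assumes "singular_simplex 1 (top_of_set X) \<sigma>"
  shows "path (edge \<sigma>)" "path_image (edge \<sigma>) \<subseteq> X"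
proof -
  have "continuous_map (top_of_set {0..1}) (top_of_set X) (\<sigma> \<circ> segment_point)"
    using assms unfolding singular_simplex_def
    by (intro continuous_map_compose[OF continuous_segment_point]) simp
  moreover have "\<sigma> \<circ> segment_point = edge \<sigma>" by (auto simp: edge_def)
  ultimately show "path (edge \<sigma>)" "path_image (edge \<sigma>) \<subseteq> X"
    by (auto simp: path_def path_image_def continuous_map_in_subtopology)
qed

lemma path_simplex_edge:
  assumes "\<sigma> \<in> extensional (standard_simplex 1)"
  shows "path_simplex (edge \<sigma>) = \<sigma>"
proof
  fix v
  show "path_simplex (edge \<sigma>) v = \<sigma> v"
  proof (cases "v \<in> standard_simplex 1")
    case True
    then obtain t where "t \<in> {0..1}" "v = segment_point t" "v 1 = t" by (rule simplex_1_cases)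
    then show ?thesis using True by (simp add: path_simplex_def edge_def)
  next
    case False
    then show ?thesis
      using assms by (simp add: path_simplex_def extensional_def)
  qed
qed

lemma edge_path_simplex: "t \<in> {0..1} \<Longrightarrow> edge (path_simplex \<gamma>) t = \<gamma> t"
  by (simp add: edge_def path_simplex_def segment_point_simplex[simplified])
    (simp add: segment_point_def)

lemma singular_simplex_path_simplex:
  assumes "path \<gamma>" "path_image \<gamma> \<subseteq> X"
  shows "singular_simplex 1 (top_of_set X) (path_simplex \<gamma>)"
proof -
  have "continuous_map (simplex_space 1) (top_of_set {0..1}) (\<lambda>v. v 1)"
    by (auto simp: continuous_map_in_subtopology standard_simplex_def
        intro!: continuous_map_from_subtopology continuous_map_product_projection)
  moreover have "continuous_map (top_of_set {0..1}) (top_of_set X) \<gamma>"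
    using assms by (auto simp: path_def path_image_def continuous_map_in_subtopology)
  ultimately have "continuous_map (simplex_space 1) (top_of_set X) (\<gamma> \<circ> (\<lambda>v. v 1))"
    by (rule continuous_map_compose)
  then show ?thesis
    unfolding singular_simplex_def path_simplex_def
    by (auto intro: continuous_map_eq)
qed

text \<open>Composing a singular triangle with the sweep gives a homotopy across the triangle.\<close>

lemma singular_2_simplex_imp_homotopic:
  assumes "singular_simplex 2 (top_of_set X) \<tau>"
  shows "homotopic_paths X (edge (singular_face 2 2 \<tau>) +++ edge (singular_face 2 0 \<tau>))
    (edge (singular_face 2 1 \<tau>))"
proof -
  have "continuous_map (top_of_set unit_square) (top_of_set X) (\<tau> \<circ> sweep)"
    using assms unfolding singular_simplex_def
    by (intro continuous_map_compose[OF continuous_sweep]) simp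
  then have "continuous_on unit_square (\<tau> \<circ> sweep)" "(\<tau> \<circ> sweep) \<in> unit_square \<rightarrow> X"
    by (auto simp: continuous_map_in_subtopology)
  moreover have "(edge (singular_face 2 2 \<tau>) +++ edge (singular_face 2 0 \<tau>)) t = \<tau> (sweep (0, t))"
    if "t \<in> {0..1}" for t
    using that by (auto simp: joinpaths_def edge_face_2)
  ultimately show ?thesis
    unfolding homotopic_paths
    by (intro exI[of _ "\<tau> \<circ> sweep"])
      (auto simp: edge_face_2 pathstart_def pathfinish_def sweep_ends simp del: One_nat_def)
qed

text \<open>Conversely a homotopy is constant on the sides that the sweep collapses, so it descends to a
  singular triangle.  Together the two lemmas say that three paths bound a singular triangle exactly
  when they satisfy the corresponding relation in the fundamental groupoid; every comparison of
  homotopy with homology below reduces to this.\<close>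

lemma homotopic_imp_singular_2_simplex:
  assumes hom: "homotopic_paths X (\<gamma> +++ \<delta>) \<epsilon>" and mid: "pathfinish \<gamma> = pathstart \<delta>"
  obtains \<tau> where "singular_simplex 2 (top_of_set X) \<tau>"
    "singular_face 2 2 \<tau> = path_simplex \<gamma>" "singular_face 2 0 \<tau> = path_simplex \<delta>"
    "singular_face 2 1 \<tau> = path_simplex \<epsilon>"
proof -
  obtain h where h: "continuous_on unit_square h" "h \<in> unit_square \<rightarrow> X"
    "\<And>t. t \<in> {0..1} \<Longrightarrow> h (0, t) = (\<gamma> +++ \<delta>) t" "\<And>t. t \<in> {0..1} \<Longrightarrow> h (1, t) = \<epsilon> t"
    "\<And>s. s \<in> {0..1} \<Longrightarrow> h (s, 0) = h (0, 0)" "\<And>s. s \<in> {0..1} \<Longrightarrow> h (s, 1) = h (0, 1)"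
    using hom unfolding homotopic_paths by (auto simp: pathstart_def pathfinish_def)
  define \<tau> where "\<tau> = restrict (h \<circ> inv_into unit_square sweep) (standard_simplex 2)"
  have \<tau>: "\<tau> (sweep st) = h st" if st: "st \<in> unit_square" for st
  proof -
    obtain s t where 1: "st = (s, t)" by force
    obtain s' t' where 2: "inv_into unit_square sweep (sweep st) = (s', t')" by force
    have "(s', t') \<in> unit_square"
      unfolding 2[symmetric] using st by (intro inv_into_into imageI)
    moreover have "sweep (s', t') = sweep (s, t)"
      unfolding 2[symmetric] unfolding 1[symmetric] using st by (intro f_inv_into_f imageI)
    then have "t' = t" "s' = s \<or> t = 0 \<or> t = 1" using sweep_eqD by blast+
    moreover have "s \<in> {0..1}" using st 1 by simp
    ultimately have "h (s', t') = h (s, t)"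
      using h(5)[of s] h(5)[of s'] h(6)[of s] h(6)[of s'] by (elim disjE) simp_all
    then have "h (inv_into unit_square sweep (sweep st)) = h st" by (simp only: 1 2[unfolded 1])
    then show ?thesis using sweep_simplex[OF st] by (simp add: \<tau>_def)
  qed
  have "continuous_map (top_of_set unit_square) (top_of_set X) h"
    using h by (auto simp: continuous_map_in_subtopology)
  then have "continuous_map (top_of_set unit_square) (top_of_set X) (\<tau> \<circ> sweep)"
    by (rule continuous_map_eq) (simp add: \<tau>)
  then have "continuous_map (simplex_space 2) (top_of_set X) \<tau>"
    by (rule continuous_compose_quotient_map[OF quotient_map_sweep])
  then have "singular_simplex 2 (top_of_set X) \<tau>"
    by (simp add: singular_simplex_def \<tau>_def)
  moreover have face: "singular_face 2 k \<tau> = path_simplex \<zeta>"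
    if "\<And>t. t \<in> {0..1} \<Longrightarrow> \<tau> (simplical_face k (segment_point t)) = \<zeta> t" for k \<zeta>
  proof
    fix v
    show "singular_face 2 k \<tau> v = path_simplex \<zeta> v"
    proof (cases "v \<in> standard_simplex 1")
      case True
      then obtain t where "t \<in> {0..1}" "v = segment_point t" "v 1 = t" by (rule simplex_1_cases)
      then show ?thesis
        using True that by (simp add: path_simplex_def singular_face_def)
    qed (simp add: path_simplex_def singular_face_def)
  qed
  have "singular_face 2 2 \<tau> = path_simplex \<gamma>"
    by (rule face) (simp add: face_2_segment_point \<tau> h joinpaths_def)
  moreover have "singular_face 2 0 \<tau> = path_simplex \<delta>"
  proof (rule face)
    fix t :: real assume t: "t \<in> {0..1}"
    have "(\<gamma> +++ \<delta>) ((t + 1) / 2) = \<delta> t"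
      using t mid by (auto simp: joinpaths_def pathfinish_def pathstart_def add_divide_distrib)
    then show "\<tau> (simplical_face 0 (segment_point t)) = \<delta> t"
      using t by (simp add: face_2_segment_point \<tau> h)
  qed
  moreover have "singular_face 2 1 \<tau> = path_simplex \<epsilon>"
    by (rule face) (simp add: face_2_segment_point \<tau> h del: One_nat_def)
  ultimately show ?thesis by (rule that)
qed

lemma chain_boundary_2:
  "chain_boundary 2 (frag_of \<tau>) = frag_of (singular_face 2 0 \<tau>) - frag_of (singular_face 2 1 \<tau>)
     + frag_of (singular_face 2 2 \<tau>)"
  by (simp add: chain_boundary_of numeral_2_eq_2)

section \<open>Calculus of paths\<close>

text \<open>Subpaths of the identity path of the unit interval can be joined up to homotopy because the
  interval is convex, and a path in any space transports this homotopy.  The choices \<open>(0, 1, 1)\<close>,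
  \<open>(0, 0, 1)\<close> and \<open>(0, 1, 0)\<close> give the two unit laws and the inverse law of the fundamental groupoid,
  for spaces without a linear structure.\<close>

lemma homotopic_paths_subpaths:
  fixes \<gamma> :: "real \<Rightarrow> 'a::topological_space"
  assumes \<gamma>: "path \<gamma>" "path_image \<gamma> \<subseteq> X" and "u \<in> {0..1}" "v \<in> {0..1}" "w \<in> {0..1}"
  shows "homotopic_paths X ((\<gamma> \<circ> subpath u v id) +++ (\<gamma> \<circ> subpath v w id))
    (\<gamma> \<circ> subpath u w id)"
proof -
  have "homotopic_paths {0..1::real} (subpath u v id +++ subpath v w id) (subpath u w id)"
    using assms(3-5) by (intro homotopic_join_subpaths) (auto simp: path_def path_image_def)
  then have "homotopic_paths X (\<gamma> \<circ> (subpath u v id +++ subpath v w id)) (\<gamma> \<circ> subpath u w id)"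
    by (rule homotopic_paths_continuous_image) (use \<gamma> in \<open>auto simp: path_def path_image_def\<close>)
  then show ?thesis by (simp add: path_compose_join)
qed

definition path_from_to :: "'a::topological_space set \<Rightarrow> 'a \<Rightarrow> 'a \<Rightarrow> (real \<Rightarrow> 'a) \<Rightarrow> bool" where
  "path_from_to X x y \<gamma> \<longleftrightarrow>
    path \<gamma> \<and> path_image \<gamma> \<subseteq> X \<and> pathstart \<gamma> = x \<and> pathfinish \<gamma> = y"

lemma path_from_to_join:
  "path_from_to X x y \<gamma> \<Longrightarrow> path_from_to X y z \<delta> \<Longrightarrow> path_from_to X x z (\<gamma> +++ \<delta>)"
  by (auto simp: path_from_to_def path_image_join)

lemma path_from_to_reverse: "path_from_to X x y \<gamma> \<Longrightarrow> path_from_to X y x (reversepath \<gamma>)"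
  by (auto simp: path_from_to_def)

lemma path_from_to_const: "x \<in> X \<Longrightarrow> path_from_to X x x (\<lambda>_. x)"
  by (auto simp: path_from_to_def path_def path_image_def pathstart_def pathfinish_def)

lemma path_from_to_mem: "path_from_to X x y \<gamma> \<Longrightarrow> x \<in> X \<and> y \<in> X"
  unfolding path_from_to_def using pathstart_in_path_image pathfinish_in_path_image by blast

lemma is_loop_iff: "is_loop X b \<gamma> \<longleftrightarrow> path_from_to X b b \<gamma>"
  by (simp add: is_loop_def path_from_to_def)

lemma path_from_to_homotopic:
  "homotopic_paths X \<gamma> \<delta> \<Longrightarrow> path_from_to X x y \<gamma> \<Longrightarrow> path_from_to X x y \<delta>"
  unfolding path_from_to_def
  using homotopic_paths_imp_path homotopic_paths_imp_subset
    homotopic_paths_imp_pathstart homotopic_paths_imp_pathfinish by metis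

lemma homotopic_paths_const_right:
  "path_from_to X x y \<gamma> \<Longrightarrow> homotopic_paths X (\<gamma> +++ (\<lambda>_. y)) \<gamma>"
  using homotopic_paths_subpaths[of \<gamma> X 0 1 1]
  by (auto simp: path_from_to_def pathfinish_def subpath_def comp_def)

lemma homotopic_paths_const_left:
  "path_from_to X x y \<gamma> \<Longrightarrow> homotopic_paths X ((\<lambda>_. x) +++ \<gamma>) \<gamma>"
  using homotopic_paths_subpaths[of \<gamma> X 0 0 1]
  by (auto simp: path_from_to_def pathstart_def subpath_def comp_def)

lemma homotopic_paths_inverse_right:
  "path_from_to X x y \<gamma> \<Longrightarrow> homotopic_paths X (\<gamma> +++ reversepath \<gamma>) (\<lambda>_. x)"
  using homotopic_paths_subpaths[of \<gamma> X 0 1 0]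
  by (auto simp: path_from_to_def pathstart_def subpath_def reversepath_def comp_def)

lemma homotopic_paths_inverse_left:
  "path_from_to X x y \<gamma> \<Longrightarrow> homotopic_paths X (reversepath \<gamma> +++ \<gamma>) (\<lambda>_. y)"
  using homotopic_paths_inverse_right[OF path_from_to_reverse] by fastforce

lemma homotopic_paths_join_assoc:
  assumes "path_from_to X w x \<alpha>" "path_from_to X x y \<beta>" "path_from_to X y z \<gamma>"
  shows "homotopic_paths X (\<alpha> +++ (\<beta> +++ \<gamma>)) ((\<alpha> +++ \<beta>) +++ \<gamma>)"
  using assms by (intro homotopic_paths_assoc) (auto simp: path_from_to_def)

lemma homotopic_paths_join_left:
  assumes "homotopic_paths X \<alpha> \<alpha>'" "path_from_to X x y \<alpha>" "path_from_to X y z \<beta>"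
  shows "homotopic_paths X (\<alpha> +++ \<beta>) (\<alpha>' +++ \<beta>)"
  using assms by (intro homotopic_paths_join) (auto simp: path_from_to_def)

lemma homotopic_paths_join_right:
  assumes "homotopic_paths X \<beta> \<beta>'" "path_from_to X x y \<alpha>" "path_from_to X y z \<beta>"
  shows "homotopic_paths X (\<alpha> +++ \<beta>) (\<alpha> +++ \<beta>')"
  using assms by (intro homotopic_paths_join) (auto simp: path_from_to_def)

lemma homotopic_paths_cancel:
  assumes \<alpha>: "path_from_to X w x \<alpha>" and \<kappa>: "path_from_to X v x \<kappa>" and \<beta>: "path_from_to X x z \<beta>"
  shows "homotopic_paths X ((\<alpha> +++ reversepath \<kappa>) +++ (\<kappa> +++ \<beta>)) (\<alpha> +++ \<beta>)"
proof -
  note r = path_from_to_reverse[OF \<kappa>]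
  note [trans] = homotopic_paths_trans
  have "homotopic_paths X ((\<alpha> +++ reversepath \<kappa>) +++ (\<kappa> +++ \<beta>))
      (\<alpha> +++ (reversepath \<kappa> +++ (\<kappa> +++ \<beta>)))"
    using homotopic_paths_join_assoc[OF \<alpha> r path_from_to_join[OF \<kappa> \<beta>]]
    by (rule homotopic_paths_sym)
  also have "homotopic_paths X (\<alpha> +++ (reversepath \<kappa> +++ (\<kappa> +++ \<beta>)))
      (\<alpha> +++ ((reversepath \<kappa> +++ \<kappa>) +++ \<beta>))"
    using homotopic_paths_join_assoc[OF r \<kappa> \<beta>] \<alpha>
      path_from_to_join[OF r path_from_to_join[OF \<kappa> \<beta>]]
    by (rule homotopic_paths_join_right)
  also have "homotopic_paths X (\<alpha> +++ ((reversepath \<kappa> +++ \<kappa>) +++ \<beta>)) (\<alpha> +++ ((\<lambda>_. x) +++ \<beta>))"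
    using homotopic_paths_join_left[OF homotopic_paths_inverse_left[OF \<kappa>] path_from_to_join[OF r \<kappa>] \<beta>]
      \<alpha> path_from_to_join[OF path_from_to_join[OF r \<kappa>] \<beta>]
    by (rule homotopic_paths_join_right)
  also have "homotopic_paths X (\<alpha> +++ ((\<lambda>_. x) +++ \<beta>)) (\<alpha> +++ \<beta>)"
    using homotopic_paths_const_left[OF \<beta>] \<alpha>
      path_from_to_join[OF path_from_to_const \<beta>] path_from_to_mem[OF \<beta>]
    by (intro homotopic_paths_join_right) auto
  finally show ?thesis .
qed

text \<open>Closing up paths to loops by fixed base paths turns composition of paths into composition of
  loops.\<close>

lemma homotopic_paths_conjugate_join:
  assumes \<kappa>: "path_from_to X b x \<kappa>" and \<mu>: "path_from_to X b y \<mu>" and \<nu>: "path_from_to X b z \<nu>"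
    and p: "path_from_to X x y p" and q: "path_from_to X y z q"
    and r: "homotopic_paths X (p +++ q) r"
  shows "homotopic_paths X (((\<kappa> +++ p) +++ reversepath \<mu>) +++ ((\<mu> +++ q) +++ reversepath \<nu>))
    ((\<kappa> +++ r) +++ reversepath \<nu>)"
proof -
  note n = path_from_to_reverse[OF \<nu>]
  note [trans] = homotopic_paths_trans
  note j = path_from_to_join
  have "homotopic_paths X (((\<kappa> +++ p) +++ reversepath \<mu>) +++ ((\<mu> +++ q) +++ reversepath \<nu>))
    (((\<kappa> +++ p) +++ reversepath \<mu>) +++ (\<mu> +++ (q +++ reversepath \<nu>)))"
    using homotopic_paths_sym[OF homotopic_paths_join_assoc[OF \<mu> q n]]
      j[OF j[OF \<kappa> p] path_from_to_reverse[OF \<mu>]] j[OF j[OF \<mu> q] n]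
    by (rule homotopic_paths_join_right)
  also have "homotopic_paths X (((\<kappa> +++ p) +++ reversepath \<mu>) +++ (\<mu> +++ (q +++ reversepath \<nu>)))
    ((\<kappa> +++ p) +++ (q +++ reversepath \<nu>))"
    using j[OF \<kappa> p] \<mu> j[OF q n] by (rule homotopic_paths_cancel)
  also have "homotopic_paths X ((\<kappa> +++ p) +++ (q +++ reversepath \<nu>))
    (((\<kappa> +++ p) +++ q) +++ reversepath \<nu>)"
    using j[OF \<kappa> p] q n by (rule homotopic_paths_join_assoc)
  also have "homotopic_paths X (((\<kappa> +++ p) +++ q) +++ reversepath \<nu>)
    ((\<kappa> +++ (p +++ q)) +++ reversepath \<nu>)"
    using homotopic_paths_sym[OF homotopic_paths_join_assoc[OF \<kappa> p q]] j[OF j[OF \<kappa> p] q] n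
    by (rule homotopic_paths_join_left)
  also have "homotopic_paths X ((\<kappa> +++ (p +++ q)) +++ reversepath \<nu>) ((\<kappa> +++ r) +++ reversepath \<nu>)"
    using homotopic_paths_join_right[OF r \<kappa> j[OF p q]] j[OF \<kappa> j[OF p q]] n
    by (rule homotopic_paths_join_left)
  finally show ?thesis .
qed

section \<open>The fundamental group\<close>

lemma path_class_eq_iff:
  assumes "path_from_to X x y \<gamma>"
  shows "path_class X \<gamma> = path_class X \<delta> \<longleftrightarrow> homotopic_paths X \<gamma> \<delta>"
proof
  have "\<gamma> \<in> path_class X \<gamma>" using assms by (simp add: path_class_def path_from_to_def)
  then show "homotopic_paths X \<gamma> \<delta>" if "path_class X \<gamma> = path_class X \<delta>"
    using that homotopic_paths_sym[of X \<delta> \<gamma>] unfolding that by (simp add: path_class_def)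
  show "path_class X \<gamma> = path_class X \<delta>" if "homotopic_paths X \<gamma> \<delta>"
    using that homotopic_paths_sym homotopic_paths_trans unfolding path_class_def by blast
qed

lemma carrier_pi1: "carrier (pi1 X b) = path_class X ` {\<gamma>. path_from_to X b b \<gamma>}"
  by (simp add: pi1_def is_loop_iff)

lemma pi1_class_carrier: "path_from_to X b b \<gamma> \<Longrightarrow> path_class X \<gamma> \<in> carrier (pi1 X b)"
  by (simp add: carrier_pi1)

lemma mult_pi1:
  assumes "path_from_to X b b \<gamma>" "path_from_to X b b \<delta>"
  shows "path_class X \<gamma> \<otimes>\<^bsub>pi1 X b\<^esub> path_class X \<delta> = path_class X (\<gamma> +++ \<delta>)"
proof -
  have "path_class X (\<gamma>' +++ \<delta>') = path_class X (\<gamma> +++ \<delta>)"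
    if "\<gamma>' \<in> path_class X \<gamma>" "\<delta>' \<in> path_class X \<delta>" for \<gamma>' \<delta>'
  proof -
    have "homotopic_paths X (\<gamma> +++ \<delta>) (\<gamma>' +++ \<delta>')"
      using that assms by (intro homotopic_paths_join) (auto simp: path_class_def path_from_to_def)
    then show ?thesis
      by (rule path_class_eq_iff[OF path_from_to_join[OF assms], THEN iffD2, symmetric])
  qed
  moreover have "\<gamma> \<in> path_class X \<gamma>" "\<delta> \<in> path_class X \<delta>"
    using assms by (auto simp: path_class_def path_from_to_def)
  ultimately have "(\<Union>\<gamma>'\<in>path_class X \<gamma>. \<Union>\<delta>'\<in>path_class X \<delta>. path_class X (\<gamma>' +++ \<delta>'))
     = path_class X (\<gamma> +++ \<delta>)"
    by blast
  then show ?thesis by (simp add: pi1_def)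
qed

section \<open>The mod 2 Hurewicz homomorphism\<close>

abbreviation path_chain :: "(real \<Rightarrow> 'a) \<Rightarrow> 'a chain" where
  "path_chain \<gamma> \<equiv> frag_of (path_simplex \<gamma>)"

text \<open>The boundary of the singular triangle that fills the homotopy is the stated sum.\<close>

lemma triangle_mod2_boundary:
  assumes "homotopic_paths X (\<gamma> +++ \<delta>) \<epsilon>" "pathfinish \<gamma> = pathstart \<delta>"
  shows "mod2_boundary 1 (top_of_set X) (path_chain \<gamma> + path_chain \<delta> - path_chain \<epsilon>)"
proof -
  obtain \<tau> where "singular_simplex 2 (top_of_set X) \<tau>"
    "singular_face 2 2 \<tau> = path_simplex \<gamma>" "singular_face 2 0 \<tau> = path_simplex \<delta>"
    "singular_face 2 1 \<tau> = path_simplex \<epsilon>"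
    using homotopic_imp_singular_2_simplex[OF assms] .
  then show ?thesis
    by (intro mod2_boundaryI[of _ _ "frag_of \<tau>" 0])
      (simp_all add: singular_chain_of chain_boundary_2 flip: numeral_2_eq_2)
qed

lemma join_mod2_boundary:
  assumes "path_from_to X x y \<gamma>" "path_from_to X y z \<delta>"
  shows "mod2_boundary 1 (top_of_set X)
    (path_chain \<gamma> + path_chain \<delta> - path_chain (\<gamma> +++ \<delta>))"
  using assms path_from_to_join[OF assms]
  by (intro triangle_mod2_boundary) (auto simp: path_from_to_def)

text \<open>The triangle for the relation \<open>const +++ const \<simeq> const\<close> has a single constant path as the
  alternating sum of its faces.\<close>

lemma const_mod2_boundary:
  assumes "x \<in> X"
  shows "mod2_boundary 1 (top_of_set X) (path_chain (\<lambda>_. x))"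
  using triangle_mod2_boundary[OF homotopic_paths_const_right[OF path_from_to_const[OF assms]]]
  by (simp add: pathstart_def pathfinish_def)

lemma inverse_mod2_boundary:
  assumes "path_from_to X x y \<gamma>"
  shows "mod2_boundary 1 (top_of_set X) (path_chain \<gamma> + path_chain (reversepath \<gamma>))"
  using mod2_boundary_add[OF triangle_mod2_boundary[OF homotopic_paths_inverse_right[OF assms]]
      const_mod2_boundary[of x]] path_from_to_mem[OF assms] by simp

text \<open>A homotopy \<open>\<gamma> \<simeq> \<delta>\<close> is regarded as a triangle with sides \<open>\<gamma>\<close>, a constant path and \<open>\<delta>\<close>.
  Consequently the Hurewicz map is well defined on homotopy classes.\<close>

lemma homotopic_mod2_boundary:
  assumes "homotopic_paths X \<gamma> \<delta>" "path_from_to X x y \<gamma>"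
  shows "mod2_boundary 1 (top_of_set X) (path_chain \<gamma> - path_chain \<delta>)"
proof -
  have y: "y \<in> X" using path_from_to_mem[OF assms(2)] by simp
  have "homotopic_paths X (\<gamma> +++ (\<lambda>_. y)) \<delta>"
    using homotopic_paths_const_right[OF assms(2)] assms(1) by (rule homotopic_paths_trans)
  then have "mod2_boundary 1 (top_of_set X) (path_chain \<gamma> + path_chain (\<lambda>_. y) - path_chain \<delta>)"
    using assms(2) by (intro triangle_mod2_boundary) (simp_all add: path_from_to_def pathstart_def)
  from mod2_boundary_diff[OF this const_mod2_boundary[OF y]] show ?thesis by simp
qed

lemma singular_face_1:
  "singular_face 1 0 \<sigma> = (\<lambda>_\<in>standard_simplex 0. edge \<sigma> 1)"
  "singular_face 1 1 \<sigma> = (\<lambda>_\<in>standard_simplex 0. edge \<sigma> 0)"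
proof -
  have "simplical_face 0 (\<lambda>j::nat. if j = 0 then 1 else 0) = segment_point 1"
    "simplical_face 1 (\<lambda>j::nat. if j = 0 then 1 else 0) = segment_point 0"
    by (auto simp: simplical_face_def segment_point_def)
  then show "singular_face 1 0 \<sigma> = (\<lambda>_\<in>standard_simplex 0. edge \<sigma> 1)"
    "singular_face 1 1 \<sigma> = (\<lambda>_\<in>standard_simplex 0. edge \<sigma> 0)"
    by (auto simp: singular_face_def edge_def standard_simplex_0 intro!: restrict_ext)
qed

lemma chain_boundary_1:
  "chain_boundary 1 (frag_of \<sigma>) = frag_of (\<lambda>_\<in>standard_simplex 0. edge \<sigma> 1)
     - frag_of (\<lambda>_\<in>standard_simplex 0. edge \<sigma> 0)"
  using singular_face_1[of \<sigma>] by (simp add: chain_boundary_of)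

lemma loop_mod2_cycle:
  assumes "path_from_to X b b \<gamma>"
  shows "mod2_cycle 1 (top_of_set X) (path_chain \<gamma>)"
proof -
  have "edge (path_simplex \<gamma>) 1 = b" "edge (path_simplex \<gamma>) 0 = b"
    using assms by (simp_all add: edge_path_simplex path_from_to_def pathstart_def pathfinish_def)
  then have "chain_boundary 1 (path_chain \<gamma>) = frag_cmul 2 0"
    using chain_boundary_1[of "path_simplex \<gamma>"] by simp
  moreover have "singular_chain 1 (top_of_set X) (path_chain \<gamma>)"
    unfolding singular_chain_of using assms singular_simplex_path_simplex
    unfolding path_from_to_def by blast
  ultimately show ?thesis unfolding mod2_cycle_def by (intro conjI exI[of _ 0]) auto
qed

lemma hurewicz_path_class:
  assumes "path_from_to X b b \<gamma>"
  shows "hurewicz X (path_class X \<gamma>) = mod2_class 1 (top_of_set X) (path_chain \<gamma>)"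
proof -
  have "\<gamma> \<in> path_class X \<gamma>" using assms by (simp add: path_class_def path_from_to_def)
  then have "(SOME \<delta>. \<delta> \<in> path_class X \<gamma>) \<in> path_class X \<gamma>" 
    by (rule someI[of "\<lambda>\<delta>. \<delta> \<in> path_class X \<gamma>"])
  then have "homotopic_paths X \<gamma> (SOME \<delta>. \<delta> \<in> path_class X \<gamma>)" by (simp add: path_class_def)
  from mod2_class_eqI[OF homotopic_mod2_boundary[OF this assms]]
  show ?thesis unfolding hurewicz_def by simp
qed

lemma hurewicz_hom: "hurewicz X \<in> hom (pi1 X b) (H1 X)"
proof (rule homI)
  fix A B assume "A \<in> carrier (pi1 X b)" "B \<in> carrier (pi1 X b)"
  then obtain \<gamma> \<delta> where AB: "A = path_class X \<gamma>" "B = path_class X \<delta>"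
    and loops: "path_from_to X b b \<gamma>" "path_from_to X b b \<delta>"
    by (auto simp: carrier_pi1)
  note j = path_from_to_join[OF loops]
  show "hurewicz X (A \<otimes>\<^bsub>pi1 X b\<^esub> B) = hurewicz X A \<otimes>\<^bsub>H1 X\<^esub> hurewicz X B"
    using mod2_class_eqI[OF join_mod2_boundary[OF loops]] loops
    by (simp add: AB mult_pi1 hurewicz_path_class[OF j] hurewicz_path_class mult_homology_mod2
        loop_mod2_cycle del: One_nat_def)
qed (auto simp: carrier_pi1 hurewicz_path_class carrier_homology_mod2 loop_mod2_cycle
    simp del: One_nat_def)

lemma edge_path_from_to:
  assumes "singular_simplex 1 (top_of_set X) \<sigma>"
  shows "path_from_to X (edge \<sigma> 0) (edge \<sigma> 1) (edge \<sigma>)"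
  using path_edge[OF assms] by (simp add: path_from_to_def pathstart_def pathfinish_def)

lemma singular_chain_path_chain:
  "path_from_to X x y \<gamma> \<Longrightarrow> singular_chain 1 (top_of_set X) (path_chain \<gamma>)"
  unfolding singular_chain_of by (intro singular_simplex_path_simplex) (simp_all add: path_from_to_def)

lemma path_connected_base_paths:
  fixes X :: "'a::topological_space set"
  assumes "path_connected X" "b \<in> X"
  obtains \<kappa> where "\<And>x. x \<in> X \<Longrightarrow> path_from_to X b x (\<kappa> x)"
  using assms unfolding path_connected_def path_from_to_def by metis

text \<open>Base paths close up every singular edge to a loop.  The base paths themselves contribute
  \<open>L (\<partial>c)\<close>, where \<open>L\<close> sends a vertex to its base path; for a mod 2 cycle this is twice a chain and
  vanishes.  So the class of a cycle is the class of a loop.\<close>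

lemma hurewicz_surj:
  fixes X :: "'a::topological_space set"
  assumes X: "path_connected X" "b \<in> X"
  shows "hurewicz X ` carrier (pi1 X b) = carrier (H1 X)"
proof
  show "hurewicz X ` carrier (pi1 X b) \<subseteq> carrier (H1 X)"
    using hurewicz_hom by (auto simp: hom_def)
  obtain \<kappa> where \<kappa>: "\<And>x. x \<in> X \<Longrightarrow> path_from_to X b x (\<kappa> x)"
    using path_connected_base_paths[OF X] by blast
  define L :: "'a chain \<Rightarrow> 'a chain" where
    "L = frag_extend (\<lambda>\<omega>. path_chain (\<kappa> (\<omega> (\<lambda>j. if j = 0 then 1 else 0))))"
  let ?bd = "mod2_boundary 1 (top_of_set X)"
  have L_chain: "singular_chain 1 (top_of_set X) (L e)" if "singular_chain 0 (top_of_set X) e" for e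
    unfolding L_def
  proof (rule singular_chain_extend)
    fix \<omega> assume "\<omega> \<in> Poly_Mapping.keys e"
    then have "singular_simplex 0 (top_of_set X) \<omega>"
      using that by (auto simp: singular_chain_def)
    then have "\<omega> (\<lambda>j. if j = 0 then 1 else 0) \<in> X"
      by (auto simp: singular_simplex_def continuous_map_def standard_simplex_0)
    then show "singular_chain 1 (top_of_set X) (path_chain (\<kappa> (\<omega> (\<lambda>j. if j = 0 then 1 else 0))))"
      using \<kappa> singular_chain_path_chain by blast
  qed
  \<comment> \<open>The loop \<open>\<gamma>\<close> represents \<open>c\<close> up to the base paths at the end points of its edges.\<close>
  have close_up: "\<exists>\<gamma>. path_from_to X b b \<gamma> \<and> ?bd (c - L (chain_boundary 1 c) - path_chain \<gamma>)"
    if "singular_chain 1 (top_of_set X) c" for c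
    using that unfolding singular_chain_def
  proof (induction c rule: frag_induction)
    case zero
    show ?case
      using path_from_to_const[OF X(2)] mod2_boundary_minus[OF const_mod2_boundary[OF X(2)]]
      by (intro exI[of _ "\<lambda>_. b"]) (simp add: L_def)
  next
    case (one \<sigma>)
    define x y where "x = edge \<sigma> 0" and "y = edge \<sigma> 1"
    have p: "path_from_to X x y (edge \<sigma>)"
      unfolding x_def y_def using one by (intro edge_path_from_to) simp
    have x: "path_from_to X b x (\<kappa> x)" and y: "path_from_to X b y (\<kappa> y)"
      using path_from_to_mem[OF p] \<kappa> by auto
    have \<sigma>: "frag_of \<sigma> = path_chain (edge \<sigma>)"
      using one path_simplex_edge[of \<sigma>] by (simp add: singular_simplex_def)
    have L: "L (chain_boundary 1 (frag_of \<sigma>)) = path_chain (\<kappa> y) - path_chain (\<kappa> x)"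
      unfolding chain_boundary_1 L_def x_def y_def
      by (simp add: frag_extend_diff standard_simplex_0)
    let ?\<gamma> = "(\<kappa> x +++ edge \<sigma>) +++ reversepath (\<kappa> y)"
    note j = path_from_to_join[OF x p]
    have t1: "?bd (path_chain (\<kappa> x) + path_chain (edge \<sigma>) - path_chain (\<kappa> x +++ edge \<sigma>))"
      using x p by (rule join_mod2_boundary)
    have t2: "?bd (path_chain (\<kappa> x +++ edge \<sigma>) + path_chain (reversepath (\<kappa> y)) - path_chain ?\<gamma>)"
      using j path_from_to_reverse[OF y] by (rule join_mod2_boundary)
    have t3: "?bd (path_chain (\<kappa> y) + path_chain (reversepath (\<kappa> y)))"
      using y by (rule inverse_mod2_boundary)
    have "?bd ((path_chain (\<kappa> x) + path_chain (edge \<sigma>) - path_chain (\<kappa> x +++ edge \<sigma>))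
        + (path_chain (\<kappa> x +++ edge \<sigma>) + path_chain (reversepath (\<kappa> y)) - path_chain ?\<gamma>)
        - (path_chain (\<kappa> y) + path_chain (reversepath (\<kappa> y))))"
      by (rule mod2_boundary_diff[OF mod2_boundary_add[OF t1 t2] t3])
    then have "?bd (frag_of \<sigma> - L (chain_boundary 1 (frag_of \<sigma>)) - path_chain ?\<gamma>)"
      unfolding L by (simp add: \<sigma>[symmetric] algebra_simps)
    then show ?case
      using path_from_to_join[OF j path_from_to_reverse[OF y]] by blast
  next
    case (diff c c')
    then obtain \<gamma> \<gamma>' where loops: "path_from_to X b b \<gamma>" "path_from_to X b b \<gamma>'"
      and bd: "?bd (c - L (chain_boundary 1 c) - path_chain \<gamma>)"
        "?bd (c' - L (chain_boundary 1 c') - path_chain \<gamma>')" by blast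
    note r = path_from_to_reverse[OF loops(2)]
    have "?bd ((c - L (chain_boundary 1 c) - path_chain \<gamma>)
        - (c' - L (chain_boundary 1 c') - path_chain \<gamma>')
        + (path_chain \<gamma> + path_chain (reversepath \<gamma>') - path_chain (\<gamma> +++ reversepath \<gamma>'))
        - (path_chain \<gamma>' + path_chain (reversepath \<gamma>')))"
      by (rule mod2_boundary_diff[OF mod2_boundary_add[OF mod2_boundary_diff[OF bd]
            join_mod2_boundary[OF loops(1) r]] inverse_mod2_boundary[OF loops(2)]])
    then have "?bd ((c - c') - (L (chain_boundary 1 c) - L (chain_boundary 1 c'))
        - path_chain (\<gamma> +++ reversepath \<gamma>'))"
      by (simp add: algebra_simps)
    moreover have "L (chain_boundary 1 (c - c')) = L (chain_boundary 1 c) - L (chain_boundary 1 c')"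
      by (simp add: L_def chain_boundary_diff frag_extend_diff)
    ultimately have "?bd ((c - c') - L (chain_boundary 1 (c - c')) - path_chain (\<gamma> +++ reversepath \<gamma>'))"
      by (simp only:)
    then show ?case using path_from_to_join[OF loops(1) r] by blast
  qed
  show "carrier (H1 X) \<subseteq> hurewicz X ` carrier (pi1 X b)"
  proof
    fix a assume "a \<in> carrier (H1 X)"
    then obtain c where c: "mod2_cycle 1 (top_of_set X) c" "a = mod2_class 1 (top_of_set X) c"
      by (auto simp: carrier_homology_mod2)
    then obtain e where e: "singular_chain 0 (top_of_set X) e" "chain_boundary 1 c = frag_cmul 2 e"
      by (auto simp: mod2_cycle_def)
    obtain \<gamma> where \<gamma>: "path_from_to X b b \<gamma>" "?bd (c - L (chain_boundary 1 c) - path_chain \<gamma>)"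
      using close_up c by (auto simp: mod2_cycle_def)
    have "L (chain_boundary 1 c) = frag_cmul 2 (L e)"
      unfolding e L_def by (rule frag_extend_cmul)
    then have "?bd (L (chain_boundary 1 c))"
      using mod2_boundary_double[OF L_chain[OF e(1)]] by simp
    from mod2_boundary_add[OF \<gamma>(2) this] have "?bd (c - path_chain \<gamma>)" by simp
    then have "a = hurewicz X (path_class X \<gamma>)"
      unfolding c hurewicz_path_class[OF \<gamma>(1)] by (rule mod2_class_eqI)
    then show "a \<in> hurewicz X ` carrier (pi1 X b)"
      using pi1_class_carrier[OF \<gamma>(1)] by blast
  qed
qed

lemma Z2_valued_chain_hom:
  assumes h: "h \<in> hom (chain_group n X) Z2" and c: "singular_chain n X c"
  shows "h c = 0 \<or> h c = 1"
    "singular_chain n X d \<Longrightarrow> h (c + d) = (h c + h d) mod 2"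
    "singular_chain n X d \<Longrightarrow> h (c - d) = (h c + h d) mod 2"
proof -
  have Z2: "h a = 0 \<or> h a = 1" if "singular_chain n X a" for a
    using h that by (force simp: hom_def carrier_integer_mod_group)
  have add: "h (a + d) = (h a + h d) mod 2" if "singular_chain n X a" "singular_chain n X d" for a d
    using h that by (auto simp: hom_def)
  show "h c = 0 \<or> h c = 1" using Z2 c .
  assume d: "singular_chain n X d"
  show "h (c + d) = (h c + h d) mod 2" using add c d .
  have "h c = (h (c - d) + h d) mod 2"
    using add[of "c - d" d] c d by (simp add: singular_chain_diff)
  then show "h (c - d) = (h c + h d) mod 2"
    using Z2[OF singular_chain_diff[OF c d]] Z2[OF c] Z2[OF d] by auto
qed

text \<open>The condition on \<open>h\<close> says that it is a cocycle.  It also kills the doubles among the mod 2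
  boundaries, because its target has exponent 2.\<close>

lemma homology_mod2_hom_from_chains:
  assumes h: "h \<in> hom (chain_group n X) Z2"
    and bd: "\<And>d. singular_simplex (Suc n) X d \<Longrightarrow> h (chain_boundary (Suc n) (frag_of d)) = 0"
  obtains \<psi> where "\<psi> \<in> hom (homology_mod2 n X) Z2"
    "\<And>c. mod2_cycle n X c \<Longrightarrow> \<psi> (mod2_class n X c) = h c"
proof -
  note Z2 = Z2_valued_chain_hom(1)[OF h]
  note add = Z2_valued_chain_hom(2)[OF h]
  have boundary: "h (chain_boundary (Suc n) d) = 0" if "singular_chain (Suc n) X d" for d
    using that unfolding singular_chain_def
  proof (induction d rule: free_Abelian_group_induct[consumes 1])
    case 1
    show ?case using add[of 0 0] Z2[of 0] by auto
  next
    case (2 a b)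
    then have "singular_chain (Suc n) X a" "singular_chain (Suc n) X b"
      by (auto simp: singular_chain_def)
    then show ?case
      using 2 Z2_valued_chain_hom(3)[OF h singular_chain_boundary_alt singular_chain_boundary_alt, of a b]
      by (simp add: chain_boundary_diff)
  next
    case (3 \<tau>)
    then show ?case using bd by simp
  qed
  have double: "h (frag_cmul 2 e) = 0" if "singular_chain n X e" for e
  proof -
    have "frag_cmul 2 e = e + e" using frag_cmul_distrib[of 1 1 e] by simp
    then show ?thesis using add[OF that that] Z2[OF that] by auto
  qed
  have zero: "h c = 0" if "mod2_boundary n X c" for c
    using that boundary double add unfolding mod2_boundary_def
    by (auto simp: singular_chain_cmul singular_chain_boundary_alt)
  define \<psi> where "\<psi> A = h (SOME c. c \<in> A)" for A
  have \<psi>: "\<psi> (mod2_class n X c) = h c" if c: "mod2_cycle n X c" for c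
  proof -
    let ?d = "SOME d. d \<in> mod2_class n X c"
    have "?d \<in> mod2_class n X c" by (rule someI[of "\<lambda>d. d \<in> mod2_class n X c", OF mem_mod2_class])
    then have "mod2_boundary n X (?d - c)" by (rule mod2_class_memberD)
    moreover have chains: "singular_chain n X c" "singular_chain n X (?d - c)"
      using c mod2_boundary_imp_cycle[OF \<open>mod2_boundary n X (?d - c)\<close>] by (auto simp: mod2_cycle_def)
    ultimately have "h ((?d - c) + c) = h c"
      using zero[of "?d - c"] Z2[of c] add[of "?d - c" c] by auto
    then show ?thesis by (simp add: \<psi>_def)
  qed
  have "\<psi> \<in> hom (homology_mod2 n X) Z2"
  proof (rule homI)
    fix A B assume "A \<in> carrier (homology_mod2 n X)" "B \<in> carrier (homology_mod2 n X)"
    then obtain c d where cd: "mod2_cycle n X c" "A = mod2_class n X c"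
      "mod2_cycle n X d" "B = mod2_class n X d"
      by (auto simp: carrier_homology_mod2)
    moreover have "singular_chain n X c" "singular_chain n X d"
      using cd by (auto simp: mod2_cycle_def)
    ultimately show "\<psi> A \<in> carrier Z2"
      "\<psi> (A \<otimes>\<^bsub>homology_mod2 n X\<^esub> B) = \<psi> A \<otimes>\<^bsub>Z2\<^esub> \<psi> B"
      using Z2[of c] by (auto simp: mult_homology_mod2 \<psi> mod2_cycle_add add carrier_integer_mod_group)
  qed
  then show ?thesis using \<psi> that by blast
qed

text \<open>Every homomorphism to the integers mod 2 comes from a cocycle: evaluate the homomorphism on
  the loop obtained from a singular edge by adding base paths at both ends.  The cocycle condition is
  the relation of loops around a singular triangle.  On a loop at the base point the two base paths
  cancel because the target is commutative.\<close>

lemma hurewicz_factor: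
  fixes X :: "'a::topological_space set"
  assumes X: "path_connected X" "b \<in> X"
    and \<phi>: "\<phi> \<in> hom (pi1 X b) Z2"
  obtains \<psi> where "\<psi> \<in> hom (H1 X) Z2" "\<And>a. a \<in> carrier (pi1 X b) \<Longrightarrow> \<phi> a = \<psi> (hurewicz X a)"
proof -
  obtain \<kappa> where \<kappa>: "\<And>x. x \<in> X \<Longrightarrow> path_from_to X b x (\<kappa> x)"
    using path_connected_base_paths[OF X] by blast
  define loop where "loop x p y = (\<kappa> x +++ p) +++ reversepath (\<kappa> y)" for x p y
  have loop: "path_from_to X b b (loop x p y)" if "path_from_to X x y p" for x p y
    using that \<kappa> path_from_to_mem[OF that] unfolding loop_def
    by (blast intro: path_from_to_join path_from_to_reverse)
  have Z2: "\<phi> (path_class X \<gamma>) = 0 \<or> \<phi> (path_class X \<gamma>) = 1" if "path_from_to X b b \<gamma>" for \<gamma>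
    using \<phi> pi1_class_carrier[OF that] by (force simp: hom_def carrier_integer_mod_group)
  have mult: "\<phi> (path_class X (\<gamma> +++ \<delta>)) = (\<phi> (path_class X \<gamma>) + \<phi> (path_class X \<delta>)) mod 2"
    if "path_from_to X b b \<gamma>" "path_from_to X b b \<delta>" for \<gamma> \<delta>
    using \<phi> that by (auto simp: hom_def pi1_class_carrier mult_pi1[symmetric])
  define f where "f \<sigma> = \<phi> (path_class X (loop (edge \<sigma> 0) (edge \<sigma>) (edge \<sigma> 1)))" for \<sigma>
  let ?S = "Collect (singular_simplex 1 (top_of_set X))"
  have "f ` ?S \<subseteq> carrier Z2"
    using Z2[OF loop[OF edge_path_from_to]] by (force simp: f_def carrier_integer_mod_group)
  then obtain h where h: "h \<in> hom (chain_group 1 (top_of_set X)) Z2"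
    "\<And>\<sigma>. singular_simplex 1 (top_of_set X) \<sigma> \<Longrightarrow> h (frag_of \<sigma>) = f \<sigma>"
    using comm_group.free_Abelian_group_universal[OF abelian_integer_mod_group, of f ?S 2]
    unfolding chain_group_def by (metis mem_Collect_eq)
  have cocycle: "h (chain_boundary (Suc 1) (frag_of \<tau>)) = 0"
    if \<tau>: "singular_simplex (Suc 1) (top_of_set X) \<tau>" for \<tau>
  proof -
    have \<tau>2: "singular_simplex 2 (top_of_set X) \<tau>" using \<tau> by (simp add: numeral_2_eq_2)
    define p q r where "p = edge (singular_face 2 2 \<tau>)" and "q = edge (singular_face 2 0 \<tau>)"
      and "r = edge (singular_face 2 1 \<tau>)"
    have faces: "singular_simplex 1 (top_of_set X) (singular_face 2 k \<tau>)" if "k \<le> 2" for k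
      using singular_simplex_singular_face[OF \<tau>2 _ that] by simp
    have ends: "p 1 = q 0" "r 0 = p 0" "r 1 = q 1"
      by (simp_all add: p_def q_def r_def edge_face_2 sweep_ends del: One_nat_def)
    have p: "path_from_to X (p 0) (q 0) p" and q: "path_from_to X (q 0) (q 1) q"
      and r: "path_from_to X (p 0) (q 1) r"
      using edge_path_from_to[OF faces] ends unfolding p_def q_def r_def
      by (metis le_refl, simp, metis one_le_numeral)
    have "homotopic_paths X (p +++ q) r"
      unfolding p_def q_def r_def by (rule singular_2_simplex_imp_homotopic[OF \<tau>2])
    then have "homotopic_paths X (loop (p 0) p (q 0) +++ loop (q 0) q (q 1)) (loop (p 0) r (q 1))"
      unfolding loop_def using p q \<kappa> path_from_to_mem[OF p] path_from_to_mem[OF q]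
      by (intro homotopic_paths_conjugate_join) auto
    then have "path_class X (loop (p 0) p (q 0) +++ loop (q 0) q (q 1))
        = path_class X (loop (p 0) r (q 1))"
      using path_class_eq_iff[OF path_from_to_join[OF loop[OF p] loop[OF q]]] by simp
    then have f: "f (singular_face 2 1 \<tau>) = (f (singular_face 2 2 \<tau>) + f (singular_face 2 0 \<tau>)) mod 2"
      using mult[OF loop[OF p] loop[OF q]] ends
      by (simp add: f_def p_def[symmetric] q_def[symmetric] r_def[symmetric] del: One_nat_def)
    have chains: "singular_chain 1 (top_of_set X) (frag_of (singular_face 2 k \<tau>))"
      if "k \<le> 2" for k
      unfolding singular_chain_of using faces[OF that] .
    note 0 = chains[of 0, OF zero_le] and 1 = chains[of 1, OF one_le_numeral]
      and 2 = chains[of 2, OF order_refl]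
    have "h (chain_boundary 2 (frag_of \<tau>)) = ((h (frag_of (singular_face 2 0 \<tau>))
        + h (frag_of (singular_face 2 1 \<tau>))) mod 2 + h (frag_of (singular_face 2 2 \<tau>))) mod 2"
      unfolding chain_boundary_2 Z2_valued_chain_hom(2)[OF h(1) singular_chain_diff[OF 0 1] 2]
        Z2_valued_chain_hom(3)[OF h(1) 0 1] ..
    also have "\<dots> = ((f (singular_face 2 0 \<tau>) + f (singular_face 2 1 \<tau>)) mod 2
        + f (singular_face 2 2 \<tau>)) mod 2"
      using h(2)[OF faces] by (simp del: One_nat_def)
    also have "\<dots> = 0" unfolding f by presburger
    finally show ?thesis by (simp add: numeral_2_eq_2)
  qed
  obtain \<psi> where \<psi>: "\<psi> \<in> hom (H1 X) Z2"
    "\<And>c. mod2_cycle 1 (top_of_set X) c \<Longrightarrow> \<psi> (mod2_class 1 (top_of_set X) c) = h c"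
    using homology_mod2_hom_from_chains[OF h(1) cocycle] by blast
  have "\<phi> a = \<psi> (hurewicz X a)" if in_pi1: "a \<in> carrier (pi1 X b)" for a
  proof -
    obtain \<gamma> where a: "a = path_class X \<gamma>" and \<gamma>: "path_from_to X b b \<gamma>"
      using in_pi1 by (auto simp: carrier_pi1)
    have \<kappa>b: "path_from_to X b b (\<kappa> b)" using \<kappa> X by simp
    have "homotopic_paths X \<gamma> (edge (path_simplex \<gamma>))"
      using \<gamma> by (intro homotopic_paths_eq) (auto simp: path_from_to_def edge_path_simplex)
    then have e: "path_class X (edge (path_simplex \<gamma>)) = path_class X \<gamma>"
      "path_from_to X b b (edge (path_simplex \<gamma>))"
      using path_class_eq_iff[OF \<gamma>] path_from_to_homotopic \<gamma> by blast+
    have "edge (path_simplex \<gamma>) 0 = b" "edge (path_simplex \<gamma>) 1 = b"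
      using e(2) by (simp_all add: path_from_to_def pathstart_def pathfinish_def)
    then have "f (path_simplex \<gamma>) = \<phi> (path_class X (loop b (edge (path_simplex \<gamma>)) b))"
      by (simp add: f_def)
    also have "\<dots> = (\<phi> (path_class X \<gamma>) + \<phi> (path_class X (\<kappa> b +++ reversepath (\<kappa> b)))) mod 2"
      unfolding loop_def using \<kappa>b e path_from_to_reverse[OF \<kappa>b]
      by (simp add: mult path_from_to_join) presburger
    also have "path_class X (\<kappa> b +++ reversepath (\<kappa> b)) = path_class X (\<lambda>_. b)"
      using path_class_eq_iff[OF path_from_to_join[OF \<kappa>b path_from_to_reverse[OF \<kappa>b]]]
        homotopic_paths_inverse_right[OF \<kappa>b] by simp
    also have "\<phi> (path_class X (\<lambda>_. b)) = 0"
    proof -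
      note k = path_from_to_const[OF X(2)]
      have "path_class X ((\<lambda>_. b) +++ (\<lambda>_. b)) = path_class X (\<lambda>_. b)"
        using path_class_eq_iff[OF path_from_to_join[OF k k]] homotopic_paths_const_right[OF k] by simp
      then show ?thesis using mult[OF k k] Z2[OF k] by auto
    qed
    finally have "f (path_simplex \<gamma>) = \<phi> a" using Z2[OF \<gamma>] a by auto
    moreover have "singular_simplex 1 (top_of_set X) (path_simplex \<gamma>)"
      using singular_chain_path_chain[OF \<gamma>] unfolding singular_chain_of .
    ultimately show ?thesis
      using \<psi>(2)[OF loop_mod2_cycle[OF \<gamma>]] h(2) by (simp add: a hurewicz_path_class[OF \<gamma>] del: One_nat_def)
  qed
  then show ?thesis using \<psi>(1) that by blast
qed

section \<open>The total space of the bundle is path connected\<close>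

text \<open>Over a disc in the base the bundle is a product of the disc with a circle, hence path
  connected.  Relating two base points when all points in the fibres over them can be joined gives an
  equivalence relation with open classes, and the base is connected.  Transitivity uses that no fibre
  is empty.\<close>

lemma path_connected_total_space:
  fixes F :: "'f::t2_space set" and P :: "'p::t2_space set"
  assumes surface: "closed_orientable_surface F" and principal: "principal_circle_bundle P p F act"
  shows "path_connected P"
proof -
  define R where "R y y' \<longleftrightarrow> (\<forall>e\<in>P. \<forall>e'\<in>P. p e = y \<longrightarrow> p e' = y' \<longrightarrow> path_component P e e')" for y y'
  have F: "connected F" and pP: "p ` P = F"
    using surface principal by (auto simp: closed_orientable_surface_def principal_circle_bundle_def)
  have local: "\<exists>T. openin (top_of_set F) T \<and> y \<in> T \<and> (\<forall>y'\<in>T. R y y')" if y: "y \<in> F" for y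
  proof -
    obtain U and V :: "complex set" and f g where U: "y \<in> U" "openin (top_of_set F) U" "open V"
      and fg: "homeomorphism U V f g"
      using surface y unfolding closed_orientable_surface_def homeomorphic_def by meson
    obtain W h k where W: "y \<in> W" "openin (top_of_set F) W"
      and hk: "homeomorphism (W \<times> sphere 0 1) (P \<inter> p -` W) h k"
      and ph: "\<And>v z. v \<in> W \<Longrightarrow> z \<in> sphere (0::complex) 1 \<Longrightarrow> p (h (v, z)) = v"
      using principal y unfolding principal_circle_bundle_def by meson
    have "openin (top_of_set V) (f ` (U \<inter> W))"
    proof (rule homeomorphism_imp_open_map[OF fg])
      show "openin (top_of_set U) (U \<inter> W)"
        using U W by (metis Int_lower1 openin_Int openin_imp_subset openin_subset_trans)
    qed
    then have "open (f ` (U \<inter> W))" using U(3) openin_open_trans by blast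
    moreover have "f y \<in> f ` (U \<inter> W)" using U W by blast
    ultimately obtain r where r: "r > 0" "ball (f y) r \<subseteq> f ` (U \<inter> W)"
      using open_contains_ball by blast
    \<comment> \<open>A disc around \<open>y\<close> over which the bundle is trivial.\<close>
    define T where "T = g ` ball (f y) r"
    have ball: "ball (f y) r \<subseteq> V" using r homeomorphism_image1[OF fg] by auto
    have "T \<subseteq> U \<inter> W"
    proof
      fix t assume "t \<in> T"
      then obtain w where "w \<in> U \<inter> W" "t = g (f w)" using r unfolding T_def by blast
      then show "t \<in> U \<inter> W" using homeomorphism_apply1[OF fg, of w] by auto
    qed
    have "openin (top_of_set U) T"
      unfolding T_def using fg ball
      by (intro homeomorphism_imp_open_map[OF homeomorphism_symD[OF fg]]) (simp add: openin_open_eq U)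
    then have "openin (top_of_set F) T" using U openin_trans by blast
    moreover have "y \<in> T"
      unfolding T_def using r U homeomorphism_apply1[OF fg, of y]
      by (intro image_eqI[of _ _ "f y"]) auto
    moreover have "path_connected T"
      unfolding T_def
      by (intro path_connected_continuous_image continuous_on_subset[OF homeomorphism_cont2[OF fg] ball]
          convex_imp_path_connected convex_ball)
    then have "path_connected (T \<times> sphere (0::complex) 1)"
      by (intro path_connected_Times path_connected_sphere) auto
    then have conn: "path_connected (h ` (T \<times> sphere 0 1))"
      using \<open>T \<subseteq> U \<inter> W\<close>
      by (intro path_connected_continuous_image continuous_on_subset[OF homeomorphism_cont1[OF hk]]) auto
    have sub: "h ` (T \<times> sphere 0 1) \<subseteq> P"
      using homeomorphism_image1[OF hk] \<open>T \<subseteq> U \<inter> W\<close> by blast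
    have fibre: "e \<in> h ` (T \<times> sphere 0 1)" if "e \<in> P" "p e \<in> T" for e
    proof -
      have e: "e \<in> P \<inter> p -` W" using that \<open>T \<subseteq> U \<inter> W\<close> by auto
      then have "k e \<in> W \<times> sphere 0 1" "h (k e) = e"
        using homeomorphism_image2[OF hk] homeomorphism_apply2[OF hk] by blast+
      moreover obtain v z where "k e = (v, z)" by force
      ultimately have "e = h (v, z)" "v \<in> W" "z \<in> sphere 0 1" by auto
      then show ?thesis using ph[of v z] that by auto
    qed
    have "R y y'" if "y' \<in> T" for y'
      unfolding R_def using fibre that \<open>y \<in> T\<close> conn sub
      by (metis path_component_of_subset path_connected_component)
    ultimately show ?thesis by blast
  qed
  have "R y y'" if "y \<in> F" "y' \<in> F" for y y'
    using F that
  proof (rule connected_equivalence_relation)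
    show "R b a" if "R a b" for a b
      using that path_component_sym unfolding R_def by metis
    show "R a c" if "R a b" "R b c" "b \<in> F" for a b c
      using that pP path_component_trans unfolding R_def by (metis imageE)
  qed (use local in blast)
  then have "path_component P e e'" if "e \<in> P" "e' \<in> P" for e e'
    using that pP unfolding R_def by blast
  then show ?thesis by (simp add: path_connected_component)
qed

section \<open>Homomorphisms out of a presented group\<close>

definition word_weight :: "(nat \<Rightarrow> int) \<Rightarrow> word \<Rightarrow> int" where
  "word_weight a w = (\<Sum>(i, n)\<leftarrow>w. a i * n)"

lemma word_weight_append: "word_weight a (v @ w) = word_weight a v + word_weight a w"
  by (simp add: word_weight_def)

text \<open>Merging and deleting syllables preserves the weight, and inserting a relator preserves its
  parity.\<close>

lemma word_eq_weight:
  assumes "word_eq I R v w" and "\<And>r. r \<in> R \<Longrightarrow> even (word_weight a r)"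
  shows "even (word_weight a v) \<longleftrightarrow> even (word_weight a w)"
  using assms(1)
proof induction
  case (merge i v w m n)
  then show ?case by (simp add: word_weight_def algebra_simps)
next
  case (relator r v w)
  then show ?case using assms(2) by (simp add: word_weight_append)
qed (auto simp: word_weight_def)

lemma word_weight_surface_word: "word_weight a (surface_word g) = 0"
proof -
  have "word_weight a (concat (map (\<lambda>l. commutator_word (2 * l - 1) (2 * l)) ls)) = 0" for ls
    by (induction ls) (auto simp: word_weight_append, auto simp: word_weight_def commutator_word_def)
  then show ?thesis by (simp add: surface_word_def)
qed

lemma word_eval_closed:
  assumes "group G" "y ` I \<subseteq> carrier G" "w \<in> words I"
  shows "word_eval G y w \<in> carrier G"
proof -
  interpret group G by (rule assms(1))
  show ?thesis
    using assms(3) unfolding words_def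
  proof (induction w)
    case (Cons s w)
    then show ?case
      using assms(2) by (cases s) (auto simp: word_eval_def intro!: m_closed int_pow_closed)
  qed (simp add: word_eval_def)
qed

lemma word_eval_append:
  assumes "group G" "y ` I \<subseteq> carrier G" "v \<in> words I" "w \<in> words I"
  shows "word_eval G y (v @ w) = word_eval G y v \<otimes>\<^bsub>G\<^esub> word_eval G y w"
proof -
  interpret group G by (rule assms(1))
  have w: "word_eval G y w \<in> carrier G" using word_eval_closed assms by blast
  show ?thesis
    using assms(3) unfolding words_def
  proof (induction v)
    case Nil
    then show ?case using w by (simp add: word_eval_def)
  next
    case (Cons s v)
    obtain i n where s: "s = (i, n)" by force
    have "y i \<in> carrier G" using Cons s assms(2) by auto
    moreover have "word_eval G y v \<in> carrier G"
      using Cons assms by (intro word_eval_closed) (auto simp: words_def)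
    moreover have "word_eval G y ((s # v) @ w) = y i [^]\<^bsub>G\<^esub> n \<otimes>\<^bsub>G\<^esub> word_eval G y (v @ w)"
      "word_eval G y (s # v) = y i [^]\<^bsub>G\<^esub> n \<otimes>\<^bsub>G\<^esub> word_eval G y v"
      by (simp_all add: s word_eval_def)
    ultimately show ?case using Cons w by (simp add: m_assoc int_pow_closed)
  qed
qed

lemma presented_byD:
  assumes "presented_by G y I R"
  shows "group G" "y ` I \<subseteq> carrier G" "word_eval G y ` words I = carrier G"
    and "v \<in> words I \<Longrightarrow> w \<in> words I \<Longrightarrow> word_eval G y v = word_eval G y w \<Longrightarrow> word_eq I R v w"
proof -
  note pres = assms[unfolded presented_by_def]
  show "group G" using pres by (elim conjE) assumption
  show "y ` I \<subseteq> carrier G" using pres by (elim conjE) assumption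
  show "word_eval G y ` words I = carrier G" using pres by (elim conjE) assumption
  have "\<forall>v\<in>words I. \<forall>w\<in>words I. word_eval G y v = word_eval G y w \<longleftrightarrow> word_eq I R v w"
    using pres by (elim conjE) assumption
  then show "v \<in> words I \<Longrightarrow> w \<in> words I \<Longrightarrow> word_eval G y v = word_eval G y w \<Longrightarrow> word_eq I R v w"
    for v w by simp
qed

text \<open>A homomorphism to the integers mod 2 may be prescribed arbitrarily on the generators as long as
  every relator has even weight.\<close>

lemma presented_by_character:
  assumes pres: "presented_by G y I R" and even: "\<And>r. r \<in> R \<Longrightarrow> even (word_weight a r)"
  obtains \<phi> where "\<phi> \<in> hom G Z2" "\<And>i. i \<in> I \<Longrightarrow> \<phi> (y i) = a i mod 2"
proof -
  note G = presented_byD(1)[OF pres] and y = presented_byD(2)[OF pres]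
    and surj = presented_byD(3)[OF pres] and eq = presented_byD(4)[OF pres]
  interpret group G by (rule G)
  define \<phi> where "\<phi> x = word_weight a (SOME w. w \<in> words I \<and> word_eval G y w = x) mod 2" for x
  have \<phi>: "\<phi> (word_eval G y w) = word_weight a w mod 2" if w: "w \<in> words I" for w
  proof -
    define v where "v = (SOME v. v \<in> words I \<and> word_eval G y v = word_eval G y w)"
    have "v \<in> words I \<and> word_eval G y v = word_eval G y w"
      unfolding v_def
      by (rule someI[of "\<lambda>v. v \<in> words I \<and> word_eval G y v = word_eval G y w" w]) (use w in simp)
    then have "word_eq I R v w" using eq[of v w] w by simp
    then have "even (word_weight a v) \<longleftrightarrow> even (word_weight a w)"
      using word_eq_weight even by blast
    then have "word_weight a v mod 2 = word_weight a w mod 2" by presburger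
    then show ?thesis by (simp add: \<phi>_def v_def)
  qed
  have "\<phi> \<in> hom G Z2"
  proof (rule homI)
    fix x x' assume "x \<in> carrier G" "x' \<in> carrier G"
    then obtain v w where "v \<in> words I" "w \<in> words I" "x = word_eval G y v" "x' = word_eval G y w"
      using surj by blast
    moreover from this have "x \<otimes>\<^bsub>G\<^esub> x' = word_eval G y (v @ w)" "v @ w \<in> words I"
      using word_eval_append[OF G y] by (auto simp: words_def)
    ultimately show "\<phi> (x \<otimes>\<^bsub>G\<^esub> x') = \<phi> x \<otimes>\<^bsub>Z2\<^esub> \<phi> x'"
      by (simp add: \<phi> word_weight_append mod_add_eq)
  qed (simp add: \<phi>_def carrier_integer_mod_group)
  moreover have "\<phi> (y i) = a i mod 2" if "i \<in> I" for i
  proof -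
    have "y i \<in> carrier G" using y that by auto
    then have "word_eval G y [(i, 1)] = y i" by (simp add: word_eval_def)
    then show ?thesis using \<phi>[of "[(i, 1)]"] that by (simp add: words_def word_weight_def)
  qed
  ultimately show ?thesis using that by blast
qed

text \<open>Commutators have weight zero and the last relator has weight \<open>a 0 * q\<close>.  This is where an even
  Chern number is used: otherwise no homomorphism takes the value 1 on the fibre.\<close>

lemma bundle_presentation_character:
  assumes "bundle_presentation g q G u" "even q"
  obtains \<phi> where "\<phi> \<in> hom G Z2" "\<And>i. i \<in> {0..2 * g} \<Longrightarrow> \<phi> (u i) = a i mod 2"
  using assms(1) unfolding bundle_presentation_def
proof (rule presented_by_character[where a = a])
  fix r
  assume "r \<in> (\<lambda>i. commutator_word i 0) ` {1..2 * g} \<union> {surface_word g @ [(0, q)]}"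
  then show "even (word_weight a r)"
    using assms(2) by (auto simp: word_weight_append word_weight_surface_word)
      (auto simp: word_weight_def commutator_word_def)
qed (use that in blast)

section \<open>Quadratic forms on a symplectic space over the integers mod 2\<close>

lemma hom_Z2_iff:
  "\<phi> \<in> hom G Z2 \<longleftrightarrow> (\<forall>a\<in>carrier G. \<phi> a \<in> {0, 1}) \<and>
    (\<forall>a\<in>carrier G. \<forall>b\<in>carrier G. \<phi> (a \<otimes>\<^bsub>G\<^esub> b) = (\<phi> a + \<phi> b) mod 2)"
proof -
  have "carrier Z2 = {0, 1}" by (auto simp: carrier_integer_mod_group)
  then show ?thesis by (auto simp: hom_def)
qed

lemma mod2_values: "(x::int) mod 2 \<in> {0, 1}"
  by auto

lemma mod_2_eq_iff: "(x::int) mod 2 = y mod 2 \<longleftrightarrow> (even x \<longleftrightarrow> even y)"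
  by presburger

definition parity_sign :: "int \<Rightarrow> int" where
  "parity_sign n = (if even n then 1 else -1)"

lemma parity_sign_simps [simp]:
  "parity_sign 0 = 1" "parity_sign 1 = -1" "parity_sign (n mod 2) = parity_sign n"
  "parity_sign (m + n) = parity_sign m * parity_sign n"
  by (auto simp: parity_sign_def)

text \<open>A nondegenerate alternating form on a finite vector space over the field with two elements,
  written as a group of exponent 2.  The assumptions are those which the theory of quadratic forms
  needs; a symplectic basis provides them, see \<open>symplectic_basis_space\<close> below.\<close>

locale symplectic_Z2_space = comm_group V for V (structure) +
  fixes dot :: "'a \<Rightarrow> 'a \<Rightarrow> int" and g :: nat
  assumes double: "a \<in> carrier V \<Longrightarrow> a \<otimes> a = \<one>"
    and dot_hom_right: "a \<in> carrier V \<Longrightarrow> dot a \<in> hom V Z2"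
    and dot_sym: "a \<in> carrier V \<Longrightarrow> b \<in> carrier V \<Longrightarrow> dot a b = dot b a"
    and dot_self: "a \<in> carrier V \<Longrightarrow> dot a a = 0"
    and nondegenerate: "v \<in> carrier V \<Longrightarrow> (\<And>a. a \<in> carrier V \<Longrightarrow> dot a v = 0) \<Longrightarrow> v = \<one>"
    and representable: "l \<in> hom V Z2 \<Longrightarrow> \<exists>v\<in>carrier V. \<forall>a\<in>carrier V. l a = dot a v"
    and card_carrier: "card (carrier V) = 2 ^ (2 * g)"
    and genus_pos: "g \<ge> 1"
begin

lemma dot_right: "a \<in> carrier V \<Longrightarrow> b \<in> carrier V \<Longrightarrow> c \<in> carrier V \<Longrightarrow>
    dot a (b \<otimes> c) = (dot a b + dot a c) mod 2"
  using dot_hom_right by (auto simp: hom_Z2_iff)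

lemma dot_left: "a \<in> carrier V \<Longrightarrow> b \<in> carrier V \<Longrightarrow> c \<in> carrier V \<Longrightarrow>
    dot (a \<otimes> b) c = (dot a c + dot b c) mod 2"
  using dot_right[of c a b] by (simp add: dot_sym)

lemma dot_values: "a \<in> carrier V \<Longrightarrow> b \<in> carrier V \<Longrightarrow> dot a b = 0 \<or> dot a b = 1"
  using dot_hom_right by (auto simp: hom_Z2_iff)

lemma double_cancel: "a \<in> carrier V \<Longrightarrow> v \<in> carrier V \<Longrightarrow> a \<otimes> v \<otimes> v = a"
  by (simp add: m_assoc double)

lemma finite_carrier: "finite (carrier V)"
  using card_carrier by (metis card.infinite power_not_zero zero_neq_numeral)

lemma bij_translation: "v \<in> carrier V \<Longrightarrow> bij_betw (\<lambda>a. a \<otimes> v) (carrier V) (carrier V)"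
  by (rule bij_betw_byWitness[of _ "\<lambda>a. a \<otimes> v"]) (auto simp: double_cancel)

definition quadratic_forms :: "('a \<Rightarrow> int) set" where
  "quadratic_forms = {\<omega> \<in> carrier V \<rightarrow>\<^sub>E {0, 1}.
    \<forall>a\<in>carrier V. \<forall>b\<in>carrier V. \<omega> (a \<otimes> b) = (\<omega> a + \<omega> b + dot a b) mod 2}"

text \<open>Two quadratic forms differ by a linear form, which is represented by a vector.  The
  quadratic forms are therefore a torsor under the vector space, acting by \<open>shift\<close>.\<close>

definition shift :: "('a \<Rightarrow> int) \<Rightarrow> 'a \<Rightarrow> 'a \<Rightarrow> int" where
  "shift \<omega> v = (\<lambda>a\<in>carrier V. (\<omega> a + dot a v) mod 2)"

definition act :: "('a \<Rightarrow> 'a) \<Rightarrow> ('a \<Rightarrow> int) \<Rightarrow> 'a \<Rightarrow> int" where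
  "act f \<omega> = restrict (\<omega> \<circ> f) (carrier V)"

text \<open>The number of zeros minus the number of ones of a quadratic form.  Its sign is the Arf
  invariant, here available without a choice of basis.\<close>

definition gauss_sum :: "('a \<Rightarrow> int) \<Rightarrow> int" where
  "gauss_sum \<omega> = (\<Sum>a\<in>carrier V. parity_sign (\<omega> a))"

lemma form_values: "\<omega> \<in> quadratic_forms \<Longrightarrow> a \<in> carrier V \<Longrightarrow> \<omega> a = 0 \<or> \<omega> a = 1"
  by (auto simp: quadratic_forms_def)

lemma form_mult: "\<omega> \<in> quadratic_forms \<Longrightarrow> a \<in> carrier V \<Longrightarrow> b \<in> carrier V \<Longrightarrow>
    \<omega> (a \<otimes> b) = (\<omega> a + \<omega> b + dot a b) mod 2"
  by (auto simp: quadratic_forms_def)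

lemma form_one: "\<omega> \<in> quadratic_forms \<Longrightarrow> \<omega> \<one> = 0"
  using form_mult[of \<omega> \<one> \<one>] form_values[of \<omega> \<one>] by (auto simp: dot_self)

lemma forms_differ_by_hom:
  assumes "\<omega> \<in> quadratic_forms" "\<omega>' \<in> quadratic_forms"
  shows "(\<lambda>a. (\<omega> a + \<omega>' a) mod 2) \<in> hom V Z2"
  unfolding hom_Z2_iff
proof (intro conjI ballI)
  fix a b assume ab: "a \<in> carrier V" "b \<in> carrier V"
  show "(\<omega> (a \<otimes> b) + \<omega>' (a \<otimes> b)) mod 2 = ((\<omega> a + \<omega>' a) mod 2 + (\<omega> b + \<omega>' b) mod 2) mod 2"
    unfolding form_mult[OF assms(1) ab] form_mult[OF assms(2) ab] by (auto simp: mod_2_eq_iff)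
qed (rule mod2_values)

lemma form_eq_shift:
  assumes \<omega>: "\<omega> \<in> quadratic_forms" and \<omega>': "\<omega>' \<in> quadratic_forms"
  obtains v where "v \<in> carrier V" "\<omega>' = shift \<omega> v"
proof -
  obtain v where v: "v \<in> carrier V" "\<And>a. a \<in> carrier V \<Longrightarrow> (\<omega> a + \<omega>' a) mod 2 = dot a v"
    using representable[OF forms_differ_by_hom[OF \<omega> \<omega>']] by blast
  have "\<omega>' a = shift \<omega> v a" for a
  proof (cases "a \<in> carrier V")
    case True
    then show ?thesis
      using form_values[OF \<omega> True] form_values[OF \<omega>' True] v(2)[OF True] by (auto simp: shift_def)
  next
    case False
    then show ?thesis
      using \<omega>' by (auto simp: shift_def quadratic_forms_def PiE_def extensional_def)
  qed
  then show ?thesis using v(1) that by blast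
qed

lemma shift_form:
  assumes \<omega>: "\<omega> \<in> quadratic_forms" and v: "v \<in> carrier V"
  shows "shift \<omega> v \<in> quadratic_forms"
proof -
  have "(\<omega> (a \<otimes> b) + dot (a \<otimes> b) v) mod 2
      = ((\<omega> a + dot a v) mod 2 + (\<omega> b + dot b v) mod 2 + dot a b) mod 2"
    if "a \<in> carrier V" "b \<in> carrier V" for a b
    unfolding form_mult[OF \<omega> that] dot_left[OF that v] by (auto simp: mod_2_eq_iff)
  then show ?thesis
    unfolding quadratic_forms_def by (auto simp: shift_def)
qed

text \<open>Adding the linear form \<open>dot _ v\<close> amounts to translating by \<open>v\<close>, up to a constant.\<close>

lemma shift_translate:
  assumes \<omega>: "\<omega> \<in> quadratic_forms" and a: "a \<in> carrier V" "v \<in> carrier V"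
  shows "shift \<omega> v a = (\<omega> (a \<otimes> v) + \<omega> v) mod 2"
  using form_mult[OF \<omega> a] a by (auto simp: shift_def mod_2_eq_iff)

lemma shift_shift:
  assumes "v \<in> carrier V" "w \<in> carrier V"
  shows "shift (shift \<omega> v) w = shift \<omega> (v \<otimes> w)"
proof -
  have "((\<omega> a + dot a v) mod 2 + dot a w) mod 2 = (\<omega> a + dot a (v \<otimes> w)) mod 2"
    if "a \<in> carrier V" for a
    unfolding dot_right[OF that assms] by (auto simp: mod_2_eq_iff)
  then show ?thesis by (auto simp: shift_def)
qed

lemma inj_shift: "inj_on (shift \<omega>) (carrier V)"
proof (rule inj_onI)
  fix v w assume vw: "v \<in> carrier V" "w \<in> carrier V" "shift \<omega> v = shift \<omega> w"
  have "dot a (v \<otimes> w) = 0" if a: "a \<in> carrier V" for a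
  proof -
    have "(\<omega> a + dot a v) mod 2 = (\<omega> a + dot a w) mod 2"
      using fun_cong[OF vw(3), of a] a by (simp add: shift_def)
    then have "even (dot a v + dot a w)" by (auto simp: mod_2_eq_iff)
    then show ?thesis unfolding dot_right[OF a vw(1,2)] by (simp only: even_iff_mod_2_eq_zero)
  qed
  then have "v \<otimes> w = \<one>" using nondegenerate vw by simp
  then have "v \<otimes> w \<otimes> w = \<one> \<otimes> w" by simp
  then show "v = w" using vw by (simp add: double_cancel)
qed

text \<open>By \<open>shift_translate\<close> the values of the shifted form are a permutation of the values of
  \<open>\<omega>\<close>, all flipped if \<open>\<omega> v = 1\<close>.\<close>

lemma gauss_sum_shift:
  assumes \<omega>: "\<omega> \<in> quadratic_forms" and v: "v \<in> carrier V"
  shows "gauss_sum (shift \<omega> v) = parity_sign (\<omega> v) * gauss_sum \<omega>"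
proof -
  have "gauss_sum (shift \<omega> v) = (\<Sum>a\<in>carrier V. parity_sign (\<omega> v) * parity_sign (\<omega> (a \<otimes> v)))"
    unfolding gauss_sum_def using \<omega> v by (intro sum.cong) (simp_all add: shift_translate mult.commute)
  also have "\<dots> = parity_sign (\<omega> v) * (\<Sum>a\<in>carrier V. parity_sign (\<omega> (a \<otimes> v)))"
    by (simp add: sum_distrib_left)
  also have "(\<Sum>a\<in>carrier V. parity_sign (\<omega> (a \<otimes> v))) = gauss_sum \<omega>"
    unfolding gauss_sum_def
    using sum.reindex_bij_betw[OF bij_translation[OF v], of "\<lambda>a. parity_sign (\<omega> a)"] .
  finally show ?thesis .
qed

text \<open>If \<open>a\<close> is not the neutral element, translation by a vector \<open>w\<close> with \<open>dot a w = 1\<close> reverses the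
  sign of the sum.\<close>

lemma character_sum:
  assumes a: "a \<in> carrier V"
  shows "(\<Sum>v\<in>carrier V. parity_sign (dot a v)) = (if a = \<one> then int (card (carrier V)) else 0)"
proof (cases "a = \<one>")
  case True
  have "dot \<one> v = 0" if "v \<in> carrier V" for v
    using dot_left[of \<one> \<one> v] dot_values[of \<one> v] that by auto
  then show ?thesis using True by simp
next
  case False
  then obtain w where w: "w \<in> carrier V" "dot w a \<noteq> 0"
    using nondegenerate[OF a] by blast
  then have "dot a w = 1" using dot_values[of a w] a dot_sym[of a w] by auto
  have "(\<Sum>v\<in>carrier V. parity_sign (dot a v)) = (\<Sum>v\<in>carrier V. parity_sign (dot a (v \<otimes> w)))"
    using sum.reindex_bij_betw[OF bij_translation[OF w(1)], of "\<lambda>v. parity_sign (dot a v)"] by simp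
  also have "\<dots> = (\<Sum>v\<in>carrier V. - parity_sign (dot a v))"
    using a w \<open>dot a w = 1\<close> by (intro sum.cong) (simp_all add: dot_right)
  finally show ?thesis using False by (simp add: sum_negf)
qed

text \<open>Sum \<open>gauss_sum_shift\<close> over all \<open>v\<close>, and evaluate the left side by interchanging the two
  summations, which leaves only the term of the neutral element.  The consequence that matters is
  that a Gauss sum is never zero and has only one possible absolute value.\<close>

lemma gauss_sum_square:
  assumes \<omega>: "\<omega> \<in> quadratic_forms"
  shows "gauss_sum \<omega> * gauss_sum \<omega> = 2 ^ (2 * g)"
proof -
  have "gauss_sum \<omega> * gauss_sum \<omega> = (\<Sum>v\<in>carrier V. gauss_sum (shift \<omega> v))"
    by (simp add: gauss_sum_shift \<omega> sum_distrib_right[symmetric]) (simp add: gauss_sum_def)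
  also have "\<dots> = (\<Sum>v\<in>carrier V. \<Sum>a\<in>carrier V. parity_sign (\<omega> a) * parity_sign (dot a v))"
    by (simp add: gauss_sum_def shift_def)
  also have "\<dots> = (\<Sum>a\<in>carrier V. parity_sign (\<omega> a) * (\<Sum>v\<in>carrier V. parity_sign (dot a v)))"
    by (subst sum.swap) (simp add: sum_distrib_left)
  also have "\<dots> = (\<Sum>a\<in>carrier V. if a = \<one> then parity_sign (\<omega> a) * int (card (carrier V)) else 0)"
    by (intro sum.cong) (simp_all add: character_sum)
  also have "\<dots> = 2 ^ (2 * g)"
    using finite_carrier form_one[OF \<omega>] by (simp add: card_carrier)
  finally show ?thesis .
qed

lemma gauss_sum_values:
  assumes "\<omega> \<in> quadratic_forms"
  shows "gauss_sum \<omega> = 2 ^ g \<or> gauss_sum \<omega> = - (2 ^ g)"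
proof -
  have "(gauss_sum \<omega>)\<^sup>2 = (2 ^ g)\<^sup>2"
    using gauss_sum_square[OF assms] by (simp add: power2_eq_square power_add mult_2)
  then show ?thesis by (simp add: power2_eq_iff)
qed

lemma carrier_Sp: "carrier (Sp V dot) =
    {f \<in> auto V. \<forall>a\<in>carrier V. \<forall>b\<in>carrier V. dot (f a) (f b) = dot a b}"
  by (simp add: Sp_def)

lemma SpD:
  assumes "f \<in> carrier (Sp V dot)"
  shows "f \<in> hom V V" "bij_betw f (carrier V) (carrier V)"
    "\<And>a b. a \<in> carrier V \<Longrightarrow> b \<in> carrier V \<Longrightarrow> dot (f a) (f b) = dot a b"
    "\<And>a. a \<in> carrier V \<Longrightarrow> f a \<in> carrier V"
  using assms by (auto simp: carrier_Sp auto_def Bij_def hom_def)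

lemma act_form:
  assumes f: "f \<in> carrier (Sp V dot)" and \<omega>: "\<omega> \<in> quadratic_forms"
  shows "act f \<omega> \<in> quadratic_forms"
  using SpD[OF f] form_values[OF \<omega>] form_mult[OF \<omega>] unfolding quadratic_forms_def act_def
  by (auto simp: hom_def)

lemma gauss_sum_act:
  assumes f: "f \<in> carrier (Sp V dot)"
  shows "gauss_sum (act f \<omega>) = gauss_sum \<omega>"
  using sum.reindex_bij_betw[OF SpD(2)[OF f], of "\<lambda>a. parity_sign (\<omega> a)"]
  by (simp add: gauss_sum_def act_def)

text \<open>The map \<open>a \<mapsto> a + (a \<cdot> v) v\<close> in additive notation.\<close>

definition transvection :: "'a \<Rightarrow> 'a \<Rightarrow> 'a" where
  "transvection v = (\<lambda>a\<in>carrier V. if dot a v = 1 then a \<otimes> v else a)"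

lemma transvection_Sp:
  assumes v: "v \<in> carrier V"
  shows "transvection v \<in> carrier (Sp V dot)"
proof -
  let ?t = "transvection v"
  have closed: "?t a \<in> carrier V" if "a \<in> carrier V" for a
    using that v by (simp add: transvection_def)
  have dot_v: "dot (?t a) v = dot a v" if "a \<in> carrier V" for a
    using that v dot_values[OF that v] by (auto simp: transvection_def dot_left dot_self)
  have invol: "?t (?t a) = a" if "a \<in> carrier V" for a
    using that v dot_v[OF that] closed[OF that] by (auto simp: transvection_def double_cancel)
  have mult: "?t (a \<otimes> b) = ?t a \<otimes> ?t b" if ab: "a \<in> carrier V" "b \<in> carrier V" for a b
  proof -
    have 1: "a \<otimes> v \<otimes> b = a \<otimes> b \<otimes> v"
      using ab v by (simp add: m_assoc m_comm[of v b])
    then have 2: "a \<otimes> v \<otimes> (b \<otimes> v) = a \<otimes> b"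
      using ab v by (simp add: m_assoc[symmetric] double_cancel)
    have 3: "a \<otimes> (b \<otimes> v) = a \<otimes> b \<otimes> v"
      using ab v by (simp add: m_assoc)
    show ?thesis
      using dot_values[OF ab(1) v] dot_values[OF ab(2) v]
      by (elim disjE) (use ab v in \<open>simp_all add: transvection_def dot_left 1 2 3\<close>)
  qed
  have dots: "dot (?t a) (?t b) = dot a b" if ab: "a \<in> carrier V" "b \<in> carrier V" for a b
    using dot_values[OF ab(1) v] dot_values[OF ab(2) v] dot_values[OF ab]
    by (elim disjE) (use ab v dot_sym[OF v ab(2)] dot_self[OF v] in
        \<open>simp_all add: transvection_def dot_left dot_right\<close>)
  have "bij_betw ?t (carrier V) (carrier V)"
    by (rule bij_betw_byWitness[of _ ?t]) (auto simp: invol closed)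
  then show ?thesis
    unfolding carrier_Sp auto_def Bij_def
    by (auto simp: hom_def closed mult dots) (simp add: transvection_def)
qed

text \<open>In additive notation \<open>\<omega> (a + v) = \<omega> a + \<omega> v + a \<cdot> v\<close>, which is \<open>\<omega> a + 1\<close> for \<open>a \<cdot> v = 1\<close> and
  \<open>\<omega> v = 0\<close>.  A single transvection thus realises the shift by a zero of \<open>\<omega>\<close>.\<close>

lemma act_transvection:
  assumes \<omega>: "\<omega> \<in> quadratic_forms" and v: "v \<in> carrier V" "\<omega> v = 0"
  shows "act (transvection v) \<omega> = shift \<omega> v"
proof
  fix a
  show "act (transvection v) \<omega> a = shift \<omega> v a"
  proof (cases "a \<in> carrier V")
    case True
    then show ?thesis
      using dot_values[OF True v(1)] form_values[OF \<omega> True] v form_mult[OF \<omega> True v(1)]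
      by (auto simp: act_def shift_def transvection_def)
  qed (simp add: act_def shift_def)
qed

text \<open>Shifts by zeros of \<open>\<omega>\<close> are realised by transvections.  Shifts by other vectors are excluded
  because they reverse the sign of the Gauss sum, a nonzero invariant of the action.\<close>

lemma orbit_form:
  assumes \<omega>: "\<omega> \<in> quadratic_forms"
  shows "orbit (Sp V dot) act \<omega> = shift \<omega> ` {v \<in> carrier V. \<omega> v = 0}"
proof
  show "orbit (Sp V dot) act \<omega> \<subseteq> shift \<omega> ` {v \<in> carrier V. \<omega> v = 0}"
  proof
    fix \<omega>' assume "\<omega>' \<in> orbit (Sp V dot) act \<omega>"
    then obtain f where f: "f \<in> carrier (Sp V dot)" "\<omega>' = act f \<omega>" by (auto simp: orbit_def)
    obtain v where v: "v \<in> carrier V" "\<omega>' = shift \<omega> v"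
      using form_eq_shift[OF \<omega> act_form[OF f(1) \<omega>]] f(2) by blast
    have "parity_sign (\<omega> v) * gauss_sum \<omega> = gauss_sum \<omega>"
      using gauss_sum_act[OF f(1), of \<omega>] gauss_sum_shift[OF \<omega> v(1)] f v by simp
    then have "\<omega> v = 0"
      using gauss_sum_values[OF \<omega>] form_values[OF \<omega> v(1)] by auto
    then show "\<omega>' \<in> shift \<omega> ` {v \<in> carrier V. \<omega> v = 0}" using v by blast
  qed
  show "shift \<omega> ` {v \<in> carrier V. \<omega> v = 0} \<subseteq> orbit (Sp V dot) act \<omega>"
    unfolding orbit_def using act_transvection[OF \<omega>, symmetric] transvection_Sp by blast
qed

text \<open>In additive notation \<open>shift \<omega> w\<close> vanishes at \<open>v\<close> exactly if \<open>\<omega> (w + v) = \<omega> w\<close>, so this is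
  \<open>orbit_form\<close> for the shifted form, with zeros translated by \<open>w\<close>.\<close>

lemma orbit_shift:
  assumes \<omega>: "\<omega> \<in> quadratic_forms" and w: "w \<in> carrier V"
  shows "orbit (Sp V dot) act (shift \<omega> w) = shift \<omega> ` {u \<in> carrier V. \<omega> u = \<omega> w}"
proof -
  have iff: "shift \<omega> w v = 0 \<longleftrightarrow> \<omega> (w \<otimes> v) = \<omega> w" if v: "v \<in> carrier V" for v
    using shift_translate[OF \<omega> v w] form_values[OF \<omega> w] form_values[OF \<omega>, of "v \<otimes> w"] v w
    by (auto simp: m_comm)
  have "(\<lambda>v. w \<otimes> v) ` {v \<in> carrier V. shift \<omega> w v = 0} = {u \<in> carrier V. \<omega> u = \<omega> w}"
  proof
    show "{u \<in> carrier V. \<omega> u = \<omega> w} \<subseteq> (\<lambda>v. w \<otimes> v) ` {v \<in> carrier V. shift \<omega> w v = 0}"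
    proof
      fix u assume u: "u \<in> {u \<in> carrier V. \<omega> u = \<omega> w}"
      then have "w \<otimes> (w \<otimes> u) = u" using w by (simp add: m_assoc[symmetric] double)
      then show "u \<in> (\<lambda>v. w \<otimes> v) ` {v \<in> carrier V. shift \<omega> w v = 0}"
        using u w by (intro image_eqI[of _ _ "w \<otimes> u"]) (auto simp: iff)
    qed
  qed (use w iff in auto)
  moreover have "orbit (Sp V dot) act (shift \<omega> w)
      = shift \<omega> ` (\<lambda>v. w \<otimes> v) ` {v \<in> carrier V. shift \<omega> w v = 0}"
    unfolding orbit_form[OF shift_form[OF \<omega> w]] image_image
    using w by (intro image_cong) (auto simp: shift_shift)
  ultimately show ?thesis by simp
qed

text \<open>The two numbers have sum \<open>4 ^ g\<close> and difference \<open>\<plusminus>2 ^ g\<close>.  The sign depends on the form \<open>\<omega>\<close>,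
  hence the comparison of unordered pairs.\<close>

lemma card_level_sets:
  assumes \<omega>: "\<omega> \<in> quadratic_forms"
  shows "{card {v \<in> carrier V. \<omega> v = 0}, card {v \<in> carrier V. \<omega> v = 1}}
      = {2 ^ (g - 1) * (2 ^ g + 1), 2 ^ (g - 1) * (2 ^ g - 1)}"
proof -
  let ?Z = "{v \<in> carrier V. \<omega> v = 0}" and ?N = "{v \<in> carrier V. \<omega> v = 1}"
  have un: "?Z \<union> ?N = carrier V" using form_values[OF \<omega>] by auto
  have fin: "finite ?Z" "finite ?N"
    by (simp_all add: finite_carrier)
  have disj: "?Z \<inter> ?N = {}" by force
  have "card (?Z \<union> ?N) = card ?Z + card ?N"
    using fin disj by (rule card_Un_disjoint)
  then have "card ?Z + card ?N = 2 ^ (2 * g)"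
    by (simp only: un card_carrier)
  then have "int (card ?Z + card ?N) = int (2 ^ (2 * g))" by (simp only:)
  then have total: "int (card ?Z) + int (card ?N) = 2 ^ (2 * g)" by simp
  have "sum (\<lambda>a. parity_sign (\<omega> a)) (?Z \<union> ?N)
      = (\<Sum>a\<in>?Z. parity_sign (\<omega> a)) + (\<Sum>a\<in>?N. parity_sign (\<omega> a))"
    using fin disj by (rule sum.union_disjoint)
  then have "gauss_sum \<omega> = (\<Sum>a\<in>?Z. parity_sign (\<omega> a)) + (\<Sum>a\<in>?N. parity_sign (\<omega> a))"
    by (simp only: un gauss_sum_def)
  then have difference: "gauss_sum \<omega> = int (card ?Z) - int (card ?N)" by simp
  obtain k where k: "g = Suc k" using genus_pos by (cases g) auto
  have pow: "(2::int) ^ (2 * g) = 4 * (2 ^ k * 2 ^ k)" "(2::int) ^ g = 2 * 2 ^ k"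
    unfolding k power_even_eq power_Suc by (simp_all add: power2_eq_square)
  have sizes: "int (2 ^ (g - 1) * (2 ^ g + 1)) = 2 * (2 ^ k * 2 ^ k) + 2 ^ k"
    "int (2 ^ (g - 1) * (2 ^ g - 1)) = 2 * (2 ^ k * 2 ^ k) - 2 ^ k"
    by (simp_all add: k algebra_simps of_nat_diff)
  from gauss_sum_values[OF \<omega>] show ?thesis
  proof
    assume "gauss_sum \<omega> = 2 ^ g"
    then have "int (card ?Z) = int (2 ^ (g - 1) * (2 ^ g + 1))"
      "int (card ?N) = int (2 ^ (g - 1) * (2 ^ g - 1))"
      using total difference unfolding sizes pow by linarith+
    then have "card ?Z = 2 ^ (g - 1) * (2 ^ g + 1)" "card ?N = 2 ^ (g - 1) * (2 ^ g - 1)"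
      by (simp_all only: of_nat_eq_iff)
    then show ?thesis by simp
  next
    assume "gauss_sum \<omega> = - (2 ^ g)"
    then have "int (card ?N) = int (2 ^ (g - 1) * (2 ^ g + 1))"
      "int (card ?Z) = int (2 ^ (g - 1) * (2 ^ g - 1))"
      using total difference unfolding sizes pow by linarith+
    then have "card ?N = 2 ^ (g - 1) * (2 ^ g + 1)" "card ?Z = 2 ^ (g - 1) * (2 ^ g - 1)"
      by (simp_all only: of_nat_eq_iff)
    then show ?thesis by auto
  qed
qed

text \<open>A form \<open>\<omega>\<close> identifies the set of all forms with the vector space, by \<open>v \<mapsto> shift \<omega> v\<close>.  By
  \<open>orbit_shift\<close> the orbits correspond to the two level sets of \<open>\<omega>\<close>.\<close>

theorem orbits_of_quadratic_forms:
  assumes \<omega>: "\<omega> \<in> quadratic_forms"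
  obtains O1 O2 where "O1 \<noteq> O2" "orbits (Sp V dot) quadratic_forms act = {O1, O2}"
    "card O1 = 2 ^ (g - 1) * (2 ^ g + 1)" "card O2 = 2 ^ (g - 1) * (2 ^ g - 1)"
proof -
  define L where "L n = {v \<in> carrier V. \<omega> v = n}" for n
  have card_L: "card (shift \<omega> ` L n) = card (L n)" for n
    by (rule card_image) (auto simp: L_def intro: inj_on_subset[OF inj_shift])
  have cards: "{card (L 0), card (L 1)} = {2 ^ (g - 1) * (2 ^ g + 1), 2 ^ (g - 1) * (2 ^ g - 1)}"
    using card_level_sets[OF \<omega>] by (simp add: L_def)
  have "(2::nat) ^ g > 1" using genus_pos one_less_power[of "2::nat" g] by linarith
  then have sizes: "(2::nat) ^ (g - 1) * (2 ^ g + 1) \<noteq> 2 ^ (g - 1) * (2 ^ g - 1)"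
    "(2::nat) ^ (g - 1) * (2 ^ g + 1) \<noteq> 0" "(2::nat) ^ (g - 1) * (2 ^ g - 1) \<noteq> 0"
    unfolding mult_cancel1 by auto
  have nonempty: "L 0 \<noteq> {}" "L 1 \<noteq> {}" and distinct: "card (L 0) \<noteq> card (L 1)"
    using cards sizes by (auto simp: doubleton_eq_iff)
  have "orbits (Sp V dot) quadratic_forms act = {shift \<omega> ` L 0, shift \<omega> ` L 1}"
  proof
    show "orbits (Sp V dot) quadratic_forms act \<subseteq> {shift \<omega> ` L 0, shift \<omega> ` L 1}"
    proof
      fix O' assume "O' \<in> orbits (Sp V dot) quadratic_forms act"
      then obtain \<omega>' where \<omega>': "\<omega>' \<in> quadratic_forms" "O' = orbit (Sp V dot) act \<omega>'"
        by (auto simp: orbits_def)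
      obtain w where w: "w \<in> carrier V" "\<omega>' = shift \<omega> w" using form_eq_shift[OF \<omega> \<omega>'(1)] .
      have "O' = shift \<omega> ` L (\<omega> w)" using orbit_shift[OF \<omega> w(1)] \<omega>' w by (simp add: L_def)
      then show "O' \<in> {shift \<omega> ` L 0, shift \<omega> ` L 1}" using form_values[OF \<omega> w(1)] by auto
    qed
    have "shift \<omega> ` L n \<in> orbits (Sp V dot) quadratic_forms act" if "L n \<noteq> {}" for n
    proof -
      obtain w where w: "w \<in> carrier V" "\<omega> w = n" using \<open>L n \<noteq> {}\<close> by (auto simp: L_def)
      have "shift \<omega> ` L n = orbit (Sp V dot) act (shift \<omega> w)"
        using orbit_shift[OF \<omega> w(1)] w by (simp add: L_def)
      then show ?thesis using shift_form[OF \<omega> w(1)] by (auto simp: orbits_def)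
    qed
    then show "{shift \<omega> ` L 0, shift \<omega> ` L 1} \<subseteq> orbits (Sp V dot) quadratic_forms act"
      using nonempty by simp
  qed
  then have orbits: "orbits (Sp V dot) quadratic_forms act = {shift \<omega> ` L 0, shift \<omega> ` L 1}"
    "orbits (Sp V dot) quadratic_forms act = {shift \<omega> ` L 1, shift \<omega> ` L 0}"
    by auto
  have neq: "shift \<omega> ` L 0 \<noteq> shift \<omega> ` L 1" using distinct card_L[of 0] card_L[of 1] by auto
  from cards consider
    "card (L 0) = 2 ^ (g - 1) * (2 ^ g + 1)" "card (L 1) = 2 ^ (g - 1) * (2 ^ g - 1)"
    | "card (L 1) = 2 ^ (g - 1) * (2 ^ g + 1)" "card (L 0) = 2 ^ (g - 1) * (2 ^ g - 1)"
    unfolding doubleton_eq_iff by blast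
  then show ?thesis
  proof cases
    case 1
    then show ?thesis by (intro that[OF neq orbits(1)]) (simp_all only: card_L)
  next
    case 2
    then show ?thesis by (intro that[OF neq[symmetric] orbits(2)]) (simp_all only: card_L)
  qed
qed

end

section \<open>Bases and generators\<close>

lemma hom_eq_on_generate:
  assumes G: "group G" and H: "group H" and hom: "\<phi> \<in> hom G H" "\<phi>' \<in> hom G H"
    and S: "S \<subseteq> carrier G" and eq: "\<And>s. s \<in> S \<Longrightarrow> \<phi> s = \<phi>' s" and x: "x \<in> generate G S"
  shows "\<phi> x = \<phi>' x"
  using x
proof induction
  case one
  then show ?case using hom_one[OF hom(1) G H] hom_one[OF hom(2) G H] by simp
next
  case (incl s)
  then show ?case by (rule eq)
next
  case (inv s)
  then have "s \<in> carrier G" "\<phi> s = \<phi>' s" using S eq by auto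
  then show ?case
    using group_hom.hom_inv[of G H \<phi> s] group_hom.hom_inv[of G H \<phi>' s] G H hom
    by (simp add: group_hom_def group_hom_axioms_def)
next
  case (eng x y)
  then have "x \<in> carrier G" "y \<in> carrier G"
    using group.generate_in_carrier[OF G S] by auto
  then show ?case using eng hom_mult[OF hom(1)] hom_mult[OF hom(2)] by simp
qed

lemma presented_by_generate:
  assumes "presented_by G y I R"
  shows "generate G (y ` I) = carrier G"
proof -
  note G = presented_byD(1)[OF assms] and y = presented_byD(2)[OF assms]
    and surj = presented_byD(3)[OF assms]
  have sub: "subgroup (generate G (y ` I)) G" by (rule group.generate_is_subgroup[OF G y])
  have "word_eval G y w \<in> generate G (y ` I)" if "w \<in> words I" for w
    using that unfolding words_def
  proof (induction w)
    case Nil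
    then show ?case by (simp add: word_eval_def generate.one)
  next
    case (Cons s w)
    obtain i n where s: "s = (i, n)" by force
    have "y i \<in> generate G (y ` I)" using Cons s by (auto intro: generate.incl)
    then have "y i [^]\<^bsub>G\<^esub> n \<in> generate G (y ` I)"
      by (rule group.subgroup_int_pow_closed[OF G sub])
    then show ?case using Cons by (simp add: s word_eval_def generate.eng)
  qed
  then have "carrier G \<subseteq> generate G (y ` I)" unfolding surj[symmetric] by (rule image_subsetI)
  then show ?thesis using group.generate_in_carrier[OF G y] by auto
qed

lemma hom_Z2_int_pow:
  assumes "group G" "\<phi> \<in> hom G Z2" "x \<in> carrier G"
  shows "\<phi> (x [^]\<^bsub>G\<^esub> (n::int)) = (n * \<phi> x) mod 2"
  using hom_int_pow[of \<phi> G Z2 x n] assms by (simp add: int_pow_integer_mod_group)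

lemma (in comm_group) hom_Z2_combination:
  assumes \<phi>: "\<phi> \<in> hom G Z2" and \<sigma>: "\<sigma> ` I \<subseteq> carrier G" and I: "finite I"
  shows "\<phi> (finprod G (\<lambda>i. \<sigma> i [^] (c i :: int)) I) = (\<Sum>i\<in>I. c i * \<phi> (\<sigma> i)) mod 2"
  using I \<sigma>
proof (induction I)
  case empty
  then show ?case using hom_one[OF \<phi>] by simp
next
  case (insert j I)
  have cl: "(\<lambda>i. \<sigma> i [^] c i) \<in> I \<rightarrow> carrier G" "\<sigma> j [^] c j \<in> carrier G" using insert by auto
  then have "\<phi> (finprod G (\<lambda>i. \<sigma> i [^] c i) (insert j I))
      = (\<phi> (\<sigma> j [^] c j) + \<phi> (finprod G (\<lambda>i. \<sigma> i [^] c i) I)) mod 2"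
    using insert \<phi> by (simp add: hom_Z2_iff)
  also have "\<dots> = ((c j * \<phi> (\<sigma> j)) mod 2 + (\<Sum>i\<in>I. c i * \<phi> (\<sigma> i)) mod 2) mod 2"
    using insert hom_Z2_int_pow[OF _ \<phi>] by simp
  finally show ?case using insert by (simp add: mod_add_eq)
qed

lemma Z2_basis_generate:
  assumes H: "comm_group H" and basis: "Z2_basis H \<sigma> I"
  shows "generate H (\<sigma> ` I) = carrier H"
proof -
  interpret comm_group H by fact
  have \<sigma>: "\<sigma> ` I \<subseteq> carrier H" using basis by (simp add: Z2_basis_def)
  have sub: "subgroup (generate H (\<sigma> ` I)) H" using \<sigma> by (rule generate_is_subgroup)
  have *: "finprod H f I' \<in> generate H (\<sigma> ` I)"
    if "f ` I' \<subseteq> generate H (\<sigma> ` I)" for f I'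
    using that
  proof (induction I' rule: infinite_finite_induct)
    case (insert j J)
    then have "f ` insert j J \<subseteq> carrier H" using generate_in_carrier[OF \<sigma>] by blast
    then show ?case using insert by (simp add: generate.eng Pi_def image_subset_iff)
  qed (simp_all add: generate.one)
  have "finprod H (\<lambda>i. \<sigma> i [^]\<^bsub>H\<^esub> c i) I \<in> generate H (\<sigma> ` I)" for c :: "nat \<Rightarrow> int"
    by (intro * image_subsetI subgroup_int_pow_closed[OF sub] generate.incl imageI)
  moreover have "carrier H = (\<lambda>c. finprod H (\<lambda>i. \<sigma> i [^]\<^bsub>H\<^esub> c i) I) ` (I \<rightarrow>\<^sub>E carrier Z2)"
    using basis by (simp add: Z2_basis_def bij_betw_def)
  ultimately have "carrier H \<subseteq> generate H (\<sigma> ` I)" by auto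
  then show ?thesis using generate_in_carrier[OF \<sigma>] by auto
qed

text \<open>The index of the basis vector dual to the given one in a symplectic basis.\<close>

definition partner :: "nat \<Rightarrow> nat" where
  "partner i = (if odd i then i + 1 else i - 1)"

lemma partner:
  assumes "i \<in> {1..2 * g}"
  shows "partner i \<in> {1..2 * g}" "partner (partner i) = i"
    "(\<exists>l\<in>{1..g}. {i, j} = {2 * l - 1, 2 * l}) \<longleftrightarrow> j = partner i"
proof -
  obtain l where l: "l \<in> {1..g}" "i = 2 * l - 1 \<or> i = 2 * l"
  proof (cases "even i")
    case True
    then show ?thesis using assms that[of "i div 2"] by auto
  next
    case False
    then show ?thesis using assms that[of "(i + 1) div 2"] by (auto elim!: oddE)
  qed
  show "partner i \<in> {1..2 * g}" "partner (partner i) = i"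
    using l assms by (auto simp: partner_def)
  show "(\<exists>l\<in>{1..g}. {i, j} = {2 * l - 1, 2 * l}) \<longleftrightarrow> j = partner i"
  proof
    assume "j = partner i"
    then have "{i, j} = {2 * l - 1, 2 * l}" using l by (auto simp: partner_def)
    then show "\<exists>l\<in>{1..g}. {i, j} = {2 * l - 1, 2 * l}" using l by blast
  next
    assume "\<exists>l\<in>{1..g}. {i, j} = {2 * l - 1, 2 * l}"
    then obtain m where m: "m \<ge> 1" "{i, j} = {2 * m - 1, 2 * m}" by auto
    then have "(i = 2 * m - 1 \<and> j = 2 * m) \<or> (i = 2 * m \<and> j = 2 * m - 1)"
      by (simp add: doubleton_eq_iff)
    then show "j = partner i" using m(1) by (auto simp: partner_def)
  qed
qed

text \<open>All assertions about homomorphisms are checked on the basis.  The coefficient of \<open>\<sigma> (partner j)\<close>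
  in a vector is its product with \<open>\<sigma> j\<close>, which gives nondegeneracy and the representation of linear
  forms.\<close>

lemma symplectic_basis_space:
  fixes H (structure)
  assumes H: "comm_group H" and double: "\<And>a. a \<in> carrier H \<Longrightarrow> a \<otimes> a = \<one>"
    and symp: "symplectic_basis H dot g \<sigma>" and g: "g \<ge> 1"
  shows "symplectic_Z2_space H dot g"
proof -
  interpret comm_group H by fact
  let ?I = "{1..2 * g}"
  have basis: "Z2_basis H \<sigma> ?I" and \<sigma>: "\<sigma> ` ?I \<subseteq> carrier H"
    and right: "\<And>a. a \<in> carrier H \<Longrightarrow> dot a \<in> hom H Z2"
    and left: "\<And>b. b \<in> carrier H \<Longrightarrow> (\<lambda>a. dot a b) \<in> hom H Z2"
    using symp by (auto simp: symplectic_basis_def Z2_basis_def Z2_bilinear_def)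
  have \<sigma>i: "\<sigma> i \<in> carrier H" if "i \<in> ?I" for i using \<sigma> that by blast
  have dot_\<sigma>: "dot (\<sigma> i) (\<sigma> j) = (if j = partner i then 1 else 0)" if "i \<in> ?I" "j \<in> ?I" for i j
    using symp that partner(3)[OF that(1), of j] by (simp add: symplectic_basis_def)
  have agree: "\<phi> a = \<phi>' a" if "\<phi> \<in> hom H Z2" "\<phi>' \<in> hom H Z2" "\<And>i. i \<in> ?I \<Longrightarrow> \<phi> (\<sigma> i) = \<phi>' (\<sigma> i)"
    "a \<in> carrier H" for \<phi> \<phi>' a
  proof (rule hom_eq_on_generate[OF is_group _ that(1,2) \<sigma>])
    show "\<phi> s = \<phi>' s" if "s \<in> \<sigma> ` ?I" for s
      using that \<open>\<And>i. i \<in> ?I \<Longrightarrow> \<phi> (\<sigma> i) = \<phi>' (\<sigma> i)\<close> by blast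
    show "a \<in> generate H (\<sigma> ` ?I)" using that(4) Z2_basis_generate[OF H basis] by simp
  qed simp
  have sym: "dot a b = dot b a" if a: "a \<in> carrier H" and b: "b \<in> carrier H" for a b
  proof (rule agree[OF left[OF b] right[OF b] _ a])
    fix i assume i: "i \<in> ?I"
    show "dot (\<sigma> i) b = dot b (\<sigma> i)"
    proof (rule agree[OF right[OF \<sigma>i[OF i]] left[OF \<sigma>i[OF i]] _ b])
      fix j assume j: "j \<in> ?I"
      show "dot (\<sigma> i) (\<sigma> j) = dot (\<sigma> j) (\<sigma> i)"
        using i j partner(2)[OF i] partner(2)[OF j] by (auto simp: dot_\<sigma>)
    qed
  qed
  have self: "dot a a = 0" if a: "a \<in> carrier H" for a
  proof (rule agree[of "\<lambda>a. dot a a" "\<lambda>_. 0"])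
    have *: "dot (a \<otimes> b) (a \<otimes> b) = (dot a a + dot b b) mod 2"
      if ab: "a \<in> carrier H" "b \<in> carrier H" for a b
    proof -
      have "dot (a \<otimes> b) (a \<otimes> b) = ((dot a a + dot a b) mod 2 + (dot b a + dot b b) mod 2) mod 2"
        using left[of "a \<otimes> b"] right[OF ab(1)] right[OF ab(2)] ab by (simp add: hom_Z2_iff)
      then show ?thesis unfolding sym[OF ab(2) ab(1)] by (auto simp: mod_2_eq_iff)
    qed
    show "(\<lambda>a. dot a a) \<in> hom H Z2"
      using right * unfolding hom_Z2_iff by auto
    show "dot (\<sigma> i) (\<sigma> i) = 0" if "i \<in> ?I" for i
      using that dot_\<sigma>[OF that that] by (auto simp: partner_def split: if_splits elim!: oddE)
  qed (use a in \<open>auto simp: hom_Z2_iff\<close>)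
  have coeff: "dot (\<sigma> j) (finprod H (\<lambda>i. \<sigma> i [^] (c i :: int)) ?I) = c (partner j) mod 2"
    if j: "j \<in> ?I" for c j
  proof -
    have "(\<Sum>i\<in>?I. c i * dot (\<sigma> j) (\<sigma> i)) = (\<Sum>i\<in>?I. if i = partner j then c i else 0)"
      using j by (intro sum.cong) (auto simp: dot_\<sigma>)
    also have "\<dots> = c (partner j)" using partner(1)[OF j] by simp
    finally show ?thesis
      using hom_Z2_combination[OF right[OF \<sigma>i[OF j]] \<sigma>, of c] by simp
  qed
  have nondeg: "v = \<one>" if v: "v \<in> carrier H" "\<And>a. a \<in> carrier H \<Longrightarrow> dot a v = 0" for v
  proof -
    obtain c where c: "c \<in> ?I \<rightarrow>\<^sub>E carrier Z2" "v = finprod H (\<lambda>i. \<sigma> i [^] c i) ?I"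
      using basis v(1) unfolding Z2_basis_def bij_betw_def by blast
    have "c i = 0" if i: "i \<in> ?I" for i
    proof -
      have "c i mod 2 = 0"
        using coeff[OF partner(1)[OF i], of c] v(2)[OF \<sigma>i[OF partner(1)[OF i]]] c(2) partner(2)[OF i]
        by simp
      moreover have "c i \<in> {0..<2}" using c(1) i by (auto simp: carrier_integer_mod_group)
      ultimately show ?thesis by auto
    qed
    then have "v = finprod H (\<lambda>i. \<one>) ?I" unfolding c(2) by (intro finprod_cong') auto
    then show ?thesis by simp
  qed
  have repr: "\<exists>v\<in>carrier H. \<forall>a\<in>carrier H. l a = dot a v" if l: "l \<in> hom H Z2" for l
  proof (intro bexI ballI)
    let ?v = "finprod H (\<lambda>i. \<sigma> i [^] l (\<sigma> (partner i))) ?I"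
    show v: "?v \<in> carrier H" using \<sigma>i by (intro finprod_closed) auto
    fix a assume a: "a \<in> carrier H"
    show "l a = dot a ?v"
    proof (rule agree[OF l left[OF v] _ a])
      fix j assume j: "j \<in> ?I"
      have "l (\<sigma> j) \<in> {0, 1}" using l \<sigma>i[OF j] by (simp only: hom_Z2_iff)
      then show "l (\<sigma> j) = dot (\<sigma> j) ?v"
        unfolding coeff[OF j] partner(2)[OF j] by auto
    qed
  qed
  have "card (carrier H) = card (?I \<rightarrow>\<^sub>E carrier Z2)"
    using basis unfolding Z2_basis_def by (intro bij_betw_same_card[symmetric]) (elim conjE)
  also have "\<dots> = 2 ^ (2 * g)" by (simp add: card_PiE carrier_integer_mod_group)
  finally have card: "card (carrier H) = 2 ^ (2 * g)" .
  show ?thesis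
    by unfold_locales (use double right sym self nondeg repr card g in auto)
qed

section \<open>The action defined by a quadratic section\<close>

text \<open>The algebra behind the action on special coverings.  \<open>V\<close> and \<open>W\<close> are the first homology groups
  of the base and of the total space, \<open>G\<close> is the fundamental group of the total space and \<open>h\<close> its
  Hurewicz map.\<close>

locale quadratic_section_action =
  V: symplectic_Z2_space V dot g + W: comm_group W + G: group G
  for V :: "('a, 'm) monoid_scheme" and dot g
    and W :: "('b, 'n) monoid_scheme" and G :: "('c, 'k) monoid_scheme" +
  fixes h :: "'c \<Rightarrow> 'b" and u0 :: 'c and \<sigma> :: "nat \<Rightarrow> 'a" and \<nu> :: "nat \<Rightarrow> 'b"
    and r :: "nat \<Rightarrow> int" and s :: "'a \<Rightarrow> 'b"
  assumes W_double: "y \<in> carrier W \<Longrightarrow> y \<otimes>\<^bsub>W\<^esub> y = \<one>\<^bsub>W\<^esub>"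
    and h_hom: "h \<in> hom G W" and h_surj: "h ` carrier G = carrier W"
    and h_factor: "\<phi> \<in> hom G Z2 \<Longrightarrow> \<exists>\<psi>\<in>hom W Z2. \<forall>x\<in>carrier G. \<phi> x = \<psi> (h x)"
    and u0: "u0 \<in> carrier G" "h u0 = \<nu> 0"
    and \<sigma>_carrier: "\<sigma> ` {1..2 * g} \<subseteq> carrier V"
    and \<sigma>_generate: "generate V (\<sigma> ` {1..2 * g}) = carrier V"
    and \<nu>_carrier: "\<nu> ` {0..2 * g} \<subseteq> carrier W"
    and \<nu>_generate: "generate W (\<nu> ` {0..2 * g}) = carrier W"
    and \<nu>_characters: "\<exists>\<psi>\<in>hom W Z2. \<forall>i\<in>{0..2 * g}. \<psi> (\<nu> i) = a i mod 2"
    and quadratic: "quadratic_section V dot W g \<sigma> \<nu> r s"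
begin

lemma \<sigma>_closed: "i \<in> {1..2 * g} \<Longrightarrow> \<sigma> i \<in> carrier V"
  using \<sigma>_carrier by blast

lemma \<nu>_closed: "i \<le> 2 * g \<Longrightarrow> \<nu> i \<in> carrier W"
  using \<nu>_carrier by auto

lemma \<nu>0_closed: "\<nu> 0 \<in> carrier W"
  by (simp add: \<nu>_closed)

lemma s_closed: "a \<in> carrier V \<Longrightarrow> s a \<in> carrier W"
  using quadratic unfolding quadratic_section_def by (elim conjE) (erule (1) funcset_mem)

lemma r_values: "i \<in> {1..2 * g} \<Longrightarrow> r i = 0 \<or> r i = 1"
proof -
  assume i: "i \<in> {1..2 * g}"
  have "r ` {1..2 * g} \<subseteq> carrier Z2"
    using quadratic unfolding quadratic_section_def by (elim conjE)
  then show ?thesis using i by (force simp: carrier_integer_mod_group)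
qed

lemma s_basis: "i \<in> {1..2 * g} \<Longrightarrow> s (\<sigma> i) = \<nu> i \<otimes>\<^bsub>W\<^esub> (\<nu> 0 [^]\<^bsub>W\<^esub> r i)"
  using quadratic unfolding quadratic_section_def by (elim conjE) (erule (1) bspec)

lemma s_mult: "a \<in> carrier V \<Longrightarrow> b \<in> carrier V \<Longrightarrow>
    s (a \<otimes>\<^bsub>V\<^esub> b) = s a \<otimes>\<^bsub>W\<^esub> s b \<otimes>\<^bsub>W\<^esub> (\<nu> 0 [^]\<^bsub>W\<^esub> dot a b)"
  using quadratic unfolding quadratic_section_def by (elim conjE) (drule (1) bspec, erule (1) bspec)

lemma W_cancel: "x \<in> carrier W \<Longrightarrow> y \<in> carrier W \<Longrightarrow> x \<otimes>\<^bsub>W\<^esub> y \<otimes>\<^bsub>W\<^esub> y = x"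
  by (simp add: W.m_assoc W_double)

lemma \<nu>_section: "i \<in> {1..2 * g} \<Longrightarrow> \<nu> i = s (\<sigma> i) \<otimes>\<^bsub>W\<^esub> (\<nu> 0 [^]\<^bsub>W\<^esub> r i)"
  using \<nu>_closed[of i] \<nu>0_closed by (simp add: s_basis W_cancel)

text \<open>The values of a quadratic section on the basis, together with \<open>\<nu> 0\<close>, generate \<open>W\<close>; this gives
  the uniqueness of the maps in \<^const>\<open>section_lift\<close> and \<^const>\<open>linear_factor\<close>.\<close>

lemma W_hom_eqI:
  assumes K: "group K" and hom: "k \<in> hom W K" "k' \<in> hom W K"
    and eq0: "k (\<nu> 0) = k' (\<nu> 0)"
    and eq: "\<And>i. i \<in> {1..2 * g} \<Longrightarrow> k (s (\<sigma> i)) = k' (s (\<sigma> i))"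
    and y: "y \<in> carrier W"
  shows "k y = k' y"
proof (rule hom_eq_on_generate[OF W.is_group K hom \<nu>_carrier])
  show "y \<in> generate W (\<nu> ` {0..2 * g})" using y \<nu>_generate by simp
  fix z assume "z \<in> \<nu> ` {0..2 * g}"
  then obtain i where i: "i \<le> 2 * g" "z = \<nu> i" by auto
  show "k z = k' z"
  proof (cases "i = 0")
    case False
    then have i1: "i \<in> {1..2 * g}" using i by simp
    have c: "s (\<sigma> i) \<in> carrier W" "\<nu> 0 [^]\<^bsub>W\<^esub> r i \<in> carrier W"
      using s_closed[OF \<sigma>_closed[OF i1]] \<nu>0_closed by auto
    have "k (\<nu> 0 [^]\<^bsub>W\<^esub> r i) = k' (\<nu> 0 [^]\<^bsub>W\<^esub> r i)"
      using hom_int_pow[OF hom(1) \<nu>0_closed W.is_group K] hom_int_pow[OF hom(2) \<nu>0_closed W.is_group K] eq0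
      by simp
    then show ?thesis
      unfolding i(2) \<nu>_section[OF i1] hom_mult[OF hom(1) c] hom_mult[OF hom(2) c] eq[OF i1] by simp
  qed (use i eq0 in simp)
qed

lemma V_hom_eqI:
  assumes "group K" "k \<in> hom V K" "k' \<in> hom V K"
    and eq: "\<And>i. i \<in> {1..2 * g} \<Longrightarrow> k (\<sigma> i) = k' (\<sigma> i)" and a: "a \<in> carrier V"
  shows "k a = k' a"
proof (rule hom_eq_on_generate[OF V.is_group assms(1-3) \<sigma>_carrier])
  show "a \<in> generate V (\<sigma> ` {1..2 * g})" using a \<sigma>_generate by simp
qed (use eq in blast)

text \<open>The linear projection from \<open>W\<close> to \<open>V\<close>, with kernel generated by \<open>\<nu> 0\<close>.  It is assembled from the
  characters dual to the generators \<open>\<nu> i\<close>.  It is left inverse to \<open>s\<close>: the deviation of \<open>s\<close> from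
  linearity is a multiple of \<open>\<nu> 0\<close>, so its composite with \<open>s\<close> is linear and the identity on the
  basis.\<close>

lemma projection:
  obtains p where "p \<in> hom W V" "\<And>a. a \<in> carrier V \<Longrightarrow> p (s a) = a" "p (\<nu> 0) = \<one>\<^bsub>V\<^esub>"
proof -
  let ?I = "{1..2 * g}"
  \<comment> \<open>The characters \<open>\<psi> i\<close> are the coordinate functions with respect to the generators \<open>\<nu> i\<close>.\<close>
  have "\<forall>i. \<exists>\<psi>. \<psi> \<in> hom W Z2 \<and> (\<forall>j\<in>{0..2 * g}. \<psi> (\<nu> j) = (if j = i then 1 else 0))"
  proof
    fix i
    show "\<exists>\<psi>. \<psi> \<in> hom W Z2 \<and> (\<forall>j\<in>{0..2 * g}. \<psi> (\<nu> j) = (if j = i then 1 else 0))"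
      using \<nu>_characters[of "\<lambda>j. if j = i then 1 else 0"] by auto
  qed
  then obtain \<psi> where \<psi>: "\<And>i. \<psi> i \<in> hom W Z2"
    "\<And>i j. j \<in> {0..2 * g} \<Longrightarrow> \<psi> i (\<nu> j) = (if j = i then 1 else 0)"
    unfolding choice_iff by blast
  define p where "p y = finprod V (\<lambda>i. \<sigma> i [^]\<^bsub>V\<^esub> \<psi> i y) ?I" for y
  have pow_closed: "(\<lambda>i. \<sigma> i [^]\<^bsub>V\<^esub> \<psi> i y) \<in> ?I \<rightarrow> carrier V" for y
    using \<sigma>_closed by auto
  have p_hom: "p \<in> hom W V"
  proof (rule homI)
    show "p y \<in> carrier V" for y unfolding p_def using pow_closed by (rule V.finprod_closed)
    fix y z assume yz: "y \<in> carrier W" "z \<in> carrier W"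
    have "\<sigma> i [^]\<^bsub>V\<^esub> \<psi> i (y \<otimes>\<^bsub>W\<^esub> z) = \<sigma> i [^]\<^bsub>V\<^esub> \<psi> i y \<otimes>\<^bsub>V\<^esub> \<sigma> i [^]\<^bsub>V\<^esub> \<psi> i z" if i: "i \<in> ?I" for i
    proof -
      have "\<psi> i y \<in> {0, 1}" "\<psi> i z \<in> {0, 1}" "\<psi> i (y \<otimes>\<^bsub>W\<^esub> z) = (\<psi> i y + \<psi> i z) mod 2"
        using \<psi>(1)[of i] yz unfolding hom_Z2_iff by auto
      then show ?thesis using \<sigma>_closed[OF i] by (auto simp: V.double)
    qed
    then have "p (y \<otimes>\<^bsub>W\<^esub> z)
        = finprod V (\<lambda>i. \<sigma> i [^]\<^bsub>V\<^esub> \<psi> i y \<otimes>\<^bsub>V\<^esub> \<sigma> i [^]\<^bsub>V\<^esub> \<psi> i z) ?I"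
      unfolding p_def using \<sigma>_closed by (intro V.finprod_cong') auto
    then show "p (y \<otimes>\<^bsub>W\<^esub> z) = p y \<otimes>\<^bsub>V\<^esub> p z"
      unfolding p_def by (simp only: V.finprod_multf[OF pow_closed pow_closed])
  qed
  have p0: "p (\<nu> 0) = \<one>\<^bsub>V\<^esub>"
    unfolding p_def by (intro V.finprod_one_eqI) (simp add: \<psi>(2))
  have p\<nu>: "p (\<nu> j) = \<sigma> j" if j: "j \<in> ?I" for j
  proof -
    have "p (\<nu> j) = finprod V (\<lambda>i. if j = i then \<sigma> i else \<one>\<^bsub>V\<^esub>) ?I"
      unfolding p_def using \<sigma>_closed j by (intro V.finprod_cong') (auto simp: \<psi>(2))
    also have "\<dots> = \<sigma> j" using \<sigma>_closed j by (intro V.finprod_singleton) auto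
    finally show ?thesis .
  qed
  have p_pow: "p (\<nu> 0 [^]\<^bsub>W\<^esub> (n::int)) = \<one>\<^bsub>V\<^esub>" for n
    using hom_int_pow[OF p_hom \<nu>0_closed W.is_group V.is_group] p0 by simp
  have ps_hom: "(\<lambda>a. p (s a)) \<in> hom V V"
  proof (rule homI)
    have p_closed: "p y \<in> carrier V" for y
      unfolding p_def using pow_closed by (rule V.finprod_closed)
    then show "p (s a) \<in> carrier V" for a .
    fix a b assume ab: "a \<in> carrier V" "b \<in> carrier V"
    have c: "s a \<in> carrier W" "s b \<in> carrier W" "\<nu> 0 [^]\<^bsub>W\<^esub> dot a b \<in> carrier W"
      using ab s_closed \<nu>0_closed by auto
    show "p (s (a \<otimes>\<^bsub>V\<^esub> b)) = p (s a) \<otimes>\<^bsub>V\<^esub> p (s b)"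
      unfolding s_mult[OF ab] using c p_closed
      by (simp add: hom_mult[OF p_hom] p_pow)
  qed
  have "p (s a) = a" if a: "a \<in> carrier V" for a
  proof (rule V_hom_eqI[OF V.is_group ps_hom _ _ a])
    show "(\<lambda>a. a) \<in> hom V V" by (auto simp: hom_def)
    fix i assume i: "i \<in> ?I"
    have "\<nu> i \<in> carrier W" "\<nu> 0 [^]\<^bsub>W\<^esub> r i \<in> carrier W" using i \<nu>_closed \<nu>0_closed by auto
    then show "p (s (\<sigma> i)) = \<sigma> i"
      unfolding s_basis[OF i] using \<sigma>_closed[OF i] by (simp add: hom_mult[OF p_hom] p_pow p\<nu>[OF i])
  qed
  then show ?thesis using that p_hom p0 by blast
qed

lemma s_one: "s \<one>\<^bsub>V\<^esub> = \<one>\<^bsub>W\<^esub>"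
proof -
  have "s \<one>\<^bsub>V\<^esub> = s \<one>\<^bsub>V\<^esub> \<otimes>\<^bsub>W\<^esub> s \<one>\<^bsub>V\<^esub>"
    using s_mult[of "\<one>\<^bsub>V\<^esub>" "\<one>\<^bsub>V\<^esub>"] s_closed[of "\<one>\<^bsub>V\<^esub>"] by (simp add: V.dot_self)
  then show ?thesis using W_double[OF s_closed[OF V.one_closed]] by simp
qed

text \<open>In additive notation the lift of \<open>f\<close> is \<open>y \<mapsto> y + s (p y) + s (f (p y))\<close>.  It exchanges \<open>s (p y)\<close>
  for \<open>s (f (p y))\<close> and keeps the fibre component \<open>y + s (p y)\<close>.  It is linear because \<open>f\<close> preserves
  the bilinear form, so that the two deviations of \<open>s\<close> from linearity cancel.\<close>

lemma section_lift:
  assumes f: "f \<in> carrier (Sp V dot)"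
  shows "section_lift W g \<sigma> \<nu> s f \<in> hom W W"
    "section_lift W g \<sigma> \<nu> s f (\<nu> 0) = \<nu> 0"
    "\<And>a. a \<in> carrier V \<Longrightarrow> section_lift W g \<sigma> \<nu> s f (s a) = s (f a)"
proof -
  note f_hom = V.SpD(1)[OF f] and f_bij = V.SpD(2)[OF f] and f_dot = V.SpD(3)[OF f]
    and f_closed = V.SpD(4)[OF f]
  obtain p where p: "p \<in> hom W V" "\<And>a. a \<in> carrier V \<Longrightarrow> p (s a) = a" "p (\<nu> 0) = \<one>\<^bsub>V\<^esub>"
    using projection by blast
  have p_closed: "p y \<in> carrier V" if "y \<in> carrier W" for y using p(1) that by (auto simp: hom_def)
  \<comment> \<open>The formula makes sense for all self-maps of \<open>V\<close>, in particular for the inverse of \<open>f\<close>,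
    whose lift is the inverse of the lift of \<open>f\<close>.\<close>
  define lift where "lift f' = (\<lambda>y\<in>carrier W. y \<otimes>\<^bsub>W\<^esub> s (p y) \<otimes>\<^bsub>W\<^esub> s (f' (p y)))" for f'
  have lift_closed: "lift f' y \<in> carrier W"
    if "\<And>a. a \<in> carrier V \<Longrightarrow> f' a \<in> carrier V" "y \<in> carrier W" for f' y
    using that p_closed s_closed by (simp add: lift_def)
  have p_lift: "p (lift f' y) = f' (p y)"
    if f': "\<And>a. a \<in> carrier V \<Longrightarrow> f' a \<in> carrier V" and y: "y \<in> carrier W" for f' y
  proof -
    have c: "p y \<in> carrier V" "f' (p y) \<in> carrier V" "s (p y) \<in> carrier W" "s (f' (p y)) \<in> carrier W"
      using f' p_closed[OF y] s_closed by auto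
    then have "p (lift f' y) = p y \<otimes>\<^bsub>V\<^esub> p y \<otimes>\<^bsub>V\<^esub> f' (p y)"
      using y by (simp add: lift_def hom_mult[OF p(1)] p(2))
    then show ?thesis using c by (simp add: V.double)
  qed
  have lift_section: "lift f' (s a) = s (f' a)"
    if "\<And>a. a \<in> carrier V \<Longrightarrow> f' a \<in> carrier V" "a \<in> carrier V" for f' a
    using that s_closed p(2) by (simp add: lift_def W_double)
  have lift_inverse: "lift f'' (lift f' y) = y"
    if f': "\<And>a. a \<in> carrier V \<Longrightarrow> f' a \<in> carrier V" "\<And>a. a \<in> carrier V \<Longrightarrow> f'' a \<in> carrier V"
      and inv: "\<And>a. a \<in> carrier V \<Longrightarrow> f'' (f' a) = a" and y: "y \<in> carrier W" for f' f'' y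
  proof -
    have c: "p y \<in> carrier V" "f' (p y) \<in> carrier V" "s (p y) \<in> carrier W" "s (f' (p y)) \<in> carrier W"
      using f' p_closed[OF y] s_closed by auto
    have "lift f'' (lift f' y) = lift f' y \<otimes>\<^bsub>W\<^esub> s (f' (p y)) \<otimes>\<^bsub>W\<^esub> s (p y)"
      using lift_closed[OF f'(1) y] p_lift[OF f'(1) y] inv c unfolding lift_def[of f''] by simp
    also have "\<dots> = y" using y c by (simp add: lift_def W_cancel)
    finally show ?thesis .
  qed
  have lift_hom: "lift f \<in> hom W W"
  proof (rule homI)
    show "lift f y \<in> carrier W" if "y \<in> carrier W" for y using lift_closed[OF f_closed that] .
    fix y z assume yz: "y \<in> carrier W" "z \<in> carrier W"
    define A B C D n where "A = s (p y)" and "B = s (p z)" and "C = s (f (p y))" and "D = s (f (p z))"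
      and "n = \<nu> 0 [^]\<^bsub>W\<^esub> dot (p y) (p z)"
    have pyz: "p y \<in> carrier V" "p z \<in> carrier V" using yz p_closed by auto
    have c: "A \<in> carrier W" "B \<in> carrier W" "C \<in> carrier W" "D \<in> carrier W" "n \<in> carrier W"
      using pyz f_closed s_closed \<nu>0_closed by (auto simp: A_def B_def C_def D_def n_def)
    have "lift f (y \<otimes>\<^bsub>W\<^esub> z) = y \<otimes>\<^bsub>W\<^esub> z \<otimes>\<^bsub>W\<^esub> (A \<otimes>\<^bsub>W\<^esub> B \<otimes>\<^bsub>W\<^esub> n) \<otimes>\<^bsub>W\<^esub> (C \<otimes>\<^bsub>W\<^esub> D \<otimes>\<^bsub>W\<^esub> n)"
      using yz pyz f_closed
      by (simp add: lift_def hom_mult[OF p(1)] hom_mult[OF f_hom] s_mult f_dot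
          A_def B_def C_def D_def n_def)
    \<comment> \<open>One factor \<open>n\<close> comes from \<open>s\<close> at \<open>p y\<close> and \<open>p z\<close>, the other from \<open>s\<close> at their images under
      \<open>f\<close>; they agree because \<open>f\<close> is symplectic.\<close>
    also have "\<dots> = (y \<otimes>\<^bsub>W\<^esub> A \<otimes>\<^bsub>W\<^esub> C) \<otimes>\<^bsub>W\<^esub> (z \<otimes>\<^bsub>W\<^esub> B \<otimes>\<^bsub>W\<^esub> D) \<otimes>\<^bsub>W\<^esub> n \<otimes>\<^bsub>W\<^esub> n"
      using yz c by (simp add: W.m_ac)
    also have "\<dots> = lift f y \<otimes>\<^bsub>W\<^esub> lift f z"
      using yz c by (simp add: W_cancel) (simp add: lift_def A_def B_def C_def D_def)
    finally show "lift f (y \<otimes>\<^bsub>W\<^esub> z) = lift f y \<otimes>\<^bsub>W\<^esub> lift f z" .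
  qed
  have inv_closed: "inv_into (carrier V) f a \<in> carrier V" if "a \<in> carrier V" for a
    using f_bij that by (metis bij_betw_def inv_into_into)
  have "bij_betw (lift f) (carrier W) (carrier W)"
  proof (rule bij_betw_byWitness[of _ "lift (inv_into (carrier V) f)"])
    show "\<forall>y\<in>carrier W. lift (inv_into (carrier V) f) (lift f y) = y"
      by (intro ballI lift_inverse[OF f_closed inv_closed] bij_betw_inv_into_left[OF f_bij])
    show "\<forall>y\<in>carrier W. lift f (lift (inv_into (carrier V) f) y) = y"
      by (intro ballI lift_inverse[OF inv_closed f_closed] bij_betw_inv_into_right[OF f_bij])
  qed (use lift_closed[OF f_closed] lift_closed[OF inv_closed] in auto)
  then have lift_auto: "lift f \<in> auto W"
    using lift_hom by (simp add: auto_def Bij_def lift_def)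
  have f1: "f \<one>\<^bsub>V\<^esub> = \<one>\<^bsub>V\<^esub>" using hom_one[OF f_hom] by simp
  have lift0: "lift f (\<nu> 0) = \<nu> 0"
    using \<nu>0_closed by (simp add: lift_def p(3) f1 s_one)
  have "section_lift W g \<sigma> \<nu> s f = lift f"
    unfolding section_lift_def
  proof (rule the_equality)
    show "lift f \<in> auto W \<and> lift f (\<nu> 0) = \<nu> 0 \<and> (\<forall>i\<in>{1..2 * g}. lift f (s (\<sigma> i)) = s (f (\<sigma> i)))"
      by (intro conjI ballI lift_auto lift0 lift_section[OF f_closed] \<sigma>_closed)
    fix k assume k: "k \<in> auto W \<and> k (\<nu> 0) = \<nu> 0 \<and> (\<forall>i\<in>{1..2 * g}. k (s (\<sigma> i)) = s (f (\<sigma> i)))"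
    then have k_hom: "k \<in> hom W W" and k_ext: "k \<in> extensional (carrier W)"
      by (auto simp: auto_def Bij_def)
    show "k = lift f"
    proof (rule extensionalityI[OF k_ext])
      show "lift f \<in> extensional (carrier W)" by (simp add: lift_def)
      show "k y = lift f y" if y: "y \<in> carrier W" for y
        using k lift0 lift_section[OF f_closed] \<sigma>_closed
        by (intro W_hom_eqI[OF W.is_group k_hom lift_hom _ _ y]) auto
    qed
  qed
  then show "section_lift W g \<sigma> \<nu> s f \<in> hom W W"
    "section_lift W g \<sigma> \<nu> s f (\<nu> 0) = \<nu> 0"
    "\<And>a. a \<in> carrier V \<Longrightarrow> section_lift W g \<sigma> \<nu> s f (s a) = s (f a)"
    using lift_hom lift0 lift_section[OF f_closed] by simp_all
qed

end

lemma orbits_pullback: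
  assumes \<Phi>: "bij_betw \<Phi> E Q"
    and closed: "\<And>f x. f \<in> carrier S \<Longrightarrow> x \<in> E \<Longrightarrow> \<alpha> f x \<in> E"
    and equivariant: "\<And>f x. f \<in> carrier S \<Longrightarrow> x \<in> E \<Longrightarrow> \<Phi> (\<alpha> f x) = \<beta> f (\<Phi> x)"
  shows "orbits S E \<alpha> = (\<lambda>O'. {x \<in> E. \<Phi> x \<in> O'}) ` orbits S Q \<beta>"
proof -
  have inj: "inj_on \<Phi> E" and surj: "\<Phi> ` E = Q" using \<Phi> by (auto simp: bij_betw_def)
  have pull: "{y \<in> E. \<Phi> y \<in> orbit S \<beta> (\<Phi> x)} = orbit S \<alpha> x" if x: "x \<in> E" for x
  proof (intro subset_antisym subsetI)
    fix y assume "y \<in> {y \<in> E. \<Phi> y \<in> orbit S \<beta> (\<Phi> x)}"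
    then obtain f where f: "y \<in> E" "f \<in> carrier S" "\<Phi> y = \<beta> f (\<Phi> x)" by (auto simp: orbit_def)
    then have "\<Phi> y = \<Phi> (\<alpha> f x)" using equivariant x by simp
    then have "y = \<alpha> f x" using inj_onD[OF inj] f closed x by blast
    then show "y \<in> orbit S \<alpha> x" using f(2) unfolding orbit_def by blast
  next
    fix y assume "y \<in> orbit S \<alpha> x"
    then obtain f where f: "f \<in> carrier S" "y = \<alpha> f x" by (auto simp: orbit_def)
    then have "y \<in> E" "\<Phi> y = \<beta> f (\<Phi> x)" using closed equivariant x by auto
    then show "y \<in> {y \<in> E. \<Phi> y \<in> orbit S \<beta> (\<Phi> x)}" using f(1) unfolding orbit_def by blast
  qed
  have "orbits S E \<alpha> = orbit S \<alpha> ` E" "orbits S Q \<beta> = orbit S \<beta> ` \<Phi> ` E"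
    unfolding surj by (auto simp: orbits_def)
  then show ?thesis using pull by (simp add: image_image cong: image_cong)
qed

context quadratic_section_action
begin

lemma linear_factor_eqI:
  assumes \<psi>: "\<psi> \<in> hom W Z2" "\<psi> \<in> extensional (carrier W)"
    and factor: "\<And>x. x \<in> carrier G \<Longrightarrow> \<phi> x = \<psi> (h x)"
  shows "linear_factor G h W \<phi> = \<psi>"
  unfolding linear_factor_def
proof (rule the_equality)
  show "\<psi> \<in> hom W Z2 \<inter> extensional (carrier W) \<and> (\<forall>a\<in>carrier G. \<phi> a = \<psi> (h a))"
    using assms by simp
  fix \<psi>' assume \<psi>': "\<psi>' \<in> hom W Z2 \<inter> extensional (carrier W) \<and> (\<forall>a\<in>carrier G. \<phi> a = \<psi>' (h a))"
  show "\<psi>' = \<psi>"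
  proof (rule extensionalityI)
    show "\<psi>' y = \<psi> y" if y: "y \<in> carrier W" for y
    proof -
      obtain x where "x \<in> carrier G" "y = h x" using y h_surj by (metis imageE)
      then show ?thesis using \<psi>' factor[of x] by simp
    qed
  qed (use \<psi> \<psi>' in auto)
qed

lemma linear_factor:
  assumes \<phi>: "\<phi> \<in> hom G Z2"
  shows "linear_factor G h W \<phi> \<in> hom W Z2" "linear_factor G h W \<phi> \<in> extensional (carrier W)"
    "\<And>x. x \<in> carrier G \<Longrightarrow> \<phi> x = linear_factor G h W \<phi> (h x)"
proof -
  obtain \<psi> where \<psi>: "\<psi> \<in> hom W Z2" "\<forall>x\<in>carrier G. \<phi> x = \<psi> (h x)" using h_factor[OF \<phi>] by blast
  have h: "h x \<in> carrier W" if "x \<in> carrier G" for x using h_hom that by (auto simp: hom_def)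
  have "restrict \<psi> (carrier W) \<in> hom W Z2" using \<psi>(1) unfolding hom_Z2_iff by simp
  moreover have "\<phi> x = restrict \<psi> (carrier W) (h x)" if "x \<in> carrier G" for x
    using \<psi>(2) h that by simp
  moreover from calculation have "linear_factor G h W \<phi> = restrict \<psi> (carrier W)"
    by (intro linear_factor_eqI) auto
  ultimately show "linear_factor G h W \<phi> \<in> hom W Z2"
    "linear_factor G h W \<phi> \<in> extensional (carrier W)"
    "\<And>x. x \<in> carrier G \<Longrightarrow> \<phi> x = linear_factor G h W \<phi> (h x)"
    by simp_all
qed

abbreviation coverings :: "('c \<Rightarrow> int) set" where
  "coverings \<equiv> special_coverings G u0"

text \<open>The quadratic form of a covering: a linear form on \<open>W\<close> with value 1 on \<open>\<nu> 0\<close> turns the deviation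
  of \<open>s\<close> from linearity into the bilinear form.\<close>

definition form :: "('c \<Rightarrow> int) \<Rightarrow> 'a \<Rightarrow> int" where
  "form \<phi> = restrict (linear_factor G h W \<phi> \<circ> s) (carrier V)"

lemma coveringD:
  assumes "\<phi> \<in> coverings"
  shows "\<phi> \<in> hom G Z2" "\<phi> \<in> extensional (carrier G)" "linear_factor G h W \<phi> (\<nu> 0) = 1"
proof -
  show *: "\<phi> \<in> hom G Z2" "\<phi> \<in> extensional (carrier G)" using assms by (auto simp: special_coverings_def)
  have "\<phi> u0 = 1" using assms by (simp add: special_coverings_def)
  then show "linear_factor G h W \<phi> (\<nu> 0) = 1" using linear_factor(3)[OF *(1) u0(1)] u0(2) by simp
qed

lemma coveringI:
  assumes \<psi>: "\<psi> \<in> hom W Z2" "\<psi> (\<nu> 0) = 1"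
  shows "restrict (\<psi> \<circ> h) (carrier G) \<in> coverings"
    "linear_factor G h W (restrict (\<psi> \<circ> h) (carrier G)) = restrict \<psi> (carrier W)"
proof -
  have h: "h x \<in> carrier W" if "x \<in> carrier G" for x using h_hom that by (auto simp: hom_def)
  have "restrict (\<psi> \<circ> h) (carrier G) \<in> hom G Z2"
    using \<psi>(1) h hom_mult[OF h_hom] unfolding hom_Z2_iff by simp
  then show "restrict (\<psi> \<circ> h) (carrier G) \<in> coverings"
    using \<psi>(2) u0 by (simp add: special_coverings_def)
  have "restrict \<psi> (carrier W) \<in> hom W Z2" using \<psi>(1) unfolding hom_Z2_iff by simp
  then show "linear_factor G h W (restrict (\<psi> \<circ> h) (carrier G)) = restrict \<psi> (carrier W)"
    using h by (intro linear_factor_eqI) auto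
qed

lemma pullback_form:
  assumes \<psi>: "\<psi> \<in> hom W Z2" "\<psi> (\<nu> 0) = 1"
  shows "restrict (\<psi> \<circ> s) (carrier V) \<in> V.quadratic_forms"
proof -
  have val: "\<psi> y = 0 \<or> \<psi> y = 1" if "y \<in> carrier W" for y
    using \<psi>(1) that unfolding hom_Z2_iff by auto
  have "\<psi> (s (a \<otimes>\<^bsub>V\<^esub> b)) = (\<psi> (s a) + \<psi> (s b) + dot a b) mod 2"
    if ab: "a \<in> carrier V" "b \<in> carrier V" for a b
  proof -
    have c: "s a \<in> carrier W" "s b \<in> carrier W" "\<nu> 0 [^]\<^bsub>W\<^esub> dot a b \<in> carrier W"
      using ab s_closed \<nu>0_closed by auto
    have "\<psi> (\<nu> 0 [^]\<^bsub>W\<^esub> dot a b) = dot a b mod 2"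
      using hom_Z2_int_pow[OF W.is_group \<psi>(1) \<nu>0_closed] \<psi>(2) by simp
    then have "\<psi> (s (a \<otimes>\<^bsub>V\<^esub> b)) = ((\<psi> (s a) + \<psi> (s b)) mod 2 + dot a b mod 2) mod 2"
      unfolding s_mult[OF ab] using hom_mult[OF \<psi>(1), of "s a \<otimes>\<^bsub>W\<^esub> s b"] hom_mult[OF \<psi>(1) c(1,2)] c
      by simp
    then show ?thesis by (simp add: mod_add_eq)
  qed
  then show ?thesis
    unfolding V.quadratic_forms_def using val s_closed by auto
qed

text \<open>A linear form on \<open>W\<close> with value 1 on \<open>\<nu> 0\<close> is determined by its values on the vectors
  \<open>s (\<sigma> i)\<close>, which can be prescribed, and the same holds for a quadratic form and its values on the
  \<open>\<sigma> i\<close>.\<close>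

lemma bij_form: "bij_betw form coverings V.quadratic_forms"
  unfolding bij_betw_def
proof
  show "inj_on form coverings"
  proof (rule inj_onI)
    fix \<phi> \<phi>' assume \<phi>: "\<phi> \<in> coverings" and \<phi>': "\<phi>' \<in> coverings" and eq: "form \<phi> = form \<phi>'"
    note lf = linear_factor[OF coveringD(1)[OF \<phi>]] and lf' = linear_factor[OF coveringD(1)[OF \<phi>']]
    have "linear_factor G h W \<phi> y = linear_factor G h W \<phi>' y" if y: "y \<in> carrier W" for y
    proof (rule W_hom_eqI[OF _ lf(1) lf'(1) _ _ y])
      show "linear_factor G h W \<phi> (\<nu> 0) = linear_factor G h W \<phi>' (\<nu> 0)"
        using coveringD(3)[OF \<phi>] coveringD(3)[OF \<phi>'] by simp
      show "linear_factor G h W \<phi> (s (\<sigma> i)) = linear_factor G h W \<phi>' (s (\<sigma> i))" if "i \<in> {1..2 * g}" for i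
        using fun_cong[OF eq, of "\<sigma> i"] \<sigma>_closed[OF that] by (simp add: form_def)
    qed simp
    then have "\<phi> x = \<phi>' x" if "x \<in> carrier G" for x
      using lf(3)[OF that] lf'(3)[OF that] h_hom that by (auto simp: hom_def)
    then show "\<phi> = \<phi>'"
      by (rule extensionalityI[OF coveringD(2)[OF \<phi>] coveringD(2)[OF \<phi>']])
  qed
  show "form ` coverings = V.quadratic_forms"
  proof (intro subset_antisym subsetI)
    fix \<omega> assume "\<omega> \<in> form ` coverings"
    then show "\<omega> \<in> V.quadratic_forms"
      using pullback_form linear_factor(1) coveringD(1,3) unfolding form_def by blast
  next
    fix \<omega> assume \<omega>: "\<omega> \<in> V.quadratic_forms"
    \<comment> \<open>The summand \<open>r i\<close> compensates for the factor \<open>\<nu> 0 [^] r i\<close> in \<open>s (\<sigma> i)\<close>.\<close>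
    obtain \<psi> where \<psi>: "\<psi> \<in> hom W Z2"
      "\<And>i. i \<in> {0..2 * g} \<Longrightarrow> \<psi> (\<nu> i) = (if i = 0 then 1 else \<omega> (\<sigma> i) + r i) mod 2"
      using \<nu>_characters[of "\<lambda>i. if i = 0 then 1 else \<omega> (\<sigma> i) + r i"] by blast
    have \<psi>0: "\<psi> (\<nu> 0) = 1" using \<psi>(2)[of 0] by simp
    let ?\<omega> = "restrict (\<psi> \<circ> s) (carrier V)"
    have pull: "?\<omega> \<in> V.quadratic_forms" using pullback_form[OF \<psi>(1) \<psi>0] .
    have basis: "?\<omega> (\<sigma> i) = \<omega> (\<sigma> i)" if i: "i \<in> {1..2 * g}" for i
    proof -
      have c: "\<nu> i \<in> carrier W" "\<nu> 0 [^]\<^bsub>W\<^esub> r i \<in> carrier W" using i \<nu>_closed \<nu>0_closed by auto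
      have "\<psi> (\<nu> 0 [^]\<^bsub>W\<^esub> r i) = r i mod 2"
        using hom_Z2_int_pow[OF W.is_group \<psi>(1) \<nu>0_closed] \<psi>0 by simp
      then have "\<psi> (s (\<sigma> i)) = ((\<omega> (\<sigma> i) + r i) mod 2 + r i mod 2) mod 2"
        unfolding s_basis[OF i] using hom_mult[OF \<psi>(1) c] \<psi>(2)[of i] i by simp
      then show ?thesis
        using V.form_values[OF \<omega> \<sigma>_closed[OF i]] r_values[OF i] \<sigma>_closed[OF i] by auto
    qed
    have "(?\<omega> a + \<omega> a) mod 2 = 0" if a: "a \<in> carrier V" for a
    proof (rule V_hom_eqI[OF _ V.forms_differ_by_hom[OF pull \<omega>] _ _ a])
      show "(\<lambda>_. 0) \<in> hom V Z2" by (simp add: hom_Z2_iff)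
      show "(?\<omega> (\<sigma> i) + \<omega> (\<sigma> i)) mod 2 = 0" if "i \<in> {1..2 * g}" for i
        unfolding basis[OF that] by simp
    qed simp
    then have eq: "?\<omega> a = \<omega> a" if a: "a \<in> carrier V" for a
      using V.form_values[OF pull a] V.form_values[OF \<omega> a] a by fastforce
    have "\<omega> \<in> extensional (carrier V)"
      using \<omega> by (auto simp: V.quadratic_forms_def PiE_def)
    then have "?\<omega> = \<omega>" using eq by (intro extensionalityI[OF restrict_extensional])
    moreover have "form (restrict (\<psi> \<circ> h) (carrier G)) = ?\<omega>"
      unfolding form_def coveringI(2)[OF \<psi>(1) \<psi>0] using s_closed by (auto simp: restrict_def)
    ultimately show "\<omega> \<in> form ` coverings" using coveringI(1)[OF \<psi>(1) \<psi>0] by (metis image_eqI)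
  qed
qed

text \<open>Since the lift of \<open>f\<close> satisfies \<open>f\<^sub>s \<circ> s = s \<circ> f\<close>, the covering obtained from \<open>\<phi>\<close> by the action of \<open>f\<close>
  has the quadratic form of \<open>\<phi>\<close> composed with \<open>f\<close>.\<close>

lemma s_action_equivariant:
  assumes f: "f \<in> carrier (Sp V dot)" and \<phi>: "\<phi> \<in> coverings"
  shows "s_action G h W g \<sigma> \<nu> s f \<phi> \<in> coverings"
    "form (s_action G h W g \<sigma> \<nu> s f \<phi>) = V.act f (form \<phi>)"
proof -
  let ?k = "section_lift W g \<sigma> \<nu> s f"
  let ?\<psi> = "linear_factor G h W \<phi> \<circ> ?k"
  note lf = linear_factor[OF coveringD(1)[OF \<phi>]]
  have \<psi>: "?\<psi> \<in> hom W Z2"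
    using hom_compose[OF section_lift(1)[OF f] lf(1)] .
  have \<psi>0: "?\<psi> (\<nu> 0) = 1"
    using section_lift(2)[OF f] coveringD(3)[OF \<phi>] by simp
  have act: "s_action G h W g \<sigma> \<nu> s f \<phi> = restrict (?\<psi> \<circ> h) (carrier G)"
    unfolding s_action_def ..
  show "s_action G h W g \<sigma> \<nu> s f \<phi> \<in> coverings"
    unfolding act by (rule coveringI(1)[OF \<psi> \<psi>0])
  show "form (s_action G h W g \<sigma> \<nu> s f \<phi>) = V.act f (form \<phi>)"
  proof
    fix a
    show "form (s_action G h W g \<sigma> \<nu> s f \<phi>) a = V.act f (form \<phi>) a"
    proof (cases "a \<in> carrier V")
      case True
      then show ?thesis
        unfolding form_def act coveringI(2)[OF \<psi> \<psi>0] V.act_def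
        using s_closed[OF True] section_lift(3)[OF f True] V.SpD(4)[OF f True] by simp
    qed (simp add: form_def V.act_def)
  qed
qed

theorem s_action_orbits:
  obtains O1 O2 where "O1 \<noteq> O2"
    "orbits (Sp V dot) coverings (s_action G h W g \<sigma> \<nu> s) = {O1, O2}"
    "card O1 = 2 ^ (g - 1) * (2 ^ g + 1)" "card O2 = 2 ^ (g - 1) * (2 ^ g - 1)"
proof -
  obtain \<psi> where \<psi>: "\<psi> \<in> hom W Z2" "\<forall>i\<in>{0..2 * g}. \<psi> (\<nu> i) = 1 mod 2"
    using \<nu>_characters[of "\<lambda>_. 1"] by blast
  then have "restrict (\<psi> \<circ> s) (carrier V) \<in> V.quadratic_forms" by (intro pullback_form) auto
  then obtain O1 O2 where O: "O1 \<noteq> O2" "orbits (Sp V dot) V.quadratic_forms V.act = {O1, O2}"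
    "card O1 = 2 ^ (g - 1) * (2 ^ g + 1)" "card O2 = 2 ^ (g - 1) * (2 ^ g - 1)"
    using V.orbits_of_quadratic_forms by blast
  define T where "T O' = {\<phi> \<in> coverings. form \<phi> \<in> O'}" for O'
  have orbits: "orbits (Sp V dot) coverings (s_action G h W g \<sigma> \<nu> s) = {T O1, T O2}"
  proof -
    have "orbits (Sp V dot) coverings (s_action G h W g \<sigma> \<nu> s)
        = T ` orbits (Sp V dot) V.quadratic_forms V.act"
      unfolding T_def by (rule orbits_pullback[OF bij_form]) (rule s_action_equivariant; assumption)+
    then show ?thesis by (simp add: O(2))
  qed
  have "O1 \<subseteq> V.quadratic_forms" "O2 \<subseteq> V.quadratic_forms"
  proof -
    have "O' \<subseteq> V.quadratic_forms" if "O' \<in> orbits (Sp V dot) V.quadratic_forms V.act" for O'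
      using that V.act_form by (auto simp: orbits_def orbit_def)
    then show "O1 \<subseteq> V.quadratic_forms" "O2 \<subseteq> V.quadratic_forms" unfolding O(2) by auto
  qed
  moreover have image: "form ` T O' = O'" if "O' \<subseteq> V.quadratic_forms" for O'
  proof -
    have "form ` coverings = V.quadratic_forms" using bij_form by (simp add: bij_betw_def)
    then show ?thesis using that unfolding T_def by auto
  qed
  moreover have "card (form ` T O') = card (T O')" for O'
    using bij_form by (intro card_image) (auto simp: bij_betw_def T_def intro: inj_on_subset)
  ultimately have "T O1 \<noteq> T O2" "card (T O1) = card O1" "card (T O2) = card O2"
    using O(1) by metis+
  then show ?thesis using that[OF _ orbits] O(3,4) by simp
qed

end

text \<open>The topological input for the algebra: the Hurewicz map is surjective and all characters
  factor through it, the total space being path connected, and the presentation yields the characters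
  dual to the generators.\<close>

lemma bundle_quadratic_section_action:
  fixes F :: "'f::t2_space set" and P :: "'p::t2_space set" and u :: "nat \<Rightarrow> (real \<Rightarrow> 'p) set"
    and \<sigma> :: "nat \<Rightarrow> 'f chain set"
  assumes g: "g \<ge> 1" and P: "path_connected P" "e \<in> P" and q: "even q"
    and pres: "bundle_presentation g q (pi1 P e) u"
    and symp: "symplectic_basis (H1 F) dot g \<sigma>"
    and sec: "quadratic_section (H1 F) dot (H1 P) g \<sigma> (\<lambda>i. hurewicz P (u i)) r s"
  shows "quadratic_section_action (H1 F) dot g (H1 P) (pi1 P e) (hurewicz P) (u 0) \<sigma>
    (\<lambda>i. hurewicz P (u i)) r s"
proof -
  have pres': "presented_by (pi1 P e) u {0..2 * g}
      ((\<lambda>i. commutator_word i 0) ` {1..2 * g} \<union> {surface_word g @ [(0, q)]})"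
    using pres by (simp add: bundle_presentation_def)
  note G = presented_byD(1)[OF pres'] and u = presented_byD(2)[OF pres']
  note HP = comm_group_homology_mod2[of 1 "top_of_set P"]
  have group_HP: "group (H1 P)" using HP by (rule comm_group.axioms(2))
  note surj = hurewicz_surj[OF P]
  have basis: "Z2_basis (H1 F) \<sigma> {1..2 * g}" using symp by (simp add: symplectic_basis_def)
  have image: "(\<lambda>i. hurewicz P (u i)) ` {0..2 * g} = hurewicz P ` u ` {0..2 * g}"
    by (simp add: image_image)
  have characters: "\<exists>\<psi>\<in>hom (H1 P) Z2. \<forall>i\<in>{0..2 * g}. \<psi> (hurewicz P (u i)) = a i mod 2"
    for a :: "nat \<Rightarrow> int"
  proof -
    obtain \<phi> where \<phi>: "\<phi> \<in> hom (pi1 P e) Z2" "\<And>i. i \<in> {0..2 * g} \<Longrightarrow> \<phi> (u i) = a i mod 2"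
      using bundle_presentation_character[OF pres q] by blast
    obtain \<psi> where \<psi>: "\<psi> \<in> hom (H1 P) Z2"
      "\<And>x. x \<in> carrier (pi1 P e) \<Longrightarrow> \<phi> x = \<psi> (hurewicz P x)"
      using hurewicz_factor[OF P \<phi>(1)] by blast
    have "\<psi> (hurewicz P (u i)) = a i mod 2" if i: "i \<in> {0..2 * g}" for i
    proof -
      have "u i \<in> carrier (pi1 P e)" using u i by blast
      then show ?thesis using \<psi>(2)[of "u i"] \<phi>(2)[OF i] by simp
    qed
    then show ?thesis using \<psi>(1) by blast
  qed
  have generate: "generate (H1 P) (hurewicz P ` u ` {0..2 * g}) = carrier (H1 P)"
    using group_hom.generate_img[of "pi1 P e" "H1 P" "hurewicz P" "u ` {0..2 * g}"] G group_HP u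
      hurewicz_hom[of P e] presented_by_generate[OF pres'] surj
    by (simp add: group_hom_def group_hom_axioms_def)
  have space: "symplectic_Z2_space (H1 F) dot g"
    using comm_group_homology_mod2 homology_mod2_exponent_2 symp g by (rule symplectic_basis_space)
  show ?thesis
  proof (intro quadratic_section_action.intro quadratic_section_action_axioms.intro space HP G)
    show "y \<otimes>\<^bsub>H1 P\<^esub> y = \<one>\<^bsub>H1 P\<^esub>" if "y \<in> carrier (H1 P)" for y
      using that by (rule homology_mod2_exponent_2)
    show "hurewicz P \<in> hom (pi1 P e) (H1 P)" by (rule hurewicz_hom)
    show "hurewicz P ` carrier (pi1 P e) = carrier (H1 P)" by (rule surj)
    show "\<exists>\<psi>\<in>hom (H1 P) Z2. \<forall>x\<in>carrier (pi1 P e). \<phi> x = \<psi> (hurewicz P x)"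
      if "\<phi> \<in> hom (pi1 P e) Z2" for \<phi>
      using hurewicz_factor[OF P that] by metis
    show "u 0 \<in> carrier (pi1 P e)" using u by auto
    show "\<sigma> ` {1..2 * g} \<subseteq> carrier (H1 F)" using basis by (simp add: Z2_basis_def)
    show "generate (H1 F) (\<sigma> ` {1..2 * g}) = carrier (H1 F)"
      using comm_group_homology_mod2 basis by (rule Z2_basis_generate)
    show "(\<lambda>i. hurewicz P (u i)) ` {0..2 * g} \<subseteq> carrier (H1 P)"
      unfolding image using u surj by (metis image_mono)
    show "generate (H1 P) ((\<lambda>i. hurewicz P (u i)) ` {0..2 * g}) = carrier (H1 P)"
      unfolding image by (rule generate)
  qed (rule refl characters sec HOL.refl)+
qed

theorem theorem1:
  fixes g :: nat and q :: int
    and F :: "'f::t2_space set" and P :: "'p::t2_space set"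
    and p :: "'p \<Rightarrow> 'f" and act :: "complex \<Rightarrow> 'p \<Rightarrow> 'p" and e :: 'p
    and c :: "(real \<Rightarrow> complex) set"
    and x :: "nat \<Rightarrow> (real \<Rightarrow> 'f) set" and u :: "nat \<Rightarrow> (real \<Rightarrow> 'p) set"
    and \<sigma> :: "nat \<Rightarrow> 'f chain set" and \<nu> :: "nat \<Rightarrow> 'p chain set"
    and dot :: "'f chain set \<Rightarrow> 'f chain set \<Rightarrow> int"
  assumes genus: "g \<ge> 1"
    and surface: "closed_orientable_surface F"
    and principal: "principal_circle_bundle P p F act"
    and chern: "has_chern_number P p F act q" "even q"
    and basepoint: "e \<in> P"
    and x: "surface_presentation g (pi1 F (p e)) x"
    and fibre_generator: "c \<in> carrier (pi1 (sphere 0 1) 1)"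
      "generate (pi1 (sphere 0 1) 1) {c} = carrier (pi1 (sphere 0 1) 1)"
    and u0: "u 0 = pi1_map P (\<lambda>z. act z e) c"
    and u: "\<And>i. i \<in> {1..2 * g} \<Longrightarrow> u i \<in> carrier (pi1 P e) \<and> pi1_map F p (u i) = x i"
    and presentation: "bundle_presentation g q (pi1 P e) u"
    and \<sigma>: "\<sigma> = (\<lambda>i. hurewicz F (x i))"
    and \<nu>: "\<nu> = (\<lambda>i. hurewicz P (u i))"
    and dot: "dot = intersection_product F"
    and symplectic: "symplectic_basis (H1 F) dot g \<sigma>"
  shows "(\<forall>r s. quadratic_section (H1 F) dot (H1 P) g \<sigma> \<nu> r s \<longrightarrow>
      (\<exists>O1 O2. O1 \<noteq> O2 \<and> s_orbits P e u F dot g \<sigma> \<nu> s = {O1, O2} \<and>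
         card O1 = 2 ^ (g - 1) * (2 ^ g + 1) \<and> card O2 = 2 ^ (g - 1) * (2 ^ g - 1))) \<and>
    (\<forall>r s r' s'. quadratic_section (H1 F) dot (H1 P) g \<sigma> \<nu> r s \<longrightarrow>
      quadratic_section (H1 F) dot (H1 P) g \<sigma> \<nu> r' s' \<longrightarrow>
      card (s_orbits P e u F dot g \<sigma> \<nu> s) = card (s_orbits P e u F dot g \<sigma> \<nu> s') \<and>
      (\<exists>\<beta>. bij_betw \<beta> (s_orbits P e u F dot g \<sigma> \<nu> s) (s_orbits P e u F dot g \<sigma> \<nu> s') \<and>
         (\<forall>A\<in>s_orbits P e u F dot g \<sigma> \<nu> s. card (\<beta> A) = card A)))"
proof -
  let ?orbits = "s_orbits P e u F dot g \<sigma> \<nu>"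
  have P: "path_connected P" using path_connected_total_space[OF surface principal] .
  have two_orbits: "\<exists>O1 O2. O1 \<noteq> O2 \<and> ?orbits s = {O1, O2} \<and>
      card O1 = 2 ^ (g - 1) * (2 ^ g + 1) \<and> card O2 = 2 ^ (g - 1) * (2 ^ g - 1)"
    if "quadratic_section (H1 F) dot (H1 P) g \<sigma> \<nu> r s" for r s
  proof -
    interpret quadratic_section_action "H1 F" dot g "H1 P" "pi1 P e" "hurewicz P" "u 0" \<sigma> \<nu> r s
      using bundle_quadratic_section_action[OF genus P basepoint chern(2) presentation symplectic] that
      unfolding \<nu> by blast
    show ?thesis using s_action_orbits by metis
  qed
  have same_sizes: "card (?orbits s) = card (?orbits s') \<and>
      (\<exists>\<beta>. bij_betw \<beta> (?orbits s) (?orbits s') \<and> (\<forall>A\<in>?orbits s. card (\<beta> A) = card A))"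
    if s: "quadratic_section (H1 F) dot (H1 P) g \<sigma> \<nu> r s"
      and s': "quadratic_section (H1 F) dot (H1 P) g \<sigma> \<nu> r' s'" for r s r' s'
  proof -
    obtain O1 O2 where O: "O1 \<noteq> O2" "?orbits s = {O1, O2}"
      "card O1 = 2 ^ (g - 1) * (2 ^ g + 1)" "card O2 = 2 ^ (g - 1) * (2 ^ g - 1)"
      using two_orbits[OF s] by blast
    obtain O1' O2' where O': "O1' \<noteq> O2'" "?orbits s' = {O1', O2'}"
      "card O1' = 2 ^ (g - 1) * (2 ^ g + 1)" "card O2' = 2 ^ (g - 1) * (2 ^ g - 1)"
      using two_orbits[OF s'] by blast
    \<comment> \<open>Orbits are matched by size.\<close>
    let ?\<beta> = "\<lambda>A. if A = O1 then O1' else O2'"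
    have "bij_betw ?\<beta> {O1, O2} {O1', O2'}"
      using O(1) O'(1) by (auto simp: bij_betw_def inj_on_def)
    moreover have "\<forall>A\<in>{O1, O2}. card (?\<beta> A) = card A"
      using O(1,3,4) O'(3,4) by simp
    ultimately show ?thesis
      unfolding O(2) O'(2) using O(1) O'(1) by (intro conjI exI[of _ ?\<beta>]) simp_all
  qed
  show ?thesis
  proof (rule conjI)
    show "\<forall>r s. quadratic_section (H1 F) dot (H1 P) g \<sigma> \<nu> r s \<longrightarrow>
        (\<exists>O1 O2. O1 \<noteq> O2 \<and> ?orbits s = {O1, O2} \<and>
          card O1 = 2 ^ (g - 1) * (2 ^ g + 1) \<and> card O2 = 2 ^ (g - 1) * (2 ^ g - 1))"
      by (intro allI impI) (rule two_orbits)
  qed (intro allI impI, rule same_sizes)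
qed

end
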